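(* For each integer $d\ge 1$, let $\Omega_d$ be the finite simplicial graph with vertex set $\{a_0,a_1,\dots,a_d,\;b_0,b_1,\dots,b_d,\;c_1,c_2\}$ and with exactly the following edges: $a_0a_i$ and $b_0a_i$ for $1\le i\le d$; $a_0b_1$ and $b_0b_1$; $b_ib_{i-1}$ and $b_ia_{i-1}$ for $2\le i\le d$; and $b_1c_1$, $c_1c_2$, $c_2a_d$. Let $G_{\Omega_d}$ be the associated right-angled Coxeter group. If $d_1$ and $d_2$ are two different positive integers, then $G_{\Omega_{d_1}}$ and $G_{\Omega_{d_2}}$ have different divergence spectra. Therefore, they are not quasi-isometric.
   Context: All metric spaces are proper geodesic metric spaces. For a finite simplicial graph $\Omega$, the associated right-angled Coxeter group $G_\Omega$ has generating set $S$ the vertices of $\Omega$ and relations $s^2=1$ for all $s\in S$ and $st=ts$ whenever $s,t$ are adjacent vertices. **Equivalence of functions.** For functions $f,g:[0,\infty)\to[0,\infty]$, $f\preceq g$ if there are positive constants $A,B,C,D$ with $f(x)\le Ag(Bx)+Cx$ for all $x>D$; $f\sim g$ if $f\preceq g$ and $g\preceq f$. (Values at $0$ are irrelevant.) **Geodesics.** A $(K,L)$-quasi-geodesic is a map $\gamma$ from an interval of $\mathbb{R}$ with $\frac1K|s-t|-L\le d(\gamma(s),\gamma(t))\le K|s-t|+L$; a geodesic is a $(1,0)$-quasi-geodesic. A quasi-geodesic $\gamma$ is Morse if for all $K\ge1$, $L>0$ there is a constant $M=M(K,L)$ such that every $(K,L)$-quasi-geodesic with endpoints on $\gamma$ lies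 in the $M$-neighborhood of $\gamma$. **Divergence spectrum.** For a bi-infinite geodesic $\alpha$, $r>0$ and $t\in\mathbb{R}$, let $\rho_\alpha(r,t)$ be the infimum of the lengths of all paths from $\alpha(t-r)$ to $\alpha(t+r)$ lying outside the open ball of radius $r$ about $\alpha(t)$ ($\infty$ if there are none). The lower divergence of $\alpha$ is $ldiv_\alpha(r)=\inf_{t\in\mathbb{R}}\rho_\alpha(r,t)$. The divergence spectrum $S_X$ of a space $X$ is the set of functions $f:[0,\infty)\to[0,\infty]$ such that $f\sim ldiv_\gamma$ for some Morse bi-infinite geodesic $\gamma$ in $X$. The divergence spectrum of a finitely generated group is that of its Cayley graph (edges of length 1) with respect to some (any) finite generating set. *)

theory Defs
  imports "HOL-Analysis.Analysis" "HOL-Algebra.Generated_Groups"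
begin

section \<open>Geodesics, divergence and quasi-isometries\<close>

text \<open>Functions \<open>[0,\<infinity>) \<rightarrow> [0,\<infinity>]\<close> are rendered with type \<open>real \<Rightarrow> ennreal\<close>; the relation below only
  looks at positive arguments.\<close>

definition fun_preceq :: "(real \<Rightarrow> ennreal) \<Rightarrow> (real \<Rightarrow> ennreal) \<Rightarrow> bool" where
  "fun_preceq f g \<longleftrightarrow>
     (\<exists>A>0. \<exists>B>0. \<exists>C>0. \<exists>D>0. \<forall>x>D. f x \<le> ennreal A * g (B * x) + ennreal (C * x))"

definition fun_equiv :: "(real \<Rightarrow> ennreal) \<Rightarrow> (real \<Rightarrow> ennreal) \<Rightarrow> bool" where
  "fun_equiv f g \<longleftrightarrow> fun_preceq f g \<and> fun_preceq g f"

context Metric_space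
begin

definition quasi_geodesic :: "real \<Rightarrow> real \<Rightarrow> real set \<Rightarrow> (real \<Rightarrow> 'a) \<Rightarrow> bool" where
  "quasi_geodesic K L I \<gamma> \<longleftrightarrow> is_interval I \<and> \<gamma> \<in> I \<rightarrow> M \<and>
     (\<forall>s\<in>I. \<forall>t\<in>I. 1 / K * \<bar>s - t\<bar> - L \<le> d (\<gamma> s) (\<gamma> t) \<and> d (\<gamma> s) (\<gamma> t) \<le> K * \<bar>s - t\<bar> + L)"

definition geodesic :: "real set \<Rightarrow> (real \<Rightarrow> 'a) \<Rightarrow> bool" where
  "geodesic I \<gamma> \<longleftrightarrow> quasi_geodesic 1 0 I \<gamma>"

text \<open>A quasi-geodesic has (two) endpoints precisely when its domain is a compact interval.\<close>

definition Morse :: "real set \<Rightarrow> (real \<Rightarrow> 'a) \<Rightarrow> bool" where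
  "Morse I \<gamma> \<longleftrightarrow> (\<exists>K\<ge>1. \<exists>L\<ge>0. quasi_geodesic K L I \<gamma>) \<and>
     (\<forall>K\<ge>1. \<forall>L>0. \<exists>N. \<forall>a b \<sigma>. a \<le> b \<longrightarrow> quasi_geodesic K L {a..b} \<sigma> \<longrightarrow>
        \<sigma> a \<in> \<gamma> ` I \<longrightarrow> \<sigma> b \<in> \<gamma> ` I \<longrightarrow>
        (\<forall>s\<in>{a..b}. \<exists>t\<in>I. d (\<sigma> s) (\<gamma> t) < N))"

definition path_length :: "(real \<Rightarrow> 'a) \<Rightarrow> ennreal" where
  "path_length p =
     (SUP ts\<in>{ts. sorted ts \<and> set ts \<subseteq> {0..1}}.
        \<Sum>i<length ts - 1. ennreal (d (p (ts ! i)) (p (ts ! Suc i))))"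

text \<open>The infimum of the empty set is \<open>\<infinity>\<close> in type \<^typ>\<open>ennreal\<close>.\<close>

definition divergence_at :: "(real \<Rightarrow> 'a) \<Rightarrow> real \<Rightarrow> real \<Rightarrow> ennreal" where
  "divergence_at \<alpha> r t =
     (INF p\<in>{p. pathin mtopology p \<and> p 0 = \<alpha> (t - r) \<and> p 1 = \<alpha> (t + r) \<and>
                p ` {0..1} \<inter> mball (\<alpha> t) r = {}}. path_length p)"

definition lower_divergence :: "(real \<Rightarrow> 'a) \<Rightarrow> real \<Rightarrow> ennreal" where
  "lower_divergence \<alpha> r = (INF t. divergence_at \<alpha> r t)"

definition divergence_spectrum :: "(real \<Rightarrow> ennreal) set" where
  "divergence_spectrum =
     {f \<in> {0..} \<rightarrow>\<^sub>E UNIV.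
        \<exists>\<gamma>. geodesic UNIV \<gamma> \<and> Morse UNIV \<gamma> \<and> fun_equiv f (lower_divergence \<gamma>)}"

end

definition quasi_isometric ::
  "'a set \<Rightarrow> ('a \<Rightarrow> 'a \<Rightarrow> real) \<Rightarrow> 'b set \<Rightarrow> ('b \<Rightarrow> 'b \<Rightarrow> real) \<Rightarrow> bool" where
  "quasi_isometric X dX Y dY \<longleftrightarrow>
     (\<exists>f K L. f \<in> X \<rightarrow> Y \<and> K \<ge> 1 \<and> L \<ge> 0 \<and>
        (\<forall>x\<in>X. \<forall>y\<in>X. 1 / K * dX x y - L \<le> dY (f x) (f y) \<and> dY (f x) (f y) \<le> K * dX x y + L) \<and>
        (\<forall>y\<in>Y. \<exists>x\<in>X. dY (f x) y \<le> L))"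


section \<open>Graphs as metric spaces\<close>

text \<open>A simplicial graph is given by its vertex set \<open>V\<close> and a set \<open>E\<close> of two-element subsets
  of \<open>V\<close>. Points of the geometric realization are given by barycentric coordinates:
  \<open>edge_point u v t\<close> is the point at distance \<open>t\<close> from \<open>u\<close> on the unit-length edge \<open>{u, v}\<close>.\<close>

definition simplicial_graph :: "'v set \<Rightarrow> 'v set set \<Rightarrow> bool" where
  "simplicial_graph V E \<longleftrightarrow> (\<forall>e\<in>E. e \<subseteq> V \<and> card e = 2)"

definition edge_point :: "'v \<Rightarrow> 'v \<Rightarrow> real \<Rightarrow> 'v \<Rightarrow> real" where
  "edge_point u v t = (\<lambda>w. (1 - t) * indicator {u} w + t * indicator {v} w)"

definition graph_points :: "'v set \<Rightarrow> 'v set set \<Rightarrow> ('v \<Rightarrow> real) set" where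
  "graph_points V E =
     {edge_point u u 0 |u. u \<in> V} \<union> {edge_point u v t |u v t. {u, v} \<in> E \<and> t \<in> {0..1}}"

text \<open>\<open>graph_chain V E x y l\<close>: there is a chain of segments, each contained in one closed edge,
  from \<open>x\<close> to \<open>y\<close> of total length \<open>l\<close>.\<close>

inductive graph_chain :: "'v set \<Rightarrow> 'v set set \<Rightarrow> ('v \<Rightarrow> real) \<Rightarrow> ('v \<Rightarrow> real) \<Rightarrow> real \<Rightarrow> bool"
  for V E where
  nil: "x \<in> graph_points V E \<Longrightarrow> graph_chain V E x x 0"
| step: "\<lbrakk>{u, v} \<in> E; s \<in> {0..1}; t \<in> {0..1}; graph_chain V E (edge_point u v t) y l\<rbrakk>
    \<Longrightarrow> graph_chain V E (edge_point u v s) y (\<bar>s - t\<bar> + l)"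

text \<open>The value \<open>0\<close> is a dummy that only occurs outside \<open>graph_points V E\<close> when the graph is
  connected.\<close>

definition graph_dist :: "'v set \<Rightarrow> 'v set set \<Rightarrow> ('v \<Rightarrow> real) \<Rightarrow> ('v \<Rightarrow> real) \<Rightarrow> real" where
  "graph_dist V E x y =
     (if \<exists>l. graph_chain V E x y l then Inf {l. graph_chain V E x y l} else 0)"


section \<open>Cayley graphs of finitely generated groups\<close>

definition finite_generating_set :: "('g, 'm) monoid_scheme \<Rightarrow> 'g set \<Rightarrow> bool" where
  "finite_generating_set G T \<longleftrightarrow> finite T \<and> T \<subseteq> carrier G \<and> generate G T = carrier G"

definition cayley_edges :: "('g, 'm) monoid_scheme \<Rightarrow> 'g set \<Rightarrow> 'g set set" where
  "cayley_edges G T = {{g, g \<otimes>\<^bsub>G\<^esub> s} |g s. g \<in> carrier G \<and> s \<in> T \<and> s \<noteq> \<one>\<^bsub>G\<^esub>}"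

definition cayley_points :: "('g, 'm) monoid_scheme \<Rightarrow> 'g set \<Rightarrow> ('g \<Rightarrow> real) set" where
  "cayley_points G T = graph_points (carrier G) (cayley_edges G T)"

definition cayley_dist ::
  "('g, 'm) monoid_scheme \<Rightarrow> 'g set \<Rightarrow> ('g \<Rightarrow> real) \<Rightarrow> ('g \<Rightarrow> real) \<Rightarrow> real" where
  "cayley_dist G T = graph_dist (carrier G) (cayley_edges G T)"

definition cayley_divergence_spectrum ::
  "('g, 'm) monoid_scheme \<Rightarrow> 'g set \<Rightarrow> (real \<Rightarrow> ennreal) set" where
  "cayley_divergence_spectrum G T =
     Metric_space.divergence_spectrum (cayley_points G T) (cayley_dist G T)"

definition groups_quasi_isometric :: "('g, 'm) monoid_scheme \<Rightarrow> ('h, 'n) monoid_scheme \<Rightarrow> bool" where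
  "groups_quasi_isometric G H \<longleftrightarrow>
     (\<exists>T U. finite_generating_set G T \<and> finite_generating_set H U \<and>
        quasi_isometric (cayley_points G T) (cayley_dist G T) (cayley_points H U) (cayley_dist H U))"

lemma edge_point_swap: "edge_point u v t = edge_point v u (1 - t)"
  by (auto simp: edge_point_def)

lemma edge_point_0: "edge_point u v 0 = edge_point u u 0"
  by (auto simp: edge_point_def)

lemma edge_point_1: "edge_point u v 1 = edge_point v v 0"
  by (auto simp: edge_point_def)

lemma graph_chain_points:
  assumes "graph_chain V E x y l" shows "x \<in> graph_points V E" "y \<in> graph_points V E" "l \<ge> 0"
  using assms by (induction rule: graph_chain.induct) (auto simp: graph_points_def)

lemma graph_chain_trans:
  assumes "graph_chain V E x y l" "graph_chain V E y z m"
  shows "graph_chain V E x z (l + m)"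
  using assms
proof (induction arbitrary: m rule: graph_chain.induct)
  case (step u v s t y l)
  from graph_chain.step[OF step.hyps(1-3) step.IH[OF step.prems]] show ?case
    by (simp add: add.assoc)
qed simp

lemma graph_chain_sym:
  assumes "graph_chain V E x y l" shows "graph_chain V E y x l"
  using assms
proof (induction rule: graph_chain.induct)
  case (step u v s t y l)
  have "edge_point u v s \<in> graph_points V E"
    using step.hyps by (auto simp: graph_points_def)
  from graph_chain.step[OF step.hyps(1,3,2) graph_chain.nil[OF this]]
  have "graph_chain V E (edge_point u v t) (edge_point u v s) \<bar>t - s\<bar>" by simp
  from graph_chain_trans[OF step.IH this] show ?case
    by (simp add: abs_minus_commute add.commute)
qed (rule graph_chain.nil)

lemma graph_chain_lipschitz:
  assumes "graph_chain V E x y l" shows "\<bar>x w - y w\<bar> \<le> l"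
  using assms
proof (induction rule: graph_chain.induct)
  case (step u v s t y l)
  have "edge_point u v s w - edge_point u v t w = (t - s) * (indicator {u} w - indicator {v} w)"
    by (simp add: edge_point_def algebra_simps)
  then have "\<bar>edge_point u v s w - edge_point u v t w\<bar> \<le> \<bar>s - t\<bar>"
    by (auto simp: indicator_def)
  with step.IH show ?case by linarith
qed simp

lemma metric_space_graph:
  assumes conn: "\<And>u v. u \<in> V \<Longrightarrow> v \<in> V \<Longrightarrow> \<exists>l. graph_chain V E (edge_point u u 0) (edge_point v v 0) l"
    and graph: "simplicial_graph V E"
  shows "Metric_space (graph_points V E) (graph_dist V E)"
proof
  have bdd: "bdd_below {l. graph_chain V E x y l}" for x y
    using graph_chain_points(3) by (intro bdd_belowI[of _ 0]) auto
  have to_vertex: "\<exists>v\<in>V. \<exists>l. graph_chain V E x (edge_point v v 0) l" if "x \<in> graph_points V E" for x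
  proof -
    from that consider u where "u \<in> V" "x = edge_point u u 0"
      | u v t where "{u, v} \<in> E" "t \<in> {0..1}" "x = edge_point u v t"
      by (auto simp: graph_points_def)
    then show ?thesis
    proof cases
      case 1 then show ?thesis using graph_chain.nil[OF that] by blast
    next
      case 2
      then have u: "u \<in> V" using graph by (auto simp: simplicial_graph_def)
      have "edge_point u v 0 \<in> graph_points V E" using u by (auto simp: graph_points_def edge_point_0[of u v])
      from graph_chain.step[OF 2(1,2) _ graph_chain.nil[OF this]]
      have "graph_chain V E x (edge_point u u 0) \<bar>t - 0\<bar>" by (simp add: 2 edge_point_0[of u v])
      with u show ?thesis by blast
    qed
  qed
  have ne: "{l. graph_chain V E x y l} \<noteq> {}"
    if "x \<in> graph_points V E" "y \<in> graph_points V E" for x y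
  proof -
    from to_vertex that obtain u v l m where "u \<in> V" "v \<in> V"
      "graph_chain V E x (edge_point u u 0) l" "graph_chain V E y (edge_point v v 0) m" by meson
    then show ?thesis using conn[of u v] by (auto dest: graph_chain_trans graph_chain_sym)
  qed
  have dist_eq: "graph_dist V E x y = Inf {l. graph_chain V E x y l}"
    if "x \<in> graph_points V E" "y \<in> graph_points V E" for x y
    using ne[OF that] by (auto simp: graph_dist_def)
  show sym: "graph_dist V E x y = graph_dist V E y x" for x y
  proof -
    have "graph_chain V E x y = graph_chain V E y x" by (intro ext) (blast intro: graph_chain_sym)
    then show ?thesis by (simp add: graph_dist_def)
  qed
  show "0 \<le> graph_dist V E x y" for x y
  proof (cases "\<exists>l. graph_chain V E x y l")
    case True
    then have "0 \<le> Inf {l. graph_chain V E x y l}"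
      by (intro cInf_greatest) (auto dest: graph_chain_points(3))
    then show ?thesis by (simp add: graph_dist_def)
  qed (simp add: graph_dist_def)
  show "(graph_dist V E x y = 0) = (x = y)" if xy: "x \<in> graph_points V E" "y \<in> graph_points V E" for x y
  proof
    assume 0: "graph_dist V E x y = 0"
    have "\<bar>x w - y w\<bar> \<le> 0" for w
      using cInf_greatest[OF ne[OF xy], of "\<bar>x w - y w\<bar>"] graph_chain_lipschitz 0
      unfolding dist_eq[OF xy] by fastforce
    then show "x = y" by (intro ext) simp
  next
    assume "x = y"
    have "graph_dist V E x y \<le> 0" unfolding dist_eq[OF xy]
      using graph_chain.nil[OF xy(2)] \<open>x = y\<close> by (intro cInf_lower[OF _ bdd]) simp
    moreover have "graph_dist V E x y \<ge> 0" unfolding dist_eq[OF xy]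
      using cInf_greatest[OF ne[OF xy]] graph_chain_points(3) by fastforce
    ultimately show "graph_dist V E x y = 0" by simp
  qed
  show "graph_dist V E x z \<le> graph_dist V E x y + graph_dist V E y z"
    if xyz: "x \<in> graph_points V E" "y \<in> graph_points V E" "z \<in> graph_points V E" for x y z
  proof -
    have 1: "graph_dist V E x z \<le> l + m" if "graph_chain V E x y l" "graph_chain V E y z m" for l m
      unfolding dist_eq[OF xyz(1,3)] using graph_chain_trans[OF that] by (intro cInf_lower[OF _ bdd]) simp
    have "graph_dist V E x z - m \<le> graph_dist V E x y" if "graph_chain V E y z m" for m
      using cInf_greatest[OF ne[OF xyz(1,2)], of "graph_dist V E x z - m"] 1[OF _ that]
      unfolding dist_eq[OF xyz(1,2)] by fastforce
    then show ?thesis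
      using cInf_greatest[OF ne[OF xyz(2,3)], of "graph_dist V E x z - graph_dist V E x y"]
      unfolding dist_eq[OF xyz(2,3)] by fastforce
  qed
qed

lemma metric_space_cayley:
  fixes G (structure)
  assumes G: "group G" and T: "finite_generating_set G T"
  shows "Metric_space (cayley_points G T) (cayley_dist G T)"
proof -
  interpret group G by fact
  let ?E = "cayley_edges G T" and ?chain = "graph_chain (carrier G) (cayley_edges G T)"
  have TG: "T \<subseteq> carrier G" and gen: "generate G T = carrier G"
    using T by (auto simp: finite_generating_set_def)
  have graph: "simplicial_graph (carrier G) ?E"
    unfolding simplicial_graph_def
  proof
    fix e assume "e \<in> ?E"
    then obtain g s where e: "e = {g, g \<otimes> s}" "g \<in> carrier G" "s \<in> T" "s \<noteq> \<one>"
      by (auto simp: cayley_edges_def)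
    with TG have s: "s \<in> carrier G" by auto
    then have "g \<otimes> s \<noteq> g" using e by (metis l_cancel_one)
    then show "e \<subseteq> carrier G \<and> card e = 2" using e s by (auto simp: card_insert_if)
  qed
  have refl: "?chain (edge_point g g 0) (edge_point g g 0) 0" if "g \<in> carrier G" for g
    using that by (intro graph_chain.nil) (auto simp: graph_points_def)
  have gen_step: "\<exists>l. ?chain (edge_point g g 0) (edge_point (g \<otimes> s) (g \<otimes> s) 0) l"
    if g: "g \<in> carrier G" and s: "s \<in> T" for g s
  proof (cases "s = \<one>")
    case True
    then show ?thesis using refl[OF g] g by auto
  next
    case False
    then have edge: "{g, g \<otimes> s} \<in> ?E" using g s by (auto simp: cayley_edges_def)
    have "g \<otimes> s \<in> carrier G" using g s TG by auto
    from graph_chain.step[OF edge, of 0 1] refl[OF this] show ?thesis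
      by (auto simp: edge_point_0[of g "g \<otimes> s"] edge_point_1)
  qed
  have conn: "\<exists>l. ?chain (edge_point g g 0) (edge_point (g \<otimes> h) (g \<otimes> h) 0) l"
    if "h \<in> generate G T" "g \<in> carrier G" for g h
    using that
  proof (induction arbitrary: g rule: generate.induct)
    case one then show ?case using refl by auto
  next
    case (incl h) then show ?case by (rule gen_step[rotated])
  next
    case (inv h)
    then have h: "h \<in> carrier G" using TG by auto
    obtain l where "?chain (edge_point (g \<otimes> inv h) (g \<otimes> inv h) 0) (edge_point g g 0) l"
      using gen_step[of "g \<otimes> inv h" h] inv h by (auto simp: m_assoc)
    then show ?case by (blast dest: graph_chain_sym)
  next
    case (eng h1 h2)
    then have h: "h1 \<in> carrier G" "h2 \<in> carrier G" using gen by auto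
    obtain l where l: "?chain (edge_point g g 0) (edge_point (g \<otimes> h1) (g \<otimes> h1) 0) l"
      using eng by blast
    obtain m where "?chain (edge_point (g \<otimes> h1) (g \<otimes> h1) 0)
        (edge_point (g \<otimes> h1 \<otimes> h2) (g \<otimes> h1 \<otimes> h2) 0) m"
      using eng.IH(2)[of "g \<otimes> h1"] eng.prems h by auto
    from graph_chain_trans[OF l this] show ?case using eng.prems h by (auto simp: m_assoc)
  qed
  have conn': "\<exists>l. ?chain (edge_point u u 0) (edge_point v v 0) l"
    if "u \<in> carrier G" "v \<in> carrier G" for u v
    using conn[of "inv u \<otimes> v" u] that gen by (simp add: m_assoc[symmetric])
  show ?thesis
    unfolding cayley_points_def cayley_dist_def by (rule metric_space_graph[OF conn' graph])
qed


section \<open>Right-angled Coxeter groups\<close>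

text \<open>The group presented by generators \<open>V\<close> and relations \<open>s\<^sup>2 = 1\<close> and \<open>s t = t s\<close> for adjacent
  \<open>s\<close>, \<open>t\<close>. Since every generator is its own inverse, no formal inverses are needed:
  the elements are the classes of words over \<open>V\<close> modulo the congruence generated by the relations.
  The universal property of the presentation is \<open>racg_universal\<close> below.\<close>

inductive racg_eq :: "'v set \<Rightarrow> 'v set set \<Rightarrow> 'v list \<Rightarrow> 'v list \<Rightarrow> bool" for V E where
  refl: "x \<in> lists V \<Longrightarrow> racg_eq V E x x"
| sym: "racg_eq V E x y \<Longrightarrow> racg_eq V E y x"
| trans: "racg_eq V E x y \<Longrightarrow> racg_eq V E y z \<Longrightarrow> racg_eq V E x z"
| square: "\<lbrakk>x \<in> lists V; y \<in> lists V; s \<in> V\<rbrakk> \<Longrightarrow> racg_eq V E (x @ [s, s] @ y) (x @ y)"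
| commute: "\<lbrakk>x \<in> lists V; y \<in> lists V; s \<in> V; t \<in> V; {s, t} \<in> E\<rbrakk>
    \<Longrightarrow> racg_eq V E (x @ [s, t] @ y) (x @ [t, s] @ y)"

definition racg_rel :: "'v set \<Rightarrow> 'v set set \<Rightarrow> ('v list \<times> 'v list) set" where
  "racg_rel V E = {(x, y). racg_eq V E x y}"

definition racg :: "'v set \<Rightarrow> 'v set set \<Rightarrow> 'v list set monoid" where
  "racg V E =
     \<lparr>carrier = lists V // racg_rel V E,
      mult = (\<lambda>X Y. racg_rel V E `` {x @ y |x y. x \<in> X \<and> y \<in> Y}),
      one = racg_rel V E `` {[]}\<rparr>"

lemma racg_eq_lists: "racg_eq V E x y \<Longrightarrow> x \<in> lists V \<and> y \<in> lists V"
  by (induction rule: racg_eq.induct) auto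

lemma equiv_racg_rel: "equiv (lists V) (racg_rel V E)"
  by (intro equivI refl_onI symI transI)
    (auto simp: racg_rel_def racg_eq.refl dest: racg_eq_lists intro: racg_eq.sym racg_eq.trans)

lemma racg_eq_context:
  assumes "racg_eq V E x y" "p \<in> lists V" "q \<in> lists V"
  shows "racg_eq V E (p @ x @ q) (p @ y @ q)"
  using assms
proof (induction rule: racg_eq.induct)
  case (refl x) then show ?case by (intro racg_eq.refl) auto
next
  case (square x y s)
  then show ?case using racg_eq.square[of "p @ x" V "y @ q" s E] by auto
next
  case (commute x y s t)
  then show ?case using racg_eq.commute[of "p @ x" V "y @ q" s t E] by auto
qed (blast intro: racg_eq.sym racg_eq.trans)+

lemma racg_eq_append:
  assumes "racg_eq V E x x'" "racg_eq V E y y'" shows "racg_eq V E (x @ y) (x' @ y')"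
proof -
  have "racg_eq V E (x @ y) (x' @ y)"
    using racg_eq_context[OF assms(1), of "[]" y] racg_eq_lists[OF assms(2)] by auto
  moreover have "racg_eq V E (x' @ y) (x' @ y')"
    using racg_eq_context[OF assms(2), of x' "[]"] racg_eq_lists[OF assms(1)] by auto
  ultimately show ?thesis by (rule racg_eq.trans)
qed

lemma racg_mult_class:
  assumes "x \<in> lists V" "y \<in> lists V"
  shows "(racg_rel V E `` {x}) \<otimes>\<^bsub>racg V E\<^esub> (racg_rel V E `` {y}) = racg_rel V E `` {x @ y}"
proof -
  have "racg_eq V E (x @ y) z"
    if "racg_eq V E x x'" "racg_eq V E y y'" "racg_eq V E (x' @ y') z" for x' y' z
    using that racg_eq_append racg_eq.trans by metis
  moreover have "racg_eq V E x x" "racg_eq V E y y" using assms by (auto intro: racg_eq.refl)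
  ultimately show ?thesis by (auto simp: racg_def racg_rel_def)
qed

lemma racg_one: "\<one>\<^bsub>racg V E\<^esub> = racg_rel V E `` {[]}"
  by (simp add: racg_def)

lemma racg_carrierE:
  assumes "X \<in> carrier (racg V E)"
  obtains x where "x \<in> lists V" "X = racg_rel V E `` {x}"
  using assms by (auto simp: racg_def elim!: quotientE)

lemma racg_carrierI: "x \<in> lists V \<Longrightarrow> racg_rel V E `` {x} \<in> carrier (racg V E)"
  by (auto simp: racg_def intro: quotientI)

lemma racg_eq_rev: "x \<in> lists V \<Longrightarrow> racg_eq V E (rev x @ x) []"
proof (induction x)
  case (Cons s x)
  then have "racg_eq V E (rev x @ [s, s] @ x) (rev x @ x)" by (intro racg_eq.square) auto
  with Cons show ?case by (auto intro: racg_eq.trans)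
qed (auto intro: racg_eq.refl)

lemma racg_class_eq: "racg_eq V E x y \<Longrightarrow> racg_rel V E `` {x} = racg_rel V E `` {y}"
  using equiv_class_eq[OF equiv_racg_rel, of x y V E] by (simp add: racg_rel_def)

lemma group_racg: "group (racg V E)"
proof (rule groupI)
  fix X assume "X \<in> carrier (racg V E)"
  then obtain x where x: "x \<in> lists V" "X = racg_rel V E `` {x}" by (rule racg_carrierE)
  have "racg_rel V E `` {rev x} \<in> carrier (racg V E)" using x by (intro racg_carrierI) auto
  moreover have "(racg_rel V E `` {rev x}) \<otimes>\<^bsub>racg V E\<^esub> X = \<one>\<^bsub>racg V E\<^esub>"
    using x racg_class_eq[OF racg_eq_rev[OF x(1)]] by (simp add: racg_mult_class racg_one in_lists_conv_set)
  ultimately show "\<exists>Y\<in>carrier (racg V E). Y \<otimes>\<^bsub>racg V E\<^esub> X = \<one>\<^bsub>racg V E\<^esub>" by blast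
qed ((elim racg_carrierE)?, simp add: racg_one racg_mult_class racg_carrierI)+

lemma finite_generating_set_racg:
  assumes "finite V"
  shows "finite_generating_set (racg V E) ((\<lambda>s. racg_rel V E `` {[s]}) ` V)"
proof -
  interpret group "racg V E" by (rule group_racg)
  let ?T = "(\<lambda>s. racg_rel V E `` {[s]}) ` V"
  have T: "?T \<subseteq> carrier (racg V E)" by (auto intro: racg_carrierI)
  have "racg_rel V E `` {x} \<in> generate (racg V E) ?T" if "x \<in> lists V" for x
    using that
  proof (induction x)
    case Nil then show ?case using generate.one[of "racg V E" ?T] by (simp add: racg_one)
  next
    case (Cons s x)
    then have "racg_rel V E `` {[s]} \<otimes>\<^bsub>racg V E\<^esub> racg_rel V E `` {x} \<in> generate (racg V E) ?T"
      by (intro generate.eng) (auto intro: generate.incl)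
    then show ?case using Cons by (simp add: racg_mult_class in_lists_conv_set)
  qed
  then have "carrier (racg V E) \<subseteq> generate (racg V E) ?T" by (auto elim!: racg_carrierE)
  moreover have "generate (racg V E) ?T \<subseteq> carrier (racg V E)" using generate_incl[OF T] .
  ultimately show ?thesis using T assms by (auto simp: finite_generating_set_def)
qed

lemma racg_universal:
  assumes H: "group H" and f: "f \<in> V \<rightarrow> carrier H"
    and square: "\<And>s. s \<in> V \<Longrightarrow> f s \<otimes>\<^bsub>H\<^esub> f s = \<one>\<^bsub>H\<^esub>"
    and commute: "\<And>s t. s \<in> V \<Longrightarrow> t \<in> V \<Longrightarrow> {s, t} \<in> E \<Longrightarrow> f s \<otimes>\<^bsub>H\<^esub> f t = f t \<otimes>\<^bsub>H\<^esub> f s"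
  shows "\<exists>h\<in>hom (racg V E) H. \<forall>s\<in>V. h (racg_rel V E `` {[s]}) = f s"
proof -
  interpret group H by fact
  define F where "F x = foldr (\<lambda>s g. f s \<otimes>\<^bsub>H\<^esub> g) x \<one>\<^bsub>H\<^esub>" for x
  have F_Nil: "F [] = \<one>\<^bsub>H\<^esub>" and F_Cons: "F (s # x) = f s \<otimes>\<^bsub>H\<^esub> F x" for s x
    by (auto simp: F_def)
  have fV: "f s \<in> carrier H" if "s \<in> V" for s using f that by auto
  have F: "F x \<in> carrier H" if "x \<in> lists V" for x
    using that by (induction x) (auto simp: F_Nil F_Cons fV)
  have F_append: "F (x @ y) = F x \<otimes>\<^bsub>H\<^esub> F y" if "x \<in> lists V" "y \<in> lists V" for x y
    using that(1) by (induction x) (auto simp: F_Nil F_Cons fV F that(2) m_assoc)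
  have F_eq: "F x = F y" if "racg_eq V E x y" for x y
    using that
  proof (induction rule: racg_eq.induct)
    case (square x y s)
    then have "F ([s, s] @ y) = F y"
      using assms(3)[of s] by (simp add: F_Cons fV F m_assoc[symmetric])
    then show ?case using square by (simp add: F_append del: append_Cons append_Nil)
  next
    case (commute x y s t)
    then have "F ([s, t] @ y) = F ([t, s] @ y)"
      using assms(4)[of s t] by (simp add: F_Cons fV F m_assoc[symmetric])
    then show ?case using commute by (simp add: F_append del: append_Cons append_Nil)
  qed auto
  define h where "h X = F (SOME x. x \<in> X)" for X
  have h: "h (racg_rel V E `` {x}) = F x" if "x \<in> lists V" for x
  proof -
    have "x \<in> racg_rel V E `` {x}" using that by (simp add: racg_rel_def racg_eq.refl)
    then have "(SOME y. y \<in> racg_rel V E `` {x}) \<in> racg_rel V E `` {x}" by (rule someI)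
    then show ?thesis unfolding h_def using F_eq by (auto simp: racg_rel_def)
  qed
  have "h \<in> hom (racg V E) H"
    by (rule homI) (elim racg_carrierE, simp add: h F racg_mult_class F_append)+
  moreover have "\<forall>s\<in>V. h (racg_rel V E `` {[s]}) = f s" by (simp add: h F_Nil F_Cons fV)
  ultimately show ?thesis by blast
qed


section \<open>The graphs \<open>\<Omega>\<^sub>d\<close>\<close>

datatype omega_vertex = Va nat | Vb nat | Vc nat

definition omega_vertices :: "nat \<Rightarrow> omega_vertex set" where
  "omega_vertices d = {Va i |i. i \<le> d} \<union> {Vb i |i. i \<le> d} \<union> {Vc 1, Vc 2}"

definition omega_edges :: "nat \<Rightarrow> omega_vertex set set" where
  "omega_edges d =
     {{Va 0, Va i} |i. 1 \<le> i \<and> i \<le> d} \<union> {{Vb 0, Va i} |i. 1 \<le> i \<and> i \<le> d} \<union>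
     {{Va 0, Vb 1}, {Vb 0, Vb 1}} \<union>
     {{Vb i, Vb (i - 1)} |i. 2 \<le> i \<and> i \<le> d} \<union> {{Vb i, Va (i - 1)} |i. 2 \<le> i \<and> i \<le> d} \<union>
     {{Vb 1, Vc 1}, {Vc 1, Vc 2}, {Vc 2, Va d}}"

definition G_omega :: "nat \<Rightarrow> omega_vertex list set monoid" where
  "G_omega d = racg (omega_vertices d) (omega_edges d)"

lemma finite_omega_vertices: "finite (omega_vertices d)"
  by (simp add: omega_vertices_def setcompr_eq_image[of _ "\<lambda>i. i \<le> d"])

lemma simplicial_graph_omega: "d \<ge> 1 \<Longrightarrow> simplicial_graph (omega_vertices d) (omega_edges d)"
  by (auto simp: simplicial_graph_def omega_vertices_def omega_edges_def card_insert_if)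

end

theory Submission
  imports Defs
begin

text \<open>
  Write \<open>W\<^sub>d\<close> for the group of \<open>\<Omega>\<^sub>d\<close>. The walls (hyperplanes) of a right-angled Coxeter group give lower
  bounds for lengths of paths: a path around a ball crosses every wall that separates its ends, and
  between two consecutive walls it has to turn a corner. The wall of a letter \<open>s\<close> is a copy of the
  group of the link of \<open>s\<close>, so the cost of a corner at \<open>s\<close> is at least the radius times the cost of
  the corners between letters in the link of \<open>s\<close> (the recursion of Dani and Thomas). It yields exponent \<open>d - 1\<close> for
  the corners of \<open>\<dots> a\<^sub>d b\<^sub>d a\<^sub>d b\<^sub>d \<dots>\<close>, and every exponent for corners at \<open>c\<^sub>1\<close> and \<open>c\<^sub>2\<close>.

  Hence, for \<open>d \<ge> 2\<close>, the line \<open>\<dots> a\<^sub>d b\<^sub>d a\<^sub>d b\<^sub>d \<dots>\<close> is Morse and its lower divergence is at least of degree \<open>d\<close>.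
  A Morse geodesic that crosses walls of \<open>c\<^sub>1\<close> or \<open>c\<^sub>2\<close> at bounded distances has a lower divergence
  that exceeds every polynomial. Any other geodesic has arbitrarily long segments close to a
  coset of the subgroup generated by the letters \<open>a\<^sub>i\<close>, \<open>b\<^sub>i\<close>, in which explicit paths of length of order
  \<open>r\<^sup>d\<close> avoid balls of radius \<open>r\<close>. So the largest polynomial degree in the spectrum
  is \<open>d\<close> for \<open>d \<ge> 2\<close>, and no degree above \<open>1\<close> occurs for \<open>d = 1\<close>. The estimates hold for all spaces
  quasi-isometric to \<open>W\<^sub>d\<close>, hence for all Cayley graphs and for quasi-isometric groups.
\<close>

text \<open>At a letter c_1 or c_2 the recursion never ends, because the link of each contains the
  other. At a_j, b_j it leads down to a_(j-1), b_(j-1) and stops at a_1, b_1, whose two common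
  neighbours a_0, b_0 violate the hypothesis \<open>common\<close> of \<open>corner_step\<close>.
  The last degree, from d - 1 to d, comes from the number of walls crossed, which is of order r.

  The exact growth of the divergence of geodesics that keep meeting walls of c_1 or c_2 is not
  determined. It is enough that every member of the spectrum of W_d is \<preceq> x^d or above x^e,
  for each e: if d < d', the member of degree d' for W_d' falls into this gap of W_d. Only the
  larger of the two integers needs an axis, so no Morse line is constructed for d = 1.

  Invariance of the spectrum under quasi-isometry is not proved as such. A quasi-isometry makes the
  Cayley graph of one group a \<open>coarse_model\<close> of the other group too, and the spectrum
  of this single graph would then differ from itself.\<close>

section \<open>Right-angled Coxeter groups as additive groups\<close>

text \<open>Adjacency belongs to the vertex type, so that the group becomes a type of class
  \<open>group_add\<close> and products are computed by the algebra of additive groups.\<close>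

class simple_graph =
  fixes adj :: "'a \<Rightarrow> 'a \<Rightarrow> bool"
  assumes adj_sym: "adj u v \<Longrightarrow> adj v u" and adj_irrefl [simp]: "\<not> adj u u"

inductive rac_eq :: "'v::simple_graph list \<Rightarrow> 'v list \<Rightarrow> bool" where
  refl: "rac_eq x x"
| sym: "rac_eq x y \<Longrightarrow> rac_eq y x"
| trans: "rac_eq x y \<Longrightarrow> rac_eq y z \<Longrightarrow> rac_eq x z"
| square: "rac_eq (x @ [s, s] @ y) (x @ y)"
| commute: "adj s t \<Longrightarrow> rac_eq (x @ [s, t] @ y) (x @ [t, s] @ y)"

lemma rac_eq_context: "rac_eq x y \<Longrightarrow> rac_eq (p @ x @ q) (p @ y @ q)"
proof (induction rule: rac_eq.induct)
  case (square x s y)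
  then show ?case using rac_eq.square[of "p @ x" s "y @ q"] by simp
next
  case (commute s t x y)
  then show ?case using rac_eq.commute[of s t "p @ x" "y @ q"] by simp
qed (auto intro: rac_eq.intros)

lemma rac_eq_append:
  assumes "rac_eq x x'" "rac_eq y y'" shows "rac_eq (x @ y) (x' @ y')"
  using rac_eq_context[OF assms(1), of "[]" y] rac_eq_context[OF assms(2), of x' "[]"]
  by (auto intro: rac_eq.trans)

lemma rac_eq_rev: "rac_eq x y \<Longrightarrow> rac_eq (rev x) (rev y)"
proof (induction rule: rac_eq.induct)
  case (square x s y)
  then show ?case using rac_eq.square[of "rev y" s "rev x"] by simp
next
  case (commute s t x y)
  then show ?case using rac_eq.commute[of t s "rev y" "rev x"] by (simp add: adj_sym)
qed (auto intro: rac_eq.intros)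

lemma rac_eq_rev_append: "rac_eq (rev x @ x) []"
proof (induction x)
  case (Cons s x)
  have "rac_eq (rev x @ [s, s] @ x) (rev x @ x)" by (rule rac_eq.square)
  with Cons show ?case by (auto intro: rac_eq.trans)
qed (auto intro: rac_eq.refl)

quotient_type (overloaded) 'v rac = "'v::simple_graph list" / rac_eq
  by (rule equivpI) (auto intro!: reflpI sympI transpI intro: rac_eq.intros)

lift_definition word :: "'v::simple_graph list \<Rightarrow> 'v rac" is "\<lambda>x. x" .

instantiation rac :: (simple_graph) group_add
begin
lift_definition zero_rac :: "'a rac" is "[]" .
lift_definition plus_rac :: "'a rac \<Rightarrow> 'a rac \<Rightarrow> 'a rac" is "(@)" by (rule rac_eq_append)
lift_definition uminus_rac :: "'a rac \<Rightarrow> 'a rac" is rev by (rule rac_eq_rev)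
definition minus_rac :: "'a rac \<Rightarrow> 'a rac \<Rightarrow> 'a rac" where "minus_rac x y = x + - y"
instance
proof
  fix a b c :: "'a rac"
  show "a + b + c = a + (b + c)" by transfer (simp add: rac_eq.refl)
  show "0 + a = a" by transfer (simp add: rac_eq.refl)
  show "a + 0 = a" by transfer (simp add: rac_eq.refl)
  show "- a + a = 0" by transfer (rule rac_eq_rev_append)
  show "a + - b = a - b" by (simp add: minus_rac_def)
qed
end

lemma word_Nil [simp]: "word [] = 0" by transfer (rule rac_eq.refl)
lemma word_append: "word (x @ y) = word x + word y" by transfer (rule rac_eq.refl)
lemma word_Cons: "word (s # x) = word [s] + word x" using word_append[of "[s]" x] by simp
lemma word_rev: "word (rev x) = - word x" by transfer (rule rac_eq.refl)
lemma word_eq_iff: "word x = word y \<longleftrightarrow> rac_eq x y" by transfer simp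
lemma word_surj: obtains x where "w = word x" by transfer (meson rac_eq.refl)

abbreviation gen :: "'v::simple_graph \<Rightarrow> 'v rac" where "gen s \<equiv> word [s]"

lemma gen_twice [simp]: "gen s + gen s = 0"
  using rac_eq.square[of "[]" s "[]"] by (simp add: word_eq_iff flip: word_append word_Nil)
lemma minus_gen [simp]: "- gen s = gen s" by (rule minus_unique) simp
lemma gen_commute: "adj s t \<Longrightarrow> gen s + gen t = gen t + gen s"
  using rac_eq.commute[of s t "[]" "[]"] by (simp add: word_eq_iff flip: word_append)

lemma rac_induct [case_names zero gen]:
  assumes "P 0" "\<And>w t. P w \<Longrightarrow> P (w + gen t)" shows "P w"
proof -
  have "P (word x)" for x
    by (induction x rule: rev_induct) (auto simp: assms word_append)
  then show ?thesis by (metis word_surj)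
qed

section \<open>Special subgroups and word length\<close>

definition sp :: "'v::simple_graph set \<Rightarrow> 'v rac set" where "sp A = word ` lists A"

lemma sp_word: "set x \<subseteq> A \<Longrightarrow> word x \<in> sp A" by (auto simp: sp_def in_lists_conv_set)
lemma sp_zero [simp]: "0 \<in> sp A" using sp_word[of "[]" A] by simp
lemma sp_gen: "s \<in> A \<Longrightarrow> gen s \<in> sp A" by (rule sp_word) simp
lemma spE: assumes "w \<in> sp A" obtains x where "set x \<subseteq> A" "w = word x"
  using assms by (auto simp: sp_def in_lists_conv_set)
lemma sp_add: "v \<in> sp A \<Longrightarrow> w \<in> sp A \<Longrightarrow> v + w \<in> sp A"
  by (elim spE) (auto simp flip: word_append intro!: sp_word)
lemma sp_uminus: "w \<in> sp A \<Longrightarrow> - w \<in> sp A"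
  by (elim spE) (auto simp flip: word_rev intro!: sp_word)
lemma sp_mono: "A \<subseteq> B \<Longrightarrow> sp A \<subseteq> sp B" by (auto simp: sp_def in_lists_conv_set)
lemma sp_add_left_iff: "v \<in> sp A \<Longrightarrow> v + w \<in> sp A \<longleftrightarrow> w \<in> sp A"
  using sp_add[of v A w] sp_add[OF sp_uminus[of v A], of "v + w"] by auto
lemma sp_add_right_iff: "v \<in> sp A \<Longrightarrow> w + v \<in> sp A \<longleftrightarrow> w \<in> sp A"
  using sp_add[of w A v] sp_add[OF _ sp_uminus[of v A], of "w + v"] by (auto simp: add.assoc)

lemma sp_induct [consumes 1, case_names zero gen]:
  assumes "w \<in> sp A" "P 0" "\<And>w t. w \<in> sp A \<Longrightarrow> P w \<Longrightarrow> t \<in> A \<Longrightarrow> P (w + gen t)" shows "P w"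
proof -
  have "P (word x)" if "set x \<subseteq> A" for x
    using that by (induction x rule: rev_induct) (auto simp: assms word_append sp_word)
  then show ?thesis using assms(1) by (auto elim: spE)
qed

definition len :: "'v::simple_graph rac \<Rightarrow> nat" where
  "len w = (LEAST n. \<exists>x. w = word x \<and> length x = n)"

lemma len_word_le: "len (word x) \<le> length x"
  unfolding len_def by (rule Least_le) auto
lemma len_word: obtains x where "w = word x" "length x = len w"
proof -
  have "\<exists>n x. w = word x \<and> length x = n" by (metis word_surj)
  from LeastI_ex[OF this] that show thesis unfolding len_def by blast
qed
lemma len_zero [simp]: "len 0 = 0" using len_word_le[of "[]"] by simp
lemma len_eq_0 [simp]: "len w = 0 \<longleftrightarrow> w = 0" by (metis len_word len_zero length_0_conv word_Nil)
lemma len_gen_le: "len (gen s) \<le> 1" using len_word_le[of "[s]"] by simp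
lemma len_add: "len (v + w) \<le> len v + len w"
  by (metis len_word len_word_le length_append word_append)
lemma len_uminus [simp]: "len (- w) = len w"
proof -
  have "len (- w) \<le> len w" for w :: "'a rac"
    by (metis len_word len_word_le length_rev word_rev)
  from this[of w] this[of "- w"] show ?thesis by simp
qed

definition wd :: "'v::simple_graph rac \<Rightarrow> 'v rac \<Rightarrow> nat" where "wd v w = len (- v + w)"

lemma wd_self [simp]: "wd v v = 0" by (simp add: wd_def)
lemma wd_eq_0 [simp]: "wd v w = 0 \<longleftrightarrow> v = w" by (simp add: wd_def) (metis add_minus_cancel add.right_neutral)
lemma wd_sym: "wd v w = wd w v" unfolding wd_def by (metis len_uminus minus_add minus_minus)
lemma wd_triangle: "wd u w \<le> wd u v + wd v w"
  unfolding wd_def using len_add[of "- u + v" "- v + w"] by (simp add: add.assoc)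
lemma wd_translate [simp]: "wd (g + v) (g + w) = wd v w"
  by (simp add: wd_def minus_add diff_conv_add_uminus add.assoc del: add_uminus_conv_diff)
lemma wd_0 [simp]: "wd 0 w = len w" "wd w 0 = len w" by (simp_all add: wd_def)
lemma wd_gen: "wd w (w + gen s) \<le> 1" using len_gen_le[of s] by (simp add: wd_def)

text \<open>Deleting the letters outside \<open>A\<close> is a retraction of the whole group onto \<open>sp A\<close>.\<close>

lemma rac_eq_filter: "rac_eq x y \<Longrightarrow> rac_eq (filter P x) (filter P y)"
proof (induction rule: rac_eq.induct)
  case (square x s y)
  then show ?case using rac_eq.square[of "filter P x" s "filter P y"] by (auto intro: rac_eq.refl)
next
  case (commute s t x y)
  then show ?case using rac_eq.commute[of s t "filter P x" "filter P y"] by (auto intro: rac_eq.refl)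
qed (auto intro: rac_eq.refl rac_eq.sym rac_eq.trans)

text \<open>Filtering a shortest word for an element of \<open>sp A\<close> yields a word for the
  same element, so special subgroups are isometrically embedded.\<close>

lemma sp_geodesic_word:
  assumes "w \<in> sp A" obtains x where "w = word x" "set x \<subseteq> A" "length x = len w"
proof -
  obtain y where y: "w = word y" "length y = len w" by (rule len_word)
  obtain z where z: "w = word z" "set z \<subseteq> A" using assms by (auto elim: spE)
  let ?x = "filter (\<lambda>s. s \<in> A) y"
  have "rac_eq y z" using y z by (simp flip: word_eq_iff)
  then have "rac_eq ?x (filter (\<lambda>s. s \<in> A) z)" by (rule rac_eq_filter)
  moreover have "filter (\<lambda>s. s \<in> A) z = z" using z by (auto simp: filter_id_conv)
  ultimately have w: "w = word ?x" using z by (simp add: word_eq_iff rac_eq.sym)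
  have "length ?x \<le> len w" using y by (metis length_filter_le)
  moreover have "len w \<le> length ?x" using w len_word_le by metis
  ultimately show thesis using that[of ?x] w by auto
qed

section \<open>Walls\<close>

definition lk :: "'v::simple_graph \<Rightarrow> 'v set" where "lk s = {t. adj s t}"
text \<open>The subgroup of the star of \<open>s\<close>: the centralizer of \<open>s\<close> and
  the stabilizer of the wall between 0 and \<open>gen s\<close>.\<close>

definition St :: "'v::simple_graph \<Rightarrow> 'v rac set" where "St s = sp (insert s (lk s))"

lemma lk_irrefl [simp]: "s \<notin> lk s" by (simp add: lk_def)
lemma lk_sym: "s \<in> lk t \<longleftrightarrow> t \<in> lk s" by (auto simp: lk_def intro: adj_sym)
lemma St_commute: assumes "w \<in> St s" shows "gen s + w = w + gen s"
  using assms unfolding St_def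
proof (induction rule: sp_induct)
  case (gen w t)
  then have "gen s + gen t = gen t + gen s" using gen_commute[of s t] by (auto simp: lk_def)
  with gen show ?case by (metis add.assoc)
qed simp

text \<open>The wall of \<open>s\<close> separates the vertices \<open>w\<close> and \<open>w s\<close> with \<open>w \<in> St s\<close>; hence a word
  crosses it at those letters \<open>s\<close> whose prefix lies in \<open>St s\<close>.\<close>

fun crossings_odd :: "'v::simple_graph \<Rightarrow> 'v rac \<Rightarrow> 'v list \<Rightarrow> bool" where
  "crossings_odd s p [] = False"
| "crossings_odd s p (t # x) = ((t = s \<and> p \<in> St s) \<noteq> crossings_odd s (p + gen t) x)"

lemma crossings_odd_append:
  "crossings_odd s p (x @ y) = (crossings_odd s p x \<noteq> crossings_odd s (p + word x) y)"
proof (induction x arbitrary: p)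
  case (Cons t x)
  have "p + word (t # x) = p + gen t + word x" by (simp add: word_Cons[of t x] add.assoc)
  with Cons show ?case by auto
qed simp

lemma St_gen_iff: "t = s \<or> adj s t \<Longrightarrow> w + gen t \<in> St s \<longleftrightarrow> w \<in> St s"
  unfolding St_def by (rule sp_add_right_iff) (auto simp: lk_def intro: sp_gen)

text \<open>A letter that equals \<open>s\<close> or commutes with it does not move the prefix into
  or out of \<open>St s\<close>. Hence the letters of a square cross the wall both or neither, and
  swapping two commuting letters preserves the crossings.\<close>

lemma crossings_odd_cong: "rac_eq x y \<Longrightarrow> crossings_odd s p x = crossings_odd s p y"
proof (induction arbitrary: p rule: rac_eq.induct)
  case (square x u y)
  have "crossings_odd s q (u # u # y) = crossings_odd s q y" for q
    by (auto simp: add.assoc St_gen_iff)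
  then show ?case by (simp add: crossings_odd_append)
next
  case (commute u t x y)
  have "crossings_odd s q (u # t # y) = crossings_odd s q (t # u # y)" for q
    using commute gen_commute[of u t] adj_sym[OF commute] by (auto simp: add.assoc St_gen_iff)
  then show ?case by (simp add: crossings_odd_append)
qed auto

text \<open>The half-space that the wall of \<open>s\<close> at 0 separates from 0.\<close>

definition far :: "'v::simple_graph \<Rightarrow> 'v rac \<Rightarrow> bool" where
  "far s w \<longleftrightarrow> (\<exists>x. w = word x \<and> crossings_odd s 0 x)"

lemma far_word: "far s (word x) = crossings_odd s 0 x"
  unfolding far_def by (auto simp: word_eq_iff dest: crossings_odd_cong intro: rac_eq.refl)

lemma far_zero [simp]: "\<not> far s 0" using far_word[of s "[]"] by simp

lemma far_add_gen: "far s (w + gen t) = (far s w \<noteq> (t = s \<and> w \<in> St s))"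
proof -
  obtain x where "w = word x" by (rule word_surj)
  then show ?thesis by (auto simp: far_word crossings_odd_append simp flip: word_append)
qed

lemma far_sp: assumes "h \<in> sp A" "s \<notin> A" shows "far s (w + h) = far s w"
  using assms by (induction rule: sp_induct) (auto simp: far_add_gen simp flip: add.assoc)

lemma not_far_sp: "h \<in> sp A \<Longrightarrow> s \<notin> A \<Longrightarrow> \<not> far s h" using far_sp[of h A s 0] by simp

lemma far_gen_left: "far s (gen s + w) = (\<not> far s w)"
proof (induction w rule: rac_induct)
  case zero
  show ?case using far_add_gen[of s 0 s] by (simp add: St_def)
next
  case (gen w t)
  have "gen s + w \<in> St s \<longleftrightarrow> w \<in> St s" unfolding St_def by (rule sp_add_left_iff) (simp add: sp_gen)
  with gen show ?case by (auto simp: far_add_gen simp flip: add.assoc)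
qed

text \<open>The wall of \<open>s\<close> is crossed at an element of \<open>St s\<close>. The letter
  \<open>t\<close> does not occur in this subgroup, so the wall of \<open>t\<close> is not crossed
  before, and vice versa.\<close>

lemma far_disjoint:
  assumes "s \<noteq> t" "\<not> adj s t" shows "\<not> (far s w \<and> far t w)"
proof (induction w rule: rac_induct)
  case (gen w u)
  have "\<not> far t w" if "w \<in> St s" using that assms unfolding St_def by (intro not_far_sp) (auto simp: lk_def)
  moreover have "\<not> far s w" if "w \<in> St t"
    using that assms unfolding St_def by (intro not_far_sp) (auto simp: lk_def dest: adj_sym)
  ultimately show ?case using gen assms by (auto simp: far_add_gen)
qed simp

section \<open>Edge paths crossing chains of walls\<close>

definition edge_path :: "(nat \<Rightarrow> 'v::simple_graph rac) \<Rightarrow> nat \<Rightarrow> bool" where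
  "edge_path x n \<longleftrightarrow> (\<forall>i<n. wd (x i) (x (Suc i)) \<le> 1)"

lemma len_le_1: "len w \<le> 1 \<longleftrightarrow> w = 0 \<or> (\<exists>t. w = gen t)"
proof
  assume "len w \<le> 1"
  moreover obtain x where "w = word x" "length x = len w" by (rule len_word)
  ultimately show "w = 0 \<or> (\<exists>t. w = gen t)" by (cases x) (auto simp: length_Suc_conv le_Suc_eq)
qed (use len_gen_le in auto)

lemma wd_le_1E:
  assumes "wd v w \<le> 1" obtains "w = v" | t where "w = v + gen t"
proof -
  have "w = v + (- v + w)" by (simp flip: add.assoc)
  moreover have "- v + w = 0 \<or> (\<exists>t. - v + w = gen t)" using assms by (simp add: wd_def flip: len_le_1)
  ultimately show thesis using that by (metis add.right_neutral)
qed

lemma edge_path_rev: "edge_path x n \<Longrightarrow> edge_path (\<lambda>i. x (n - i)) n"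
  unfolding edge_path_def
proof (intro allI impI)
  fix i assume "\<forall>i<n. wd (x i) (x (Suc i)) \<le> 1" "i < n"
  then have "wd (x (n - Suc i)) (x (Suc (n - Suc i))) \<le> 1" by simp
  with \<open>i < n\<close> show "wd (x (n - i)) (x (n - Suc i)) \<le> 1" by (simp add: wd_sym Suc_diff_Suc)
qed

lemma edge_path_translate: "edge_path x n \<Longrightarrow> edge_path (\<lambda>i. g + x i) n"
  by (simp add: edge_path_def)

lemma edge_path_word: "edge_path (\<lambda>i. g + word (take i us)) n"
  unfolding edge_path_def
proof (intro allI impI)
  fix i
  show "wd (g + word (take i us)) (g + word (take (Suc i) us)) \<le> 1"
    using wd_gen[of "word (take i us)" "us ! i"]
    by (cases "i < length us") (auto simp: take_Suc_conv_app_nth word_append)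
qed

lemma edge_path_shift: "edge_path x n \<Longrightarrow> i + k \<le> n \<Longrightarrow> edge_path (\<lambda>j. x (i + j)) k"
  unfolding edge_path_def by simp

lemma edge_path_wd: "edge_path x n \<Longrightarrow> i \<le> j \<Longrightarrow> j \<le> n \<Longrightarrow> wd (x i) (x j) \<le> j - i"
proof (induction "j - i" arbitrary: j)
  case (Suc k)
  then obtain j' where j': "j = Suc j'" "i \<le> j'" by (cases j) auto
  then have "wd (x i) (x j') \<le> j' - i" "wd (x j') (x j) \<le> 1" using Suc by (auto simp: edge_path_def)
  then show ?case using wd_triangle[of "x i" "x j" "x j'"] j' by simp
qed simp

lemma cross_wall:
  assumes "wd v w \<le> 1" "\<not> far s (g + v)" "far s (g + w)"
  shows "w = v + gen s" "g + v \<in> St s" "g + w \<in> St s"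
proof -
  have "w = v + gen s \<and> g + v \<in> St s"
    using assms(1)
  proof (cases rule: wd_le_1E)
    case 1
    then show ?thesis using assms by simp
  next
    case (2 t)
    then show ?thesis using assms(2,3) far_add_gen[of s "g + v" t] by (auto simp: add.assoc)
  qed
  then show "w = v + gen s" "g + v \<in> St s" "g + w \<in> St s"
    by (auto simp: St_gen_iff simp flip: add.assoc)
qed

text \<open>The i-th wall is dual to the edge from \<open>v i\<close> to \<open>v (Suc i)\<close>.
  That neighbouring labels do not commute keeps consecutive walls disjoint and makes
  \<open>beyond\<close> a decreasing sequence of half-spaces.\<close>

definition wall_chain :: "(nat \<Rightarrow> 'v::simple_graph) \<Rightarrow> (nat \<Rightarrow> 'v rac) \<Rightarrow> nat \<Rightarrow> bool" where
  "wall_chain u v m \<longleftrightarrow> (\<forall>i<m. v (Suc i) = v i + gen (u i)) \<and>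
     (\<forall>i. Suc i < m \<longrightarrow> u i \<noteq> u (Suc i) \<and> \<not> adj (u i) (u (Suc i)))"

definition beyond :: "(nat \<Rightarrow> 'v::simple_graph) \<Rightarrow> (nat \<Rightarrow> 'v rac) \<Rightarrow> nat \<Rightarrow> 'v rac set" where
  "beyond u v i = {x. far (u i) (- v i + x)}"

lemma wall_chain_mono: "wall_chain u v m \<Longrightarrow> k \<le> m \<Longrightarrow> wall_chain u v k"
  by (auto simp: wall_chain_def)

lemma wall_chain_shift: "wall_chain u v m \<Longrightarrow> k + l \<le> m \<Longrightarrow> wall_chain (\<lambda>i. u (k + i)) (\<lambda>i. v (k + i)) l"
  unfolding wall_chain_def by (metis add_Suc_right add_less_cancel_left less_le_trans)

lemma wall_chain_next:
  assumes "wall_chain u v m" "i < m" shows "- v (Suc i) + x = gen (u i) + (- v i + x)"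
  using assms by (simp add: wall_chain_def minus_add add.assoc diff_conv_add_uminus del: add_uminus_conv_diff)

text \<open>Seen from \<open>v (Suc i)\<close>, the i-th wall is again the wall of
  \<open>u i\<close> but with its sides exchanged (\<open>far_gen_left\<close>), so
  \<open>far_disjoint\<close> applies to the two walls at this vertex.\<close>

lemma beyond_Suc:
  assumes "wall_chain u v m" "Suc i < m" shows "beyond u v (Suc i) \<subseteq> beyond u v i"
proof
  fix x assume "x \<in> beyond u v (Suc i)"
  then have "far (u (Suc i)) (- v (Suc i) + x)" by (simp add: beyond_def)
  then have "\<not> far (u i) (- v (Suc i) + x)"
    using far_disjoint assms unfolding wall_chain_def by metis
  then show "x \<in> beyond u v i"
    using wall_chain_next[OF assms(1), of i x] assms(2) by (simp add: beyond_def far_gen_left)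
qed

lemma beyond_antimono:
  assumes "wall_chain u v m" "i \<le> j" "j < m" shows "beyond u v j \<subseteq> beyond u v i"
  using assms(2,3)
proof (induction rule: dec_induct)
  case (step k)
  then show ?case using beyond_Suc[OF assms(1), of k] by simp
qed simp

text \<open>The times are those of the first entry into each half-space. Nesting makes them
  monotone; they are distinct because an edge has a single label, while neighbouring walls have
  different ones.\<close>

lemma chain_crossing_times:
  assumes chain: "wall_chain u v m" and m: "0 < m" and x: "edge_path x n"
    and start: "x 0 \<notin> beyond u v 0" and stop: "x n \<in> beyond u v (m - 1)"
  obtains \<tau> where "\<And>i. i < m \<Longrightarrow> 0 < \<tau> i \<and> \<tau> i \<le> n"
    "\<And>i. i < m \<Longrightarrow> - v i + x (\<tau> i - 1) \<in> St (u i)" "\<And>i. i < m \<Longrightarrow> - v i + x (\<tau> i) \<in> St (u i)"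
    "\<And>i. Suc i < m \<Longrightarrow> \<tau> i < \<tau> (Suc i)"
proof
  define \<tau> where "\<tau> i = (LEAST j. x j \<in> beyond u v i)" for i
  have ex: "x n \<in> beyond u v i" if "i < m" for i
  proof -
    have "i \<le> m - 1" "m - 1 < m" using that by auto
    from beyond_antimono[OF chain this] stop show ?thesis by auto
  qed
  have in_b: "x (\<tau> i) \<in> beyond u v i" if "i < m" for i
    unfolding \<tau>_def using ex[OF that] by (rule LeastI)
  have le: "\<tau> i \<le> n" if "i < m" for i
    unfolding \<tau>_def using ex[OF that] by (rule Least_le)
  have pos: "0 < \<tau> i" if "i < m" for i
  proof (rule ccontr)
    assume "\<not> 0 < \<tau> i"
    then have "x 0 \<in> beyond u v i" using in_b[OF that] by simp
    then show False using start beyond_antimono[OF chain, of 0 i] that by auto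
  qed
  have notin: "x (\<tau> i - 1) \<notin> beyond u v i" if "i < m" for i
    using not_less_Least[of "\<tau> i - 1" "\<lambda>j. x j \<in> beyond u v i"] pos[OF that] by (simp add: \<tau>_def)
  have edge: "wd (x (\<tau> i - 1)) (x (\<tau> i)) \<le> 1" if "i < m" for i
  proof -
    have "\<tau> i - 1 < n" using pos[OF that] le[OF that] by linarith
    then have "wd (x (\<tau> i - 1)) (x (Suc (\<tau> i - 1))) \<le> 1"
      using x unfolding edge_path_def by blast
    then show ?thesis using pos[OF that] by simp
  qed
  have cr: "x (\<tau> i) = x (\<tau> i - 1) + gen (u i)" "- v i + x (\<tau> i - 1) \<in> St (u i)"
    "- v i + x (\<tau> i) \<in> St (u i)" if "i < m" for i
    using cross_wall[OF edge[OF that], of "u i" "- v i"] notin[OF that] in_b[OF that]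
    by (auto simp: beyond_def)
  show "0 < \<tau> i \<and> \<tau> i \<le> n" if "i < m" for i using pos le that by blast
  show "- v i + x (\<tau> i - 1) \<in> St (u i)" "- v i + x (\<tau> i) \<in> St (u i)" if "i < m" for i
    using cr that by blast+
  show "\<tau> i < \<tau> (Suc i)" if i: "Suc i < m" for i
  proof -
    have "\<tau> i \<le> \<tau> (Suc i)"
      unfolding \<tau>_def[of i] using in_b[OF i] beyond_Suc[OF chain i] by (intro Least_le) auto
    moreover have "\<tau> i \<noteq> \<tau> (Suc i)"
    proof
      assume eq: "\<tau> i = \<tau> (Suc i)"
      have "\<not> far (u i) (- v i + x (\<tau> i - 1))" "far (u i) (- v i + x (\<tau> i))"
        using notin[of i] in_b[of i] i by (auto simp: beyond_def)
      then have "far (u i) ((- v i + x (\<tau> i - 1)) + gen (u (Suc i)))"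
        using cr(1)[OF i] eq by (simp add: add.assoc)
      with \<open>\<not> far (u i) (- v i + x (\<tau> i - 1))\<close> have "u (Suc i) = u i" by (simp add: far_add_gen)
      then show False using chain i by (auto simp: wall_chain_def)
    qed
    ultimately show ?thesis by simp
  qed
qed

section \<open>Corners between two walls and the cost of turning them\<close>

text \<open>The walls of \<open>s\<close> and \<open>t\<close> both pass next to 0, and the path
  leads from one to the other outside a ball about 0. The summand 1 accounts for the edge across the
  second wall and makes exponent 0 trivial (\<open>corner_0\<close>).\<close>

definition corner :: "real \<Rightarrow> nat \<Rightarrow> 'v::simple_graph \<Rightarrow> 'v \<Rightarrow> bool" where
  "corner c e s t \<longleftrightarrow> (\<forall>R n y. edge_path y n \<longrightarrow> y 0 \<in> St s \<longrightarrow> y n \<in> St t \<longrightarrow>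
     (\<forall>j\<le>n. R \<le> len (y j)) \<longrightarrow> c * real R ^ e \<le> real n + 1)"

lemma cornerD:
  "corner c e s t \<Longrightarrow> edge_path y n \<Longrightarrow> y 0 \<in> St s \<Longrightarrow> y n \<in> St t \<Longrightarrow> (\<And>j. j \<le> n \<Longrightarrow> R \<le> len (y j))
   \<Longrightarrow> c * real R ^ e \<le> real n + 1"
  unfolding corner_def by blast

lemma corner_sym: assumes "corner c e s t" shows "corner c e t s"
  unfolding corner_def
proof (intro allI impI)
  fix R n and y :: "nat \<Rightarrow> 'a rac"
  assume y: "edge_path y n" "y 0 \<in> St t" "y n \<in> St s" "\<forall>j\<le>n. R \<le> len (y j)"
  show "c * real R ^ e \<le> real n + 1"
    by (rule cornerD[OF assms edge_path_rev[OF y(1)]]) (use y in auto)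
qed

lemma corner_0: "corner 1 0 s t" by (simp add: corner_def)

lemma corner_mono: "corner c e s t \<Longrightarrow> c' \<le> c \<Longrightarrow> corner c' e s t"
  unfolding corner_def by (meson mult_right_mono of_nat_0_le_iff order_trans zero_le_power)

lemma corner_uniform:
  assumes "finite P" "\<And>s t. (s, t) \<in> P \<Longrightarrow> \<exists>c>0. corner c e s t"
  shows "\<exists>c>0. \<forall>(s, t)\<in>P. corner c e s t"
  using assms
proof (induction P rule: finite_induct)
  case (insert p P)
  obtain c where c: "c > 0" "\<forall>(s, t)\<in>P. corner c e s t" using insert by force
  obtain c' where c': "c' > 0" "corner c' e (fst p) (snd p)" using insert.prems[of "fst p" "snd p"] by auto
  show ?case
    using c c' by (intro exI[of _ "min c c'"]) (auto intro: corner_mono)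
qed (auto intro: exI[of _ 1])

text \<open>Between consecutive crossing times the path leads from one wall to the next around the
  vertex \<open>v (Suc i)\<close>, which both walls touch. Among m walls there are m - 1 such
  corners.\<close>

lemma chain_cost:
  assumes chain: "wall_chain u v m" and m: "0 < m" and x: "edge_path x n"
    and start: "x 0 \<notin> beyond u v 0" and stop: "x n \<in> beyond u v (m - 1)"
    and corners: "\<And>i. Suc i < m \<Longrightarrow> corner c e (u i) (u (Suc i))"
    and avoid: "\<And>i j. Suc i < m \<Longrightarrow> j \<le> n \<Longrightarrow> R \<le> wd (v (Suc i)) (x j)"
  shows "real (m - 1) * (c * real R ^ e) \<le> real n"
proof -
  obtain \<tau> where \<tau>: "\<And>i. i < m \<Longrightarrow> 0 < \<tau> i \<and> \<tau> i \<le> n"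
    "\<And>i. i < m \<Longrightarrow> - v i + x (\<tau> i - 1) \<in> St (u i)" "\<And>i. i < m \<Longrightarrow> - v i + x (\<tau> i) \<in> St (u i)"
    "\<And>i. Suc i < m \<Longrightarrow> \<tau> i < \<tau> (Suc i)"
    using chain_crossing_times[OF chain m x start stop] by metis
  have gap: "c * real R ^ e \<le> real (\<tau> (Suc i)) - real (\<tau> i)" if i: "Suc i < m" for i
  proof -
    \<comment> \<open>The piece after the crossing of wall i and before that of wall i + 1,
      translated so that the corner is at 0.\<close>
    let ?y = "\<lambda>j. - v (Suc i) + x (\<tau> i + j)" and ?k = "\<tau> (Suc i) - 1 - \<tau> i"
    have k: "\<tau> i + ?k = \<tau> (Suc i) - 1" and k': "real ?k + 1 = real (\<tau> (Suc i)) - real (\<tau> i)"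
      using \<tau>(4)[OF i] by auto
    have "\<tau> i + ?k \<le> n" using k \<tau>(1)[of "Suc i"] i by auto
    have "c * real R ^ e \<le> real ?k + 1"
    proof (rule cornerD[OF corners[OF i]])
      show "edge_path ?y ?k"
        using edge_path_shift[OF x \<open>\<tau> i + ?k \<le> n\<close>] by (rule edge_path_translate)
      have "?y 0 = gen (u i) + (- v i + x (\<tau> i))"
        using wall_chain_next[OF chain, of i] i by simp
      then show "?y 0 \<in> St (u i)" using \<tau>(3)[of i] i by (simp add: St_def sp_add sp_gen)
      show "?y ?k \<in> St (u (Suc i))" using \<tau>(2)[OF i] k by simp
      show "R \<le> len (?y j)" if "j \<le> ?k" for j
      proof -
        have "\<tau> i + j \<le> n" using that k \<tau>(1)[OF i] \<tau>(4)[OF i] by linarith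
        from avoid[OF i this] show ?thesis by (simp add: wd_def)
      qed
    qed
    then show ?thesis using k' by simp
  qed
  have "real i * (c * real R ^ e) \<le> real (\<tau> i)" if "i < m" for i
    using that
  proof (induction i)
    case (Suc i)
    then have "real i * (c * real R ^ e) \<le> real (\<tau> i)" by simp
    moreover have "real (Suc i) * (c * real R ^ e) = real i * (c * real R ^ e) + c * real R ^ e"
      by (simp only: of_nat_Suc distrib_right mult_1_left) 
    ultimately show ?case using gap[OF Suc.prems] by linarith
  qed simp
  from this[of "m - 1"] \<tau>(1)[of "m - 1"] m show ?thesis by fastforce
qed

lemma chain_length:
  assumes chain: "wall_chain u v m" and x: "edge_path x n"
    and start: "x 0 \<notin> beyond u v 0" and stop: "x n \<in> beyond u v (m - 1)"
  shows "m \<le> n"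
proof (cases "m = 0")
  case False
  then obtain \<tau> where \<tau>: "\<And>i. i < m \<Longrightarrow> 0 < \<tau> i \<and> \<tau> i \<le> n" "\<And>i. Suc i < m \<Longrightarrow> \<tau> i < \<tau> (Suc i)"
    using chain_crossing_times[OF chain _ x start stop] by (metis gr0I)
  have "i < \<tau> i" if "i < m" for i
    using that
  proof (induction i)
    case 0 then show ?case using \<tau>(1) by simp
  next
    case (Suc i) then show ?case using \<tau>(2)[of i] by fastforce
  qed
  from this[of "m - 1"] \<tau>(1)[of "m - 1"] False show ?thesis by fastforce
qed simp

lemma geodesic_path:
  obtains f where "edge_path f (wd x y)" "f 0 = x" "f (wd x y) = y"
proof -
  obtain us where us: "- x + y = word us" "length us = wd x y" unfolding wd_def by (rule len_word)
  have "x + word us = y" by (simp flip: us(1) add.assoc)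
  then show thesis using that[of "\<lambda>i. x + word (take i us)"] edge_path_word us by auto
qed

lemma chain_wd:
  assumes "wall_chain u v m" "x \<notin> beyond u v 0" "y \<in> beyond u v (m - 1)"
  shows "m \<le> wd x y"
proof -
  obtain f where "edge_path f (wd x y)" "f 0 = x" "f (wd x y) = y" by (rule geodesic_path)
  then show ?thesis using chain_length[OF assms(1), of f "wd x y"] assms by simp
qed

lemma chain_start: "v 0 \<notin> beyond u v 0"
  by (simp add: beyond_def)

text \<open>Letters different from the label of the last wall cannot cross back over it. With
  \<open>chain_wd\<close> this gives lower bounds for the length of a word times a subgroup
  element.\<close>

lemma chain_end: 
  assumes "wall_chain u v m" "0 < m" "h \<in> sp A" "u (m - 1) \<notin> A" 
  shows "v m + h \<in> beyond u v (m - 1)"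
proof -
  have "v m = v (m - 1) + gen (u (m - 1))" using assms by (cases m) (auto simp: wall_chain_def)
  then have "- v (m - 1) + (v m + h) = gen (u (m - 1)) + h" by (simp flip: add.assoc)
  then show ?thesis using assms by (simp add: beyond_def far_gen_left not_far_sp)
qed

section \<open>Reduced words\<close>

definition reduced_word :: "'v::simple_graph list \<Rightarrow> bool" where
  "reduced_word x \<longleftrightarrow> length x = len (word x)"

lemma reduced_word_append:
  assumes "reduced_word (x @ y)" shows "reduced_word x" "reduced_word y"
proof -
  have "length x + length y \<le> len (word x) + len (word y)"
    using assms len_add[of "word x" "word y"] by (simp add: reduced_word_def word_append)
  then show "reduced_word x" "reduced_word y"
    using len_word_le[of x] len_word_le[of y] by (auto simp: reduced_word_def)
qed

lemma not_reducedI: "word x = word y \<Longrightarrow> length y < length x \<Longrightarrow> \<not> reduced_word x"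
  using len_word_le[of y] by (simp add: reduced_word_def)

lemma reduced_word_twice: "\<not> reduced_word (x @ s # s # y)"
  by (rule not_reducedI[of _ "x @ y"]) (simp_all add: word_append word_Cons[of s "s # y"] word_Cons[of s y] flip: add.assoc)

lemma reduced_word_nth_neq:
  assumes "reduced_word us" "Suc i < length us" shows "us ! i \<noteq> us ! Suc i"
proof
  assume eq: "us ! i = us ! Suc i"
  have "us = take i us @ us ! i # us ! Suc i # drop (Suc (Suc i)) us"
    using assms(2) by (metis Cons_nth_drop_Suc Suc_lessD append_take_drop_id)
  with eq assms(1) reduced_word_twice show False by metis
qed

lemma wall_chain_word:
  assumes "\<And>i. Suc i < length us \<Longrightarrow> us ! i \<noteq> us ! Suc i \<and> \<not> adj (us ! i) (us ! Suc i)"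
  shows "wall_chain (\<lambda>i. us ! i) (\<lambda>i. g + word (take i us)) (length us)"
  using assms unfolding wall_chain_def by (auto simp: take_Suc_conv_app_nth word_append add.assoc)

text \<open>When no two neighbouring letters commute, the walls crossed are nested, so the ends are
  separated by as many walls as there are letters.\<close>

lemma chain_word_reduced:
  assumes "\<And>i. Suc i < length us \<Longrightarrow> us ! i \<noteq> us ! Suc i \<and> \<not> adj (us ! i) (us ! Suc i)"
  shows "reduced_word us"
proof (cases "us = []")
  case False
  have "length us \<le> wd 0 (word us)"
    using chain_wd[OF wall_chain_word[OF assms, of 0], of 0 "word us"]
      chain_end[OF wall_chain_word[OF assms, of 0], of 0 "{}"] chain_start[of "\<lambda>i. 0 + word (take i us)"] False
    by simp
  then show ?thesis using len_word_le[of us] by (simp add: reduced_word_def)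
qed (simp add: reduced_word_def)

lemma far_crossing:
  assumes "far s (g + word x)" "\<not> far s g"
  obtains p q where "x = p @ s # q" "g + word p \<in> St s"
proof -
  have "far s (g + word x) \<longrightarrow> (\<exists>p q. x = p @ s # q \<and> g + word p \<in> St s)"
  proof (induction x rule: rev_induct)
    case (snoc t x)
    show ?case
    proof (cases "far s (g + word x)")
      case True
      then show ?thesis using snoc by force
    next
      case False
      then show ?thesis using far_add_gen[of s "g + word x" t] by (auto simp: word_append add.assoc)
    qed
  qed (use assms in auto)
  with assms that show thesis by blast
qed

lemma St_conj: assumes "w \<in> St s" shows "gen s + (w + gen s) = w"
  using St_commute[OF assms] by (simp flip: add.assoc) (simp add: add.assoc)

text \<open>A reduced word crosses each of its walls once: the part between two crossings of the
  wall of \<open>s\<close> lies in \<open>St s\<close>, where \<open>s\<close> is central, so both letters \<open>s\<close> could be cancelled.\<close>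

lemma reduced_word_far:
  assumes "reduced_word (x @ s # y)"
  shows "far s (- word x + word (x @ s # y))" "\<not> far s (- word x)"
proof -
  have "\<not> far s (word y)"
  proof
    assume "far s (word y)"
    then obtain p q where "y = p @ s # q" "word p \<in> St s" using far_crossing[of s 0 y] by auto
    then have "word (x @ s # y) = word (x @ p @ q)"
      using St_conj[of "word p" s]
      by (simp add: word_append word_Cons[of s "_ @ _"] word_Cons[of s q] flip: add.assoc)
    then show False using assms \<open>y = _\<close> by (auto dest: not_reducedI)
  qed
  then show "far s (- word x + word (x @ s # y))"
    by (simp add: word_append word_Cons[of s y] far_gen_left flip: add.assoc)
  show "\<not> far s (- word x)"
  proof
    assume "far s (- word x)"
    then have "far s (0 + word (rev x))" by (simp add: word_rev)
    then obtain p q where "rev x = p @ s # q" "word p \<in> St s" using far_crossing[of s 0 "rev x"] by auto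
    then have x: "x = rev q @ s # rev p" by (metis rev_append rev_rev_ident rev.simps(2) append.assoc append_Cons append_Nil)
    have "word (rev p) \<in> St s" using \<open>word p \<in> St s\<close> by (simp add: word_rev St_def sp_uminus)
    then have "word (x @ s # y) = word (rev q @ rev p @ y)"
      unfolding x using St_conj[of "word (rev p)" s]
      by (simp add: word_append word_Cons[of s "_ @ _"] word_Cons[of s y] word_Cons[of s "rev p"] flip: add.assoc)
    then show False using assms x by (auto dest: not_reducedI)
  qed
qed

text \<open>One step of the recursion of Dani and Thomas. The start of the path is far out on the wall of
  \<open>s\<close>; the geodesic to it inside that wall crosses walls with labels in \<open>lk s\<close>, almost none of
  which meets the wall of \<open>t\<close>. So the path crosses them too, and turns a corner between any
  two of them.\<close>

lemma corner_step:
  fixes s t :: "'v::simple_graph"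
  assumes indep: "\<And>p q. p \<in> lk s \<Longrightarrow> q \<in> lk s \<Longrightarrow> \<not> adj p q"
    and common: "\<And>p q. p \<in> lk s \<inter> lk t \<Longrightarrow> q \<in> lk s \<inter> lk t \<Longrightarrow> p = q"
    and st: "\<not> adj s t"
    and corners: "\<exists>c>0. \<forall>p\<in>lk s. \<forall>q\<in>lk s. p \<noteq> q \<longrightarrow> corner c e p q"
  shows "\<exists>c>0. corner c (Suc e) s t"
proof -
  obtain c0 where c0: "c0 > 0" "\<And>p q. p \<in> lk s \<Longrightarrow> q \<in> lk s \<Longrightarrow> p \<noteq> q \<Longrightarrow> corner c0 e p q"
    using corners by blast
  \<comment> \<open>For R < 8 the divisor 8 ^ Suc e makes the claim trivial; for R \<ge> 8 both the
    number m - 1 of corners and their radius R div 2 are at least R / 8.\<close>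
  define c where "c = min c0 1 / 8 ^ Suc e"
  have c: "c > 0" using c0 by (simp add: c_def)
  have cost: "c * real R ^ Suc e \<le> real n + 1"
    if y: "edge_path y n" "y 0 \<in> St s" "y n \<in> St t" "\<forall>j\<le>n. R \<le> len (y j)" for R n y
  proof (cases "R < 8")
    case True
    have "c * real R ^ Suc e \<le> c * 8 ^ Suc e"
      using True c by (intro mult_left_mono power_mono) auto
    also have "\<dots> \<le> 1" by (simp add: c_def)
    finally show ?thesis by simp
  next
    case False
    \<comment> \<open>\<open>gen s\<close> is central in \<open>St s\<close>, so up to one letter
      \<open>s\<close> the start of the path lies in the subgroup of the link.\<close>
    obtain z where z: "z \<in> sp (lk s)" "y 0 = z \<or> y 0 = z + gen s"
    proof -
      have "\<exists>z. z \<in> sp (lk s) \<and> (w = z \<or> w = z + gen s)" if "w \<in> St s" for w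
        using that unfolding St_def
      proof (induction rule: sp_induct)
        case (gen w t)
        then obtain z where z: "z \<in> sp (lk s)" "w = z \<or> w = z + gen s" by auto
        show ?case
        proof (cases "t = s")
          case True
          then show ?thesis using z by (auto simp: add.assoc)
        next
          case False
          then have t: "t \<in> lk s" using gen by simp
          then have "gen s + gen t = gen t + gen s" using gen_commute[of s t] by (simp add: lk_def)
          then have "w + gen t = (z + gen t) \<or> w + gen t = (z + gen t) + gen s" using z by (auto simp: add.assoc)
          then show ?thesis using z t sp_add[OF z(1) sp_gen[OF t]] by blast
        qed
      qed (auto intro: exI[of _ 0])
      with y(2) that show thesis by blast
    qed
    obtain us where us: "z = word us" "set us \<subseteq> lk s" "length us = len z" by (rule sp_geodesic_word[OF z(1)])
    have "reduced_word us" using us by (simp add: reduced_word_def)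
    then have us_neq: "us ! i \<noteq> us ! Suc i" if "Suc i < length us" for i
      using that by (rule reduced_word_nth_neq)
    have us_lk: "us ! i \<in> lk s" if "i < length us" for i using that us(2) nth_mem by blast
    have "R \<le> len z + 1" using y(4) z(2) len_add[of z "gen s"] len_gen_le[of s] by (auto dest!: spec[of _ 0])
    then have lus: "R \<le> length us + 1" using us by simp
    \<comment> \<open>A first letter in \<open>lk t\<close> labels a wall that meets the wall of
      \<open>t\<close>, and is skipped. By \<open>common\<close> the next letter, being a different
      one, is then outside \<open>lk t\<close>.\<close>
    define k where "k = (if us ! 0 \<in> lk t then 1 else 0 :: nat)"
    \<comment> \<open>Only walls up to radius about R / 2 are used, so that the path keeps distance
      R div 2 from all corners.\<close>
    define m where "m = R div 2 - 1"
    have km: "k + m \<le> R div 2" "2 \<le> m" "k + m \<le> length us" using False lus by (auto simp: k_def m_def)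
    define u where "u i = us ! (k + i)" for i
    define v where "v i = word (take (k + i) us)" for i
    have chain0: "wall_chain (\<lambda>i. us ! i) (\<lambda>i. word (take i us)) (length us)"
      using wall_chain_word[of us 0] us_neq us_lk indep by simp
    have chain: "wall_chain u v (length us - k)"
      unfolding u_def v_def using wall_chain_shift[OF chain0, of k "length us - k"] km by simp
    have chain_m: "wall_chain u v m" using wall_chain_mono[OF chain] km by simp
    \<comment> \<open>Reversed, the path starts on the wall of \<open>t\<close>, on the near side of
      the whole chain, and ends beyond it.\<close>
    let ?x = "\<lambda>j. y (n - j)"
    have start: "?x 0 \<notin> beyond u v 0"
    proof -
      have "v 0 \<in> St t" unfolding v_def using us(2) km False
        by (cases us) (auto simp: k_def St_def intro!: sp_gen)
      then have "- v 0 + ?x 0 \<in> St t" using y(3) by (simp add: St_def sp_add sp_uminus)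
      moreover have "u 0 \<notin> insert t (lk t)"
      proof -
        have "u 0 \<in> lk s" unfolding u_def using us_lk km by auto
        then have "u 0 \<noteq> t" using st by (auto simp: lk_def)
        moreover have "u 0 \<notin> lk t"
        proof (cases "us ! 0 \<in> lk t")
          case True
          have "us ! 0 \<noteq> us ! 1" using us_neq[of 0] km by simp
          moreover have "us ! 0 \<in> lk s" "us ! 1 \<in> lk s" using km by (auto intro!: us_lk simp del: One_nat_def)
          ultimately have "us ! 1 \<notin> lk t" using common True by blast
          then show ?thesis using True by (simp add: u_def k_def)
        qed (simp add: u_def k_def)
        ultimately show ?thesis by simp
      qed
      ultimately show ?thesis unfolding St_def beyond_def by (simp add: not_far_sp)
    qed
    have stop: "?x n \<in> beyond u v (m - 1)"
    proof -
      let ?M = "length us - k"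
      have M: "0 < ?M" using km by simp
      have "v ?M = z" using us(1) km by (simp add: v_def)
      have "u (?M - 1) = us ! (length us - 1)" using km by (simp add: u_def)
      then have "u (?M - 1) \<in> lk s" using us_lk[of "length us - 1"] km by simp
      then have "u (?M - 1) \<noteq> s" by auto
      then have "v ?M + h \<in> beyond u v (?M - 1)" if "h \<in> {0, gen s}" for h
        using that by (intro chain_end[OF chain M, of h "{s}"]) (auto intro: sp_gen)
      then have "y 0 \<in> beyond u v (?M - 1)" using z(2) \<open>v ?M = z\<close> by force
      moreover have "beyond u v (?M - 1) \<subseteq> beyond u v (m - 1)"
        using km by (intro beyond_antimono[OF chain]) auto
      ultimately show ?thesis by auto
    qed
    have avoid: "R div 2 \<le> wd (v (Suc i)) (?x j)" if "Suc i < m" "j \<le> n" for i j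
    proof -
      have "R \<le> len (?x j)" using y(4) by simp
      also have "\<dots> \<le> len (v (Suc i)) + wd (v (Suc i)) (?x j)"
        using wd_triangle[of 0 "?x j" "v (Suc i)"] by simp
      also have "len (v (Suc i)) \<le> k + Suc i"
        unfolding v_def using len_word_le[of "take (k + Suc i) us"] by simp
      finally show ?thesis using that km by linarith
    qed
    have "real (m - 1) * (c0 * real (R div 2) ^ e) \<le> real n"
    proof (rule chain_cost[OF chain_m _ edge_path_rev[OF y(1)] start stop _ avoid])
      show "corner c0 e (u i) (u (Suc i))" if "Suc i < m" for i
        using that km us_neq us_lk by (intro c0) (auto simp: u_def)
    qed (use km in auto)
    moreover have "c * real R ^ Suc e \<le> real (m - 1) * (c0 * real (R div 2) ^ e)"
    proof -
      have "c * real R ^ Suc e \<le> c0 / 8 ^ Suc e * real R ^ Suc e"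
        unfolding c_def by (intro mult_right_mono divide_right_mono) auto
      also have "\<dots> = real R / 8 * (c0 * (real R / 8) ^ e)" by (simp add: power_divide)
      also have "\<dots> \<le> real (m - 1) * (c0 * real (R div 2) ^ e)"
      proof (intro mult_mono mult_left_mono power_mono)
        show "real R / 8 \<le> real (m - 1)" using False unfolding m_def by linarith
        show "real R / 8 \<le> real (R div 2)" using False by linarith
      qed (use c0 in auto)
      finally show ?thesis .
    qed
    ultimately show ?thesis by linarith
  qed
  show ?thesis using c cost by (intro exI[of _ c]) (auto simp: corner_def)
qed

section \<open>Corners in the groups of the graphs \<open>\<Omega>\<^sub>d\<close>\<close>

datatype indexed_vertex = Ix nat omega_vertex

text \<open>All graphs \<open>\<Omega>\<^sub>d\<close> live disjointly in one type, since a type cannot depend on \<open>d\<close>.\<close>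

instantiation indexed_vertex :: simple_graph
begin
definition adj_indexed_vertex :: "indexed_vertex \<Rightarrow> indexed_vertex \<Rightarrow> bool" where
  "adj_indexed_vertex x y = (case (x, y) of (Ix d u, Ix d' v) \<Rightarrow> d = d' \<and> {u, v} \<in> omega_edges d)"
instance
proof
  fix x y :: indexed_vertex
  show "adj x y \<Longrightarrow> adj y x"
    by (auto simp: adj_indexed_vertex_def insert_commute split: indexed_vertex.splits)
  show "\<not> adj x x"
    by (auto simp: adj_indexed_vertex_def omega_edges_def doubleton_eq_iff split: indexed_vertex.splits)
qed
end

lemma adj_Ix [simp]: "adj (Ix d u) (Ix d' v) \<longleftrightarrow> d = d' \<and> {u, v} \<in> omega_edges d"
  by (simp add: adj_indexed_vertex_def)

lemma lk_Ix: "lk (Ix d u) = Ix d ` {v. {u, v} \<in> omega_edges d}"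
proof -
  have "x \<in> lk (Ix d u) \<longleftrightarrow> x \<in> Ix d ` {v. {u, v} \<in> omega_edges d}" for x
    by (cases x) (auto simp: lk_def)
  then show ?thesis by blast
qed

lemma nb_c1: "{v. {Vc 1, v} \<in> omega_edges d} = {Vb 1, Vc 2}"
  by (auto simp: omega_edges_def doubleton_eq_iff)
lemma nb_c2: "{v. {Vc 2, v} \<in> omega_edges d} = {Vc 1, Va d}"
  by (auto simp: omega_edges_def doubleton_eq_iff)
lemma nb_b: "{Vb k, v} \<in> omega_edges d \<Longrightarrow> 2 \<le> k \<Longrightarrow> v = Va (k - 1) \<or> v = Vb (k - 1) \<or> v = Vb (Suc k)"
  by (auto simp: omega_edges_def doubleton_eq_iff)
lemma nb_b1: "{Vb 1, v} \<in> omega_edges d \<Longrightarrow> v = Va 0 \<or> v = Vb 0 \<or> v = Vc 1 \<or> v = Vb 2"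
  by (auto simp: omega_edges_def doubleton_eq_iff)
lemma nb_a: "{Va k, v} \<in> omega_edges d \<Longrightarrow> 1 \<le> k \<Longrightarrow> v = Va 0 \<or> v = Vb 0 \<or> v = Vb (Suc k) \<or> v = Vc 2"
  by (auto simp: omega_edges_def doubleton_eq_iff)

lemma lk_c: "lk (Ix d (Vc 1)) = {Ix d (Vb 1), Ix d (Vc 2)}" "lk (Ix d (Vc 2)) = {Ix d (Vc 1), Ix d (Va d)}"
  unfolding lk_Ix nb_c1 nb_c2 by auto

definition c_letters :: "nat \<Rightarrow> indexed_vertex set" where "c_letters d = {Ix d (Vc 1), Ix d (Vc 2)}"

text \<open>Two common neighbours would give a 4-cycle through c_1 or c_2, and these letters lie on
  none.\<close>

lemma c_common:
  assumes "1 \<le> d" "s \<in> c_letters d" "t \<noteq> s" "p \<in> lk s \<inter> lk t" "q \<in> lk s \<inter> lk t" shows "p = q"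
proof (rule ccontr)
  assume "p \<noteq> q"
  have t: "t \<in> lk p" "t \<in> lk q" using assms(4,5) lk_sym by auto
  \<comment> \<open>The fourth vertex \<open>t\<close> of such a cycle would be adjacent to b_1 and
    c_2, or to c_1 and a_d.\<close>
  have 1: "u = Vc 1" if "{Vb 1, u} \<in> omega_edges d" "{Vc 2, u} \<in> omega_edges d" for u
  proof -
    have "u \<in> {Vc 1, Va d}" using that(2) nb_c2[of d] by blast
    then show ?thesis using nb_b1[OF that(1)] assms(1) by auto
  qed
  have 2: "u = Vc 2" if "{Vc 1, u} \<in> omega_edges d" "{Va d, u} \<in> omega_edges d" for u
  proof -
    have "u \<in> {Vb 1, Vc 2}" using that(1) nb_c1[of d] by blast
    then show ?thesis using nb_a[OF that(2)] assms(1) by auto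
  qed
  from assms(2) consider "s = Ix d (Vc 1)" | "s = Ix d (Vc 2)" by (auto simp: c_letters_def)
  then show False
  proof cases
    case s: 1
    with assms(4,5) \<open>p \<noteq> q\<close> have "{p, q} = {Ix d (Vb 1), Ix d (Vc 2)}" by (auto simp: lk_c simp del: One_nat_def)
    then have "t \<in> lk (Ix d (Vb 1)) \<inter> lk (Ix d (Vc 2))" using t by (auto simp: doubleton_eq_iff)
    then show False using 1 assms(3) \<open>s = _\<close> unfolding lk_Ix by auto
  next
    case s: 2
    with assms(4,5) \<open>p \<noteq> q\<close> have "{p, q} = {Ix d (Vc 1), Ix d (Va d)}" by (auto simp: lk_c simp del: One_nat_def)
    then have "t \<in> lk (Ix d (Vc 1)) \<inter> lk (Ix d (Va d))" using t by (auto simp: doubleton_eq_iff)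
    then show False using 2 assms(3) \<open>s = _\<close> unfolding lk_Ix by auto
  qed
qed

lemma c_indep: "1 \<le> d \<Longrightarrow> s \<in> c_letters d \<Longrightarrow> p \<in> lk s \<Longrightarrow> q \<in> lk s \<Longrightarrow> \<not> adj p q"
  by (auto simp: c_letters_def lk_c omega_edges_def doubleton_eq_iff simp del: One_nat_def)

text \<open>Of the two letters in the link of a \<open>c\<close> letter one is again a
  \<open>c\<close> letter, and \<open>corner_step\<close> applies to it and every other letter that
  does not commute with it. So the induction runs through all exponents, whatever \<open>d\<close>
  is.\<close>

lemma c_corner:
  assumes d: "1 \<le> d"
  shows "s \<in> c_letters d \<Longrightarrow> t \<noteq> s \<Longrightarrow> \<not> adj s t \<Longrightarrow> \<exists>c>0. corner c e s t"
proof (induction e arbitrary: s t)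
  case 0
  show ?case using corner_0 by (intro exI[of _ 1]) simp
next
  case (Suc e)
  show ?case
  proof (rule corner_step)
    show "\<not> adj p q" if "p \<in> lk s" "q \<in> lk s" for p q using c_indep[OF d Suc.prems(1) that] .
    show "p = q" if "p \<in> lk s \<inter> lk t" "q \<in> lk s \<inter> lk t" for p q
      using c_common[OF d Suc.prems(1,2) that] .
    have pair: "\<exists>c>0. corner c e p q" if "p \<in> lk s" "q \<in> lk s" "p \<noteq> q" for p q
    proof -
      have "p \<in> c_letters d \<or> q \<in> c_letters d"
        using Suc.prems(1) that by (auto simp: c_letters_def lk_c simp del: One_nat_def)
      moreover have "\<not> adj p q" "\<not> adj q p" using c_indep[OF d Suc.prems(1)] that by auto
      ultimately show ?thesis using Suc.IH[of p q] Suc.IH[of q p] that corner_sym by metis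
    qed
    have "finite (lk s)" using Suc.prems(1) by (auto simp: c_letters_def lk_c simp del: One_nat_def)
    then have "\<exists>c>0. \<forall>(p, q)\<in>{(p, q) \<in> lk s \<times> lk s. p \<noteq> q}. corner c e p q"
      using pair by (intro corner_uniform) (auto intro: finite_subset[of _ "lk s \<times> lk s"])
    then show "\<exists>c>0. \<forall>p\<in>lk s. \<forall>q\<in>lk s. p \<noteq> q \<longrightarrow> corner c e p q" by blast
  qed (rule Suc.prems(3))
qed

text \<open>The link of b_j lies in {a_(j-1), b_(j-1), b_(j+1)}. The corner that limits the exponent
  is that of a_(j-1) and b_(j-1): each step of the recursion uses up one index, so b_j supports the
  exponent j - 1.\<close>

lemma b_corner:
  assumes "Suc e \<le> j" "\<not> adj (Ix d (Vb j)) t" "\<And>p q. p \<in> lk (Ix d (Vb j)) \<inter> lk t \<Longrightarrow> q \<in> lk (Ix d (Vb j)) \<inter> lk t \<Longrightarrow> p = q"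
  shows "\<exists>c>0. corner c e (Ix d (Vb j)) t"
  using assms
proof (induction e arbitrary: j t)
  case 0
  show ?case using corner_0 by (intro exI[of _ 1]) simp
next
  case (Suc e)
  define L where "L = {Ix d (Va (j - 1)), Ix d (Vb (j - 1)), Ix d (Vb (Suc j))}"
  have j: "2 \<le> j" using Suc.prems by simp
  have lkL: "lk (Ix d (Vb j)) \<subseteq> L" unfolding L_def lk_Ix using nb_b[OF _ j, of _ d] by auto
  have indep: "\<not> adj p q" if "p \<in> L" "q \<in> L" for p q
    using that j by (auto simp: L_def omega_edges_def doubleton_eq_iff)
  have pair: "\<exists>c>0. corner c e p q" if "p \<in> L" "q \<in> L" "p \<noteq> q" for p q
  proof -
    have next_corner: "\<exists>c>0. corner c e (Ix d (Vb (Suc j))) q" if "q \<in> {Ix d (Va (j - 1)), Ix d (Vb (j - 1))}" for q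
    proof (rule Suc.IH)
      show "\<not> adj (Ix d (Vb (Suc j))) q" using that by (intro indep) (auto simp: L_def)
      have 1: "v = Vb j" if "{Vb (Suc j), v} \<in> omega_edges d" "{Va (j - 1), v} \<in> omega_edges d" for v
        proof -
        have "1 \<le> j - 1" using j by simp
        then show ?thesis using nb_b[OF that(1)] nb_a[OF that(2)] j by auto
      qed
      have 2: "v = Vb j" if v: "{Vb (Suc j), v} \<in> omega_edges d" "{Vb (j - 1), v} \<in> omega_edges d" for v
      proof (cases "j = 2")
        case True
        then show ?thesis using nb_b[OF v(1)] nb_b1[of v d] v(2) by auto
      next
        case False
        then have "2 \<le> j - 1" using j by simp
        then show ?thesis using nb_b[OF v(1)] nb_b[OF v(2)] j by auto
      qed
      show "p = p'" if "p \<in> lk (Ix d (Vb (Suc j))) \<inter> lk q" "p' \<in> lk (Ix d (Vb (Suc j))) \<inter> lk q" for p p'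
      proof -
        have "lk (Ix d (Vb (Suc j))) \<inter> lk q \<subseteq> {Ix d (Vb j)}" using \<open>q \<in> _\<close> 1 2 by (auto simp: lk_Ix)
        with that show ?thesis by blast
      qed
    qed (use Suc.prems(1) in simp)
    \<comment> \<open>If j - 1 = 1, the two letters have the common neighbours a_0 and b_0 and the
      recursion stops; the bound on the exponent then forces e = 0.\<close>
    have low_corner: "\<exists>c>0. corner c e (Ix d (Vb (j - 1))) (Ix d (Va (j - 1)))"
    proof (cases "e = 0")
      case True
      then show ?thesis using corner_0 by (intro exI[of _ 1]) simp
    next
      case False
      show ?thesis
      proof (rule Suc.IH)
        show "Suc e \<le> j - 1" using Suc.prems(1) by simp
        show "\<not> adj (Ix d (Vb (j - 1))) (Ix d (Va (j - 1)))" by (intro indep) (auto simp: L_def)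
        have "{v. {Vb (j - 1), v} \<in> omega_edges d} \<inter> {v. {Va (j - 1), v} \<in> omega_edges d} \<subseteq> {Vb j}"
          using nb_b[of "j - 1" _ d] nb_a[of "j - 1" _ d] False Suc.prems(1) by fastforce
        then show "p = p'" if "p \<in> lk (Ix d (Vb (j - 1))) \<inter> lk (Ix d (Va (j - 1)))"
          "p' \<in> lk (Ix d (Vb (j - 1))) \<inter> lk (Ix d (Va (j - 1)))" for p p'
          using that unfolding lk_Ix by auto
      qed
    qed
    from that consider "p = Ix d (Vb (Suc j))" "q \<in> {Ix d (Va (j - 1)), Ix d (Vb (j - 1))}"
      | "q = Ix d (Vb (Suc j))" "p \<in> {Ix d (Va (j - 1)), Ix d (Vb (j - 1))}"
      | "p = Ix d (Vb (j - 1))" "q = Ix d (Va (j - 1))"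
      | "q = Ix d (Vb (j - 1))" "p = Ix d (Va (j - 1))" by (auto simp: L_def)
    then show ?thesis
      using next_corner low_corner corner_sym by cases blast+
  qed
  show ?case
  proof (rule corner_step)
    have "\<exists>c>0. \<forall>(p, q)\<in>{(p, q) \<in> L \<times> L. p \<noteq> q}. corner c e p q"
      using pair by (intro corner_uniform) (auto intro: finite_subset[of _ "L \<times> L"] simp: L_def)
    then show "\<exists>c>0. \<forall>p\<in>lk (Ix d (Vb j)). \<forall>q\<in>lk (Ix d (Vb j)). p \<noteq> q \<longrightarrow> corner c e p q"
      using lkL by blast
  qed (use indep lkL Suc.prems in blast)+
qed

lemma ab_corner:
  assumes "2 \<le> d"
  obtains c where "c > 0" "corner c (d - 1) (Ix d (Vb d)) (Ix d (Va d))" "corner c (d - 1) (Ix d (Va d)) (Ix d (Vb d))"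
proof -
  have "{v. {Vb d, v} \<in> omega_edges d} \<inter> {v. {Va d, v} \<in> omega_edges d} \<subseteq> {Vb (Suc d)}"
    using nb_b[OF _ assms, of _ d] nb_a[of d _ d] assms by fastforce
  then have "p = q" if "p \<in> lk (Ix d (Vb d)) \<inter> lk (Ix d (Va d))" "q \<in> lk (Ix d (Vb d)) \<inter> lk (Ix d (Va d))" for p q
    using that unfolding lk_Ix by auto
  moreover have "\<not> adj (Ix d (Vb d)) (Ix d (Va d))"
    using assms by (auto simp: omega_edges_def doubleton_eq_iff)
  ultimately have "\<exists>c>0. corner c (d - 1) (Ix d (Vb d)) (Ix d (Va d))"
    using assms by (intro b_corner) auto
  then show thesis using that corner_sym by blast
qed

section \<open>Paths avoiding balls\<close>

text \<open>Edge paths may pause, so \<open>n\<close> acts as an upper bound for the number of edges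
  (\<open>reach_mono\<close>).\<close>

definition reach :: "'v::simple_graph rac set \<Rightarrow> nat \<Rightarrow> 'v rac \<Rightarrow> 'v rac \<Rightarrow> bool" where
  "reach B n x y \<longleftrightarrow> (\<exists>f. edge_path f n \<and> f 0 = x \<and> f n = y \<and> (\<forall>i\<le>n. f i \<in> B))"

lemma reach_endpoints: "reach B n x y \<Longrightarrow> x \<in> B \<and> y \<in> B"
  unfolding reach_def by auto

lemma reach_refl: "x \<in> B \<Longrightarrow> reach B n x x"
  unfolding reach_def by (intro exI[of _ "\<lambda>_. x"]) (simp add: edge_path_def)

lemma reach_sym: assumes "reach B n x y" shows "reach B n y x"
proof -
  obtain f where "edge_path f n" "f 0 = x" "f n = y" "\<forall>i\<le>n. f i \<in> B" using assms unfolding reach_def by blast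
  then show ?thesis unfolding reach_def by (intro exI[of _ "\<lambda>i. f (n - i)"]) (simp add: edge_path_rev)
qed

lemma reach_trans: assumes "reach B m x y" "reach B n y z" shows "reach B (m + n) x z"
proof -
  obtain f where f: "edge_path f m" "f 0 = x" "f m = y" "\<forall>i\<le>m. f i \<in> B" using assms(1) unfolding reach_def by blast
  obtain g where g: "edge_path g n" "g 0 = y" "g n = z" "\<forall>i\<le>n. g i \<in> B" using assms(2) unfolding reach_def by blast
  let ?h = "\<lambda>i. if i \<le> m then f i else g (i - m)"
  have "edge_path ?h (m + n)"
    unfolding edge_path_def
  proof (intro allI impI)
    fix i assume i: "i < m + n"
    consider "i < m" | "i = m" | "i > m" by linarith
    then show "wd (?h i) (?h (Suc i)) \<le> 1"
    proof cases
      case 1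
      then show ?thesis using f(1) by (simp add: edge_path_def)
    next
      case 2
      then have "wd (g 0) (g (Suc 0)) \<le> 1" using i g(1) by (simp add: edge_path_def)
      then show ?thesis using 2 f(3) g(2) by simp
    next
      case 3
      then have "wd (g (i - m)) (g (Suc (i - m))) \<le> 1" using i g(1) by (simp add: edge_path_def)
      then show ?thesis using 3 by (simp add: Suc_diff_le)
    qed
  qed
  moreover have "\<forall>i\<le>m + n. ?h i \<in> B" using f g by simp
  moreover have "?h 0 = x" "?h (m + n) = z" using f g by auto
  ultimately show ?thesis unfolding reach_def by blast
qed

lemma reach_mono: assumes "reach B m x y" "m \<le> n" "B \<subseteq> B'" shows "reach B' n x y"
proof -
  have "reach B (m + (n - m)) x y"
    using assms(1) reach_endpoints[OF assms(1)] by (intro reach_trans[of B m x y]) (auto intro: reach_refl)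
  then show ?thesis using assms(2,3) unfolding reach_def by force
qed

lemma reach_translate:
  assumes "reach B n x y" "\<And>z. z \<in> B \<Longrightarrow> g + z \<in> B'" shows "reach B' n (g + x) (g + y)"
proof -
  obtain f where "edge_path f n" "f 0 = x" "f n = y" "\<forall>i\<le>n. f i \<in> B" using assms unfolding reach_def by blast
  then show ?thesis using assms(2) unfolding reach_def
    by (intro exI[of _ "\<lambda>i. g + f i"]) (auto intro: edge_path_translate)
qed

lemma reach_word:
  assumes "\<And>i. i \<le> length us \<Longrightarrow> g + word (take i us) \<in> B" shows "reach B (length us) g (g + word us)"
  unfolding reach_def
  by (intro exI[of _ "\<lambda>i. g + word (take i us)"]) (auto simp: edge_path_word assms)

section \<open>Alternating words as geodesic rays\<close>

fun alt :: "'a \<Rightarrow> 'a \<Rightarrow> nat \<Rightarrow> 'a list" where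
  "alt p q 0 = []"
| "alt p q (Suc n) = p # alt q p n"

lemma length_alt [simp]: "length (alt p q n) = n"
  by (induction n arbitrary: p q) auto
lemma take_alt [simp]: "i \<le> n \<Longrightarrow> take i (alt p q n) = alt p q i"
  by (induction n arbitrary: p q i) (auto simp: take_Cons split: nat.split)
lemma nth_alt: "i < n \<Longrightarrow> alt p q n ! i = (if even i then p else q)"
  by (induction n arbitrary: p q i) (auto simp: nth_Cons split: nat.split)
lemma set_alt: "set (alt p q n) \<subseteq> {p, q}"
  by (induction n arbitrary: p q) auto

lemma alt_chain:
  assumes "p \<noteq> q" "\<not> adj p q" "Suc i < n"
  shows "alt p q n ! i \<noteq> alt p q n ! Suc i \<and> \<not> adj (alt p q n ! i) (alt p q n ! Suc i)"
  using assms by (auto simp: nth_alt dest: adj_sym)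

text \<open>All walls crossed by \<open>us\<close> still separate 0 from \<open>word us + h\<close>,
  since the letters of \<open>h\<close> cannot cross the last of them.\<close>

lemma len_chain_add:
  assumes chain: "\<And>i. Suc i < length us \<Longrightarrow> us ! i \<noteq> us ! Suc i \<and> \<not> adj (us ! i) (us ! Suc i)"
    and h: "h \<in> sp A" and last: "us = [] \<or> last us \<notin> A"
  shows "length us \<le> len (word us + h)"
proof (cases "us = []")
  case False
  have wc: "wall_chain (\<lambda>i. us ! i) (\<lambda>i. 0 + word (take i us)) (length us)"
    using wall_chain_word[OF chain] by blast
  have "us ! (length us - 1) \<notin> A" using last False by (simp add: last_conv_nth)
  then have "0 + word (take (length us) us) + h \<in> beyond (\<lambda>i. us ! i) (\<lambda>i. 0 + word (take i us)) (length us - 1)"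
    using chain_end[OF wc _ h] False by simp
  then have "length us \<le> wd 0 (word us + h)"
    using chain_wd[OF wc, of 0] chain_start[of "\<lambda>i. 0 + word (take i us)"] by simp
  then show ?thesis by simp
qed simp

lemma len_alt_add:
  assumes "p \<noteq> q" "\<not> adj p q" "h \<in> sp A" "p \<notin> A" "q \<notin> A"
  shows "n \<le> len (word (alt p q n) + h)"
proof -
  have "last (alt p q n) \<in> {p, q}" if "n \<noteq> 0" 
    using that set_alt[of p q n] last_in_set[of "alt p q n"] by (metis length_0_conv length_alt subsetD)
  then show ?thesis using len_chain_add[of "alt p q n" h A, OF alt_chain[OF assms(1,2)]] assms(3-5) by fastforce
qed

lemma sp_commute:
  assumes "\<And>s t. s \<in> A \<Longrightarrow> t \<in> B \<Longrightarrow> adj s t" "v \<in> sp A" "w \<in> sp B" shows "v + w = w + v"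
  using assms(3)
proof (induction rule: sp_induct)
  case (gen w t)
  have "gen t + v = v + gen t" using assms(2)
  proof (induction rule: sp_induct)
    case (gen v s)
    then have "gen s + gen t = gen t + gen s" using assms(1) \<open>t \<in> B\<close> gen_commute by blast
    with gen.IH show ?case by (metis add.assoc)
  qed simp
  with gen.IH show ?case by (metis add.assoc)
qed simp

definition sp_outside :: "'v::simple_graph set \<Rightarrow> nat \<Rightarrow> 'v rac set" where
  "sp_outside A R = {x \<in> sp A. R \<le> len x}"

lemma sp_outside_mono: "R' \<le> R \<Longrightarrow> sp_outside A R \<subseteq> sp_outside A R'"
  by (auto simp: sp_outside_def)

lemma alt_sp: "p \<in> A \<Longrightarrow> q \<in> A \<Longrightarrow> word (alt p q n) \<in> sp A"
  using set_alt[of p q n] by (intro sp_word) auto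

lemma sp_outside_translate:
  assumes "g \<in> sp A" "len g + R \<le> M" "z \<in> sp_outside A M" shows "g + z \<in> sp_outside A R"
proof -
  have "len z \<le> len g + len (g + z)" using len_add[of "- g" "g + z"] by simp
  then show ?thesis using assms by (auto simp: sp_outside_def intro: sp_add)
qed

lemma reach_ray_end:
  assumes "p \<in> A" "q \<in> A" "g \<in> sp A" "\<And>j. j \<le> M \<Longrightarrow> R \<le> len (g + word (alt p q j))"
  shows "reach (sp_outside A R) M g (g + word (alt p q M))"
  using reach_word[of "alt p q M" g "sp_outside A R"] assms
  by (simp add: sp_outside_def sp_add alt_sp)

text \<open>In a product of two infinite dihedral groups, two rays in different factors bound a quarter
  plane.\<close>

lemma join_corner:
  assumes pq: "p \<noteq> q" "\<not> adj p q" and pq': "p' \<noteq> q'" "\<not> adj p' q'"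
    and ad: "adj p p'" "adj p q'" "adj q p'" "adj q q'" and A: "{p, q, p', q'} \<subseteq> A"
  shows "reach (sp_outside A M) (2 * M) (word (alt p q M)) (word (alt p' q' M))"
proof -
  let ?v = "word (alt p q M)" and ?w = "word (alt p' q' M)"
  have ne: "p \<notin> {p', q'}" "q \<notin> {p', q'}" "p' \<notin> {p, q}" "q' \<notin> {p, q}"
    using ad by (auto dest: adj_sym)
  have "reach (sp_outside A M) M ?v (?v + ?w)"
    using A ne by (intro reach_ray_end alt_sp len_alt_add[OF pq alt_sp, of p' "{p', q'}"]) auto
  moreover have "reach (sp_outside A M) M ?w (?w + ?v)"
    using A ne by (intro reach_ray_end alt_sp len_alt_add[OF pq' alt_sp, of p "{p, q}"]) auto
  moreover have "?v + ?w = ?w + ?v"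
    by (rule sp_commute[of "{p, q}" "{p', q'}"]) (use ad in \<open>auto intro: alt_sp\<close>)
  ultimately show ?thesis
    using reach_trans[OF _ reach_sym, of "sp_outside A M" M ?v "?v + ?w" M ?w] by (simp add: mult_2)
qed

text \<open>Walk back along \<open>w\<close>, at distance \<open>M\<close> from it: each letter \<open>s\<close> of \<open>w\<close> commutes with a ray
  in \<open>lk s\<close>, and the rays of different letters are joined via the fixed ray of \<open>a\<close>, \<open>b\<close>.\<close>

lemma reach_descend:
  assumes "\<And>s. s \<in> set w \<Longrightarrow> s \<in> A \<and> (\<exists>p q. p \<in> lk s \<and> q \<in> lk s \<and>
       reach (sp_outside A M) \<kappa> (word (alt p q M)) (word (alt a b M)))"
    and "length w + R \<le> M" "a \<in> A" "b \<in> A" "a \<noteq> b" "\<not> adj a b"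
  shows "reach (sp_outside A R) (length w * (2 * \<kappa> + 1)) (word w + word (alt a b M)) (word (alt a b M))"
  using assms(1,2)
proof (induction w rule: rev_induct)
  case Nil
  have "word (alt a b M) \<in> sp_outside A R"
    using Nil assms(3-) len_alt_add[of a b 0 "{}" M] by (simp add: sp_outside_def alt_sp)
  then show ?case by (simp add: reach_refl)
next
  case (snoc s w)
  obtain p q where pq: "s \<in> A" "p \<in> lk s" "q \<in> lk s"
    "reach (sp_outside A M) \<kappa> (word (alt p q M)) (word (alt a b M))" using snoc.prems(1)[of s] by auto
  let ?r = "word (alt p q M)" and ?b = "word (alt a b M)"
  have wA: "word w \<in> sp A" "word (w @ [s]) \<in> sp A" using snoc.prems(1) by (auto intro!: sp_word)
  have tr: "word w + z \<in> sp_outside A R" "word (w @ [s]) + z \<in> sp_outside A R" if "z \<in> sp_outside A M" for z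
    using that wA snoc.prems(2) len_word_le[of w] len_word_le[of "w @ [s]"]
    by (auto intro!: sp_outside_translate[of _ A R M])
  have 1: "reach (sp_outside A R) \<kappa> (word (w @ [s]) + ?b) (word (w @ [s]) + ?r)"
    using reach_translate[OF reach_sym[OF pq(4)]] tr(2) by blast
  have comm: "gen s + ?r = ?r + gen s"
    using pq by (intro sp_commute[of "{s}" "lk s"] alt_sp sp_gen) (auto simp: lk_def)
  have 2: "reach (sp_outside A R) 1 (word (w @ [s]) + ?r) (word w + ?r)"
  proof -
    have "reach (sp_outside A R) (length [s]) (word w + ?r) (word w + ?r + word [s])"
    proof (rule reach_word)
      fix i assume i: "i \<le> length [s]"
      have "word w + ?r + gen s = word (w @ [s]) + ?r" using comm by (simp add: word_append add.assoc)
      moreover have "?r \<in> sp_outside A M" using reach_endpoints[OF pq(4)] by simp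
      ultimately show "word w + ?r + word (take i [s]) \<in> sp_outside A R"
        using i tr by (cases i) auto
    qed
    moreover have "word w + ?r + gen s = word (w @ [s]) + ?r" using comm by (simp add: word_append add.assoc)
    ultimately show ?thesis by (auto intro: reach_sym)
  qed
  have 3: "reach (sp_outside A R) \<kappa> (word w + ?r) (word w + ?b)"
    using reach_translate[OF pq(4)] tr(1) by blast
  have 4: "reach (sp_outside A R) (length w * (2 * \<kappa> + 1)) (word w + ?b) ?b"
    using snoc by simp
  show ?case using reach_trans[OF reach_trans[OF reach_trans[OF 1 2] 3] 4]
    by (rule reach_mono) (simp_all add: algebra_simps)
qed

text \<open>If both rays from \<open>x\<close> entered the ball of radius R, they would do so at
  points less than 2 R apart. But these points lie on one geodesic line on different sides of
  \<open>x\<close>, each more than R away from it.\<close>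

lemma ray_direction:
  assumes pq: "p \<noteq> q" "\<not> adj p q" and x: "2 * R \<le> len x"
  shows "(\<forall>j. R \<le> len (x + word (alt p q j))) \<or> (\<forall>j. R \<le> len (x + word (alt q p j)))"
proof (rule ccontr)
  assume "\<not> ?thesis"
  then obtain i j where ij: "len (x + word (alt p q i)) < R" "len (x + word (alt q p j)) < R"
    by (auto simp: not_le)
  \<comment> \<open>The word that leads from one entry point through \<open>x\<close> to the other;
    no two of its neighbouring letters commute.\<close>
  let ?us = "rev (alt p q i) @ alt q p j"
  have "?us ! k \<noteq> ?us ! Suc k \<and> \<not> adj (?us ! k) (?us ! Suc k)" if "Suc k < length ?us" for k
  proof -
    have nth: "?us ! l = (if l < i then alt p q i ! (i - Suc l) else alt q p j ! (l - i))" if "l < length ?us" for l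
      using that by (simp add: nth_append rev_nth)
    have "i - Suc k = Suc (i - Suc (Suc k))" if "Suc k < i" using that by simp
    moreover have "even i \<longleftrightarrow> odd k" if "k < i" "\<not> Suc k < i"
    proof -
      have "i = Suc k" using that by simp
      then show ?thesis by simp
    qed
    moreover have "Suc k - i = Suc (k - i)" if "\<not> k < i" using that by simp
    ultimately show ?thesis
      using that pq nth[of k] nth[of "Suc k"]
      by (auto simp: nth_alt dest: adj_sym split: if_splits)
  qed
  then have "length ?us \<le> len (word ?us + 0)" by (intro len_chain_add[of ?us 0 "{}"]) auto
  then have "i + j \<le> wd (x + word (alt p q i)) (x + word (alt q p j))"
    unfolding wd_translate by (simp add: wd_def word_append word_rev)
  also have "\<dots> \<le> len (x + word (alt p q i)) + len (x + word (alt q p j))"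
    using wd_triangle[of "x + word (alt p q i)" "x + word (alt q p j)" 0] by simp
  finally have "i + j < 2 * R" using ij by simp
  moreover have "len x \<le> len (x + word (alt p q n)) + n" "len x \<le> len (x + word (alt q p n)) + n" for n
    using len_add[of "x + word (alt p q n)" "- word (alt p q n)"] len_word_le[of "alt p q n"]
      len_add[of "x + word (alt q p n)" "- word (alt q p n)"] len_word_le[of "alt q p n"]
    by (auto simp: add.assoc)
  ultimately show False using ij x by (smt (verit) add_less_mono le_less_trans less_or_eq_imp_le linorder_not_less mult_2 nat_add_left_cancel_less add.commute add_le_cancel_left)
qed

section \<open>The upper bound in the subgroup without the letters \<open>c\<^sub>1, c\<^sub>2\<close>\<close>

definition Gam :: "nat \<Rightarrow> indexed_vertex set" where
  "Gam d = Ix d ` ({Va i |i. i \<le> d} \<union> {Vb i |i. i \<le> d})"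

abbreviation va :: "nat \<Rightarrow> nat \<Rightarrow> indexed_vertex" where "va d i \<equiv> Ix d (Va i)"
abbreviation vb :: "nat \<Rightarrow> nat \<Rightarrow> indexed_vertex" where "vb d i \<equiv> Ix d (Vb i)"

lemma va_Gam [simp]: "va d i \<in> Gam d \<longleftrightarrow> i \<le> d" and vb_Gam [simp]: "vb d i \<in> Gam d \<longleftrightarrow> i \<le> d"
  by (auto simp: Gam_def)

lemma GamE:
  assumes "s \<in> Gam d" obtains i where "s = va d i" "i \<le> d" | i where "s = vb d i" "i \<le> d"
  using assms by (auto simp: Gam_def)

lemma adj_join:
  assumes "1 \<le> i" "i \<le> d"
  shows "adj (va d 0) (va d i)" "adj (vb d 0) (va d i)" "adj (va d 0) (vb d 1)" "adj (vb d 0) (vb d 1)"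
    "adj (va d i) (va d 0)" "adj (va d i) (vb d 0)" "adj (vb d 1) (va d 0)" "adj (vb d 1) (vb d 0)"
  using assms by (auto simp: omega_edges_def doubleton_eq_iff)

lemma adj_b:
  assumes "2 \<le> k" "k \<le> d"
  shows "adj (vb d k) (va d (k - 1))" "adj (vb d k) (vb d (k - 1))"
  using assms by (auto simp: omega_edges_def doubleton_eq_iff)

lemma not_adj_pair: "\<not> adj (va d k) (vb d k)" "\<not> adj (vb d k) (va d k)"
  by (auto simp: omega_edges_def doubleton_eq_iff)

abbreviation rho :: "nat \<Rightarrow> nat \<Rightarrow> indexed_vertex rac" where
  "rho d M \<equiv> word (alt (va d 0) (vb d 0) M)"

text \<open>All rays are compared with one fixed ray \<open>rho\<close>, so that the costs of
  different letters can be combined in \<open>reach_descend\<close>.\<close>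

definition ray_cost :: "nat \<Rightarrow> nat \<Rightarrow> nat \<Rightarrow> indexed_vertex \<Rightarrow> indexed_vertex \<Rightarrow> bool" where
  "ray_cost d C e p q \<longleftrightarrow> (\<forall>M\<ge>1. reach (sp_outside (Gam d) M) (C * M ^ e) (word (alt p q M)) (rho d M))"

text \<open>Both orders of \<open>p\<close> and \<open>q\<close> are required because
  \<open>ray_direction\<close> decides which of the two rays can be followed.\<close>

definition letter_cost :: "nat \<Rightarrow> nat \<Rightarrow> nat \<Rightarrow> indexed_vertex \<Rightarrow> bool" where
  "letter_cost d C e s \<longleftrightarrow> (\<exists>p q. p \<in> Gam d \<inter> lk s \<and> q \<in> Gam d \<inter> lk s \<and> p \<noteq> q \<and> \<not> adj p q \<and>
     ray_cost d C e p q \<and> ray_cost d C e q p)"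

lemma letter_costI:
  assumes "p \<in> Gam d" "q \<in> Gam d" "adj s p" "adj s q" "p \<noteq> q" "\<not> adj p q" "ray_cost d C e p q" "ray_cost d C e q p"
  shows "letter_cost d C e s"
  unfolding letter_cost_def using assms by (intro exI[of _ p] exI[of _ q]) (auto simp: lk_def)

lemma ray_cost_mono:
  assumes "ray_cost d C e p q" "C \<le> C'" "e \<le> e'" shows "ray_cost d C' e' p q"
  unfolding ray_cost_def
proof (intro allI impI)
  fix M :: nat assume M: "1 \<le> M"
  then have "C * M ^ e \<le> C' * M ^ e'"
    using assms(2,3) power_increasing[OF assms(3), of M] by (intro mult_le_mono) auto
  then show "reach (sp_outside (Gam d) M) (C' * M ^ e') (word (alt p q M)) (rho d M)"
    using assms(1) M unfolding ray_cost_def by (meson reach_mono subset_refl)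
qed

lemma letter_cost_mono: "letter_cost d C e s \<Longrightarrow> C \<le> C' \<Longrightarrow> e \<le> e' \<Longrightarrow> letter_cost d C' e' s"
  unfolding letter_cost_def using ray_cost_mono by meson

text \<open>The pairs a_0, b_0 and a_1, b_1 generate a product of two infinite dihedral groups,
  where \<open>join_corner\<close> connects rays. The reversed ray of a_0, b_0 reaches
  \<open>rho\<close> through the ray of a_1, b_1, which doubles the cost.\<close>

lemma ray_cost_base:
  assumes d: "1 \<le> d"
  shows "ray_cost d 4 1 (va d 1) (vb d 1)" "ray_cost d 4 1 (vb d 1) (va d 1)"
    "ray_cost d 4 1 (va d 0) (vb d 0)" "ray_cost d 4 1 (vb d 0) (va d 0)"
proof -
  note a = adj_join[of 1 d] not_adj_pair
  have 1: "reach (sp_outside (Gam d) M) (2 * M) (word (alt (va d 1) (vb d 1) M)) (rho d M)" for M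
    using d a by (intro join_corner) (auto simp del: adj_Ix)
  have 2: "reach (sp_outside (Gam d) M) (2 * M) (word (alt (vb d 1) (va d 1) M)) (rho d M)" for M
    using d a by (intro join_corner) (auto simp del: adj_Ix)
  have 3: "reach (sp_outside (Gam d) M) (2 * M) (word (alt (vb d 0) (va d 0) M)) (word (alt (va d 1) (vb d 1) M))" for M
    using d a by (intro join_corner) (auto simp del: adj_Ix)
  show "ray_cost d 4 1 (va d 1) (vb d 1)" "ray_cost d 4 1 (vb d 1) (va d 1)"
    unfolding ray_cost_def using reach_mono[OF 1] reach_mono[OF 2] by simp_all
  have "reach (sp_outside (Gam d) M) (4 * M) (word (alt (vb d 0) (va d 0) M)) (rho d M)" for M
    using reach_trans[OF 3 1] by (rule reach_mono) auto
  then show "ray_cost d 4 1 (vb d 0) (va d 0)" by (simp add: ray_cost_def)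
  show "ray_cost d 4 1 (va d 0) (vb d 0)"
    using reach_endpoints[OF 1] by (auto simp: ray_cost_def intro: reach_refl)
qed

text \<open>Every letter except b_j with j > 2 is adjacent to both of a_0, b_0 or to both of a_1,
  b_1.\<close>

lemma letter_cost_base:
  assumes d: "1 \<le> d" and s: "s \<in> Gam d" "\<And>j. s = vb d j \<Longrightarrow> j \<le> 2"
  shows "letter_cost d 4 1 s"
  using s(1)
proof (cases rule: GamE)
  case (1 i)
  show ?thesis
  proof (cases "i = 0")
    case True
    then show ?thesis using 1 d ray_cost_base[OF d] adj_join[of 1 d] not_adj_pair
      by (intro letter_costI[of "va d 1" d "vb d 1"]) (simp_all del: adj_Ix)
  next
    case False
    then show ?thesis using 1 d ray_cost_base[OF d] adj_join[of i d] not_adj_pair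
      by (intro letter_costI[of "va d 0" d "vb d 0"]) (simp_all del: adj_Ix)
  qed
next
  case (2 i)
  then consider "i = 0" | "i = 1" | "i = 2" using s(2)[of i] by linarith
  then show ?thesis
  proof cases
    case 1
    then show ?thesis using 2 d ray_cost_base[OF d] adj_join[of 1 d] not_adj_pair
      by (intro letter_costI[of "va d 1" d "vb d 1"]) (simp_all del: adj_Ix)
  next
    case i: 2
    then show ?thesis using 2 d ray_cost_base[OF d] adj_join[of 1 d] not_adj_pair
      by (intro letter_costI[of "va d 0" d "vb d 0"]) (simp_all del: adj_Ix)
  next
    case 3
    then show ?thesis using 2 d ray_cost_base[OF d] adj_b[of 2 d] not_adj_pair
      by (intro letter_costI[of "va d 1" d "vb d 1"]) (simp_all del: adj_Ix)
  qed
qed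

lemma letter_cost_descend:
  assumes d: "1 \<le> d" and w: "\<And>s. s \<in> set w \<Longrightarrow> s \<in> Gam d \<and> letter_cost d C e s"
    and M: "1 \<le> M" "length w + R \<le> M"
  shows "reach (sp_outside (Gam d) R) (length w * (2 * (C * M ^ e) + 1)) (word w + rho d M) (rho d M)"
proof (rule reach_descend)
  show "s \<in> Gam d \<and> (\<exists>p q. p \<in> lk s \<and> q \<in> lk s \<and> reach (sp_outside (Gam d) M) (C * M ^ e) (word (alt p q M)) (rho d M))"
    if "s \<in> set w" for s
    using w[OF that] M(1) unfolding letter_cost_def ray_cost_def by blast
qed (use M not_adj_pair in simp_all)

text \<open>From the tip of the ray, turn into a ray that commutes with the last letter, change to
  the translate of \<open>rho\<close>, and let \<open>letter_cost_descend\<close> remove the M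
  letters one by one. Each letter costs C * (2 * M) ^ e twice, hence the exponent e + 1.\<close>

lemma ray_cost_step:
  assumes d: "1 \<le> d" and e: "1 \<le> e" and pq: "p \<in> Gam d" "q \<in> Gam d" "p \<noteq> q" "\<not> adj p q"
    and cost: "letter_cost d C e p" "letter_cost d C e q"
  shows "ray_cost d (4 + 3 * (C * 2 ^ e)) (Suc e) p q"
  unfolding ray_cost_def
proof (intro allI impI)
  fix M :: nat assume M: "1 \<le> M"
  \<comment> \<open>Detours are made at radius 2 * M, of which at most M is lost by translation with
    a prefix of the ray.\<close>
  let ?v = "word (alt p q M)" and ?\<kappa> = "C * (2 * M) ^ e"
  define s where "s = last (alt p q M)"
  have s: "s \<in> {p, q}" unfolding s_def using set_alt[of p q M] M last_in_set[of "alt p q M"]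
    by (metis length_0_conv length_alt not_one_le_zero subsetD)
  obtain p' q' where pq': "p' \<in> Gam d \<inter> lk s" "q' \<in> Gam d \<inter> lk s" "ray_cost d C e p' q'"
    using s cost unfolding letter_cost_def by auto
  have vA: "?v \<in> sp (Gam d)" using pq by (intro alt_sp)
  have 1: "reach (sp_outside (Gam d) M) (2 * M) ?v (?v + word (alt p' q' (2 * M)))"
  proof (rule reach_ray_end[OF _ _ vA])
    \<comment> \<open>\<open>s\<close> is not in its own link, so the new ray leaves all M walls of
      \<open>?v\<close> behind.\<close>
    show "M \<le> len (?v + word (alt p' q' j))" for j
      using len_chain_add[of "alt p q M" "word (alt p' q' j)" "lk s", OF alt_chain[OF pq(3,4)]] pq'
      by (simp add: s_def alt_sp)
  qed (use pq' in auto)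
  have 2: "reach (sp_outside (Gam d) M) ?\<kappa> (?v + word (alt p' q' (2 * M))) (?v + rho d (2 * M))"
  proof (rule reach_translate)
    show "reach (sp_outside (Gam d) (2 * M)) ?\<kappa> (word (alt p' q' (2 * M))) (rho d (2 * M))"
      using pq'(3)[unfolded ray_cost_def, rule_format, of "2 * M"] M by linarith
    show "?v + z \<in> sp_outside (Gam d) M" if "z \<in> sp_outside (Gam d) (2 * M)" for z
      using that len_word_le[of "alt p q M"] by (intro sp_outside_translate[OF vA]) auto
  qed
  have 3: "reach (sp_outside (Gam d) M) (length (alt p q M) * (2 * ?\<kappa> + 1)) (?v + rho d (2 * M)) (rho d (2 * M))"
    using set_alt[of p q M] pq cost M by (intro letter_cost_descend[OF d]) auto
  have 4: "reach (sp_outside (Gam d) M) M (rho d M) (rho d (2 * M))"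
  proof -
    have "reach (sp_outside (Gam d) M) (length (drop M (alt (va d 0) (vb d 0) (2 * M)))) (rho d M)
        (rho d M + word (drop M (alt (va d 0) (vb d 0) (2 * M))))"
    proof (rule reach_word)
      fix i assume i: "i \<le> length (drop M (alt (va d 0) (vb d 0) (2 * M)))"
      have "take M (alt (va d 0) (vb d 0) (2 * M)) @ take i (drop M (alt (va d 0) (vb d 0) (2 * M)))
        = take (M + i) (alt (va d 0) (vb d 0) (2 * M))" by (simp only: take_add)
      then have "alt (va d 0) (vb d 0) M @ take i (drop M (alt (va d 0) (vb d 0) (2 * M))) = alt (va d 0) (vb d 0) (M + i)"
        using i by simp
      then have "rho d M + word (take i (drop M (alt (va d 0) (vb d 0) (2 * M)))) = rho d (M + i)"
        by (metis word_append)
      then show "rho d M + word (take i (drop M (alt (va d 0) (vb d 0) (2 * M)))) \<in> sp_outside (Gam d) M"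
        using len_alt_add[of "va d 0" "vb d 0" 0 "{}" "M + i"] not_adj_pair by (simp add: sp_outside_def alt_sp)
    qed
    moreover have "rho d M + word (drop M (alt (va d 0) (vb d 0) (2 * M))) = rho d (2 * M)"
      using append_take_drop_id[of M "alt (va d 0) (vb d 0) (2 * M)"] by (simp flip: word_append)
    ultimately show ?thesis by simp
  qed
  have "2 * M + ?\<kappa> + M * (2 * ?\<kappa> + 1) + M \<le> (4 + 3 * (C * 2 ^ e)) * M ^ Suc e"
  proof -
    have "?\<kappa> \<le> C * 2 ^ e * M ^ Suc e" using M by (simp add: power_mult_distrib)
    moreover have "M * (2 * ?\<kappa>) = 2 * (C * 2 ^ e * M ^ Suc e)" by (simp add: power_mult_distrib)
    moreover have "M \<le> M ^ Suc e" using M self_le_power[of M "Suc e"] by simp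
    moreover have "M * (2 * ?\<kappa> + 1) = M * (2 * ?\<kappa>) + M" unfolding add_mult_distrib2 by simp
    moreover have "(4 + 3 * (C * 2 ^ e)) * M ^ Suc e = 4 * M ^ Suc e + 3 * (C * 2 ^ e * M ^ Suc e)"
      by (simp only: add_mult_distrib mult.assoc)
    ultimately show ?thesis by linarith
  qed
  with reach_trans[OF reach_trans[OF reach_trans[OF 1 2] 3] reach_sym[OF 4]]
  show "reach (sp_outside (Gam d) M) ((4 + 3 * (C * 2 ^ e)) * M ^ Suc e) ?v (rho d M)"
    by (rule_tac reach_mono) auto
qed

text \<open>The letter b_(k+1) commutes with a_k and b_k, whose rays cost one power more than the
  letters themselves by \<open>ray_cost_step\<close>; so each index adds one degree.\<close>

lemma letter_cost_level:
  assumes "2 \<le> k" "k \<le> d"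
  shows "\<exists>C. \<forall>s\<in>Gam d. (\<forall>j. s = vb d j \<longrightarrow> j \<le> k) \<longrightarrow> letter_cost d C (k - 1) s"
  using assms
proof (induction k rule: dec_induct)
  case base
  then show ?case using letter_cost_base[of d] by (intro exI[of _ 4]) auto
next
  case (step k)
  then obtain C where C: "\<And>s. s \<in> Gam d \<Longrightarrow> (\<And>j. s = vb d j \<Longrightarrow> j \<le> k) \<Longrightarrow> letter_cost d C (k - 1) s" by auto
  define C' where "C' = 4 + 3 * (C * 2 ^ (k - 1))"
  have d: "1 \<le> d" using step by simp
  have k: "letter_cost d C (k - 1) (va d k)" "letter_cost d C (k - 1) (vb d k)"
    using step.hyps step.prems by (intro C; simp)+
  have "letter_cost d C' k s" if s: "s \<in> Gam d" "\<And>j. s = vb d j \<Longrightarrow> j \<le> Suc k" for s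
  proof (cases "s = vb d (Suc k)")
    case True
    have "Suc (k - 1) = k" using step by simp
    moreover have "adj s (va d k)" "adj s (vb d k)" using adj_b[of "Suc k" d] step True by auto
    ultimately show ?thesis
      using ray_cost_step[OF d _ _ _ _ _ k] ray_cost_step[OF d _ _ _ _ _ k(2,1)] step not_adj_pair
      unfolding C'_def by (intro letter_costI[of "va d k" d "vb d k"]) (auto simp del: adj_Ix)
  next
    case False
    then have "letter_cost d C (k - 1) s" using s by (intro C) (auto simp: le_Suc_eq)
    then show ?thesis
    proof (rule letter_cost_mono)
      have "C \<le> C * 2 ^ (k - 1)" by simp
      then show "C \<le> C'" unfolding C'_def by linarith
    qed simp
  qed
  then show ?case by auto
qed

text \<open>After an escape from \<open>x\<close> along a ray that avoids the ball, the word of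
  \<open>x\<close> is removed letter by letter as in \<open>ray_cost_step\<close>.\<close>

lemma reach_ray_from:
  assumes d: "2 \<le> d" and cost: "\<And>s. s \<in> Gam d \<Longrightarrow> letter_cost d C (d - 1) s"
    and x: "x \<in> sp (Gam d)" "2 * R \<le> len x" "len x \<le> n" and n: "1 \<le> n"
  shows "reach (sp_outside (Gam d) R) (3 * n + 3 * (C * 2 ^ d) * n ^ d) x (rho d (2 * n))"
proof (cases "x = 0")
  case True
  then have "R = 0" using x by simp
  then have "reach (sp_outside (Gam d) R) (2 * n) x (x + rho d (2 * n))" using x by (intro reach_ray_end) auto
  then have "reach (sp_outside (Gam d) R) (2 * n) x (rho d (2 * n))" using True by simp
  then show ?thesis by (rule reach_mono) auto
next
  case False
  obtain w where w: "x = word w" "set w \<subseteq> Gam d" "length w = len x" by (rule sp_geodesic_word[OF x(1)])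
  then have "w \<noteq> []" using False by auto
  \<comment> \<open>Any letter of \<open>Gam d\<close> would serve: it only supplies a pair of
    letters with cheap rays in both directions.\<close>
  then have "last w \<in> Gam d" using w(2) by auto
  then obtain p q where pq: "p \<in> Gam d" "q \<in> Gam d" "p \<noteq> q" "\<not> adj p q"
    "ray_cost d C (d - 1) p q" "ray_cost d C (d - 1) q p" using cost unfolding letter_cost_def by blast
  obtain p' q' where pq': "p' \<in> Gam d" "q' \<in> Gam d" "ray_cost d C (d - 1) p' q'"
    "\<And>j. R \<le> len (x + word (alt p' q' j))"
    using ray_direction[OF pq(3,4) x(2)] pq that by blast
  let ?M = "2 * n" and ?\<kappa> = "C * (2 * n) ^ (d - 1)"
  have R: "R \<le> n" "len x + R \<le> ?M" using x by auto
  have 1: "reach (sp_outside (Gam d) R) ?M x (x + word (alt p' q' ?M))"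
    using pq' x by (intro reach_ray_end) auto
  have 2: "reach (sp_outside (Gam d) R) ?\<kappa> (x + word (alt p' q' ?M)) (x + rho d ?M)"
  proof (rule reach_translate)
    show "reach (sp_outside (Gam d) ?M) ?\<kappa> (word (alt p' q' ?M)) (rho d ?M)"
      using pq'(3)[unfolded ray_cost_def, rule_format, of "2 * n"] n by linarith
    show "x + z \<in> sp_outside (Gam d) R" if "z \<in> sp_outside (Gam d) ?M" for z
      using that R by (intro sp_outside_translate[OF x(1)]) auto
  qed
  have 3: "reach (sp_outside (Gam d) R) (length w * (2 * ?\<kappa> + 1)) (x + rho d ?M) (rho d ?M)"
    unfolding w(1) using w cost d n R by (intro letter_cost_descend) auto
  have "?M + ?\<kappa> + length w * (2 * ?\<kappa> + 1) \<le> 3 * n + 3 * (C * 2 ^ d) * n ^ d"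
  proof -
    have nd: "n ^ d = n * n ^ (d - 1)" "2 ^ d = 2 * (2 ^ (d - 1) :: nat)" using d power_eq_if[of n d] power_eq_if[of "2::nat" d] by auto
    have \<kappa>: "n * ?\<kappa> \<le> C * 2 ^ d * n ^ d" unfolding nd by (simp add: power_mult_distrib)
    have "?\<kappa> \<le> n * ?\<kappa>" using n by simp
    have "length w * (2 * ?\<kappa> + 1) \<le> n * (2 * ?\<kappa> + 1)" using w x by (intro mult_le_mono) auto
    also have "\<dots> = 2 * (n * ?\<kappa>) + n" by (simp add: algebra_simps)
    finally show ?thesis using \<kappa> \<open>?\<kappa> \<le> n * ?\<kappa>\<close> by linarith
  qed
  with reach_trans[OF reach_trans[OF 1 2] 3] show ?thesis by (rule_tac reach_mono) auto
qed

text \<open>For d = 1 the descent letter by letter would give a quadratic bound, since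
  \<open>letter_cost_base\<close> has exponent 1 and not 0. In the product of two infinite dihedral
  groups there is a linear detour.\<close>

lemma reach_product:
  assumes u: "u \<in> sp {va 1 0, vb 1 0}" and v: "v \<in> sp {va 1 1, vb 1 1}"
    and len: "2 * R \<le> len (u + v)" "len u \<le> n" "len v \<le> n" "R \<le> n"
  shows "reach (sp_outside (Gam 1) R) (5 * n) (u + v) (rho 1 n)"
proof -
  let ?A = "{va 1 0, vb 1 0}" and ?B = "{va 1 1, vb 1 1}" and ?G = "Gam 1"
  note a = adj_join[of 1 1] not_adj_pair
  have comm: "u' + v' = v' + u'" if "u' \<in> sp ?A" "v' \<in> sp ?B" for u' v'
    using that a by (intro sp_commute[of ?A ?B]) (auto simp del: adj_Ix)
  have AB: "?A \<subseteq> ?G" "?B \<subseteq> ?G" by (auto simp: Gam_def)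
  have len_ge: "len g \<le> len (g + h)" if gh: "g \<in> sp {p, q}" "h \<in> sp D" and D: "p \<notin> D" "q \<notin> D" "\<not> adj p q" for p q g h D
  proof -
    obtain w where w: "g = word w" "set w \<subseteq> {p, q}" "length w = len g" by (rule sp_geodesic_word[OF gh(1)])
    then have red: "reduced_word w" by (simp add: reduced_word_def)
    have "length w \<le> len (word w + h)"
    proof (rule len_chain_add[OF _ gh(2)])
      show "w ! i \<noteq> w ! Suc i \<and> \<not> adj (w ! i) (w ! Suc i)" if "Suc i < length w" for i
      proof -
        have "w ! i \<in> {p, q}" "w ! Suc i \<in> {p, q}" using that w(2) nth_mem by (metis Suc_lessD subsetD)+
        then show ?thesis using reduced_word_nth_neq[OF red that] D(3) by (auto dest: adj_sym)
      qed
      show "w = [] \<or> last w \<notin> D" using w(2) D by (cases w rule: rev_cases) auto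
    qed
    then show ?thesis using w by simp
  qed
  have move: "reach (sp_outside ?G S) n g (g + h)"
    if gh: "g \<in> sp {p, q}" "h \<in> sp {p', q'}" and D: "p \<notin> {p', q'}" "q \<notin> {p', q'}" "\<not> adj p q"
      and sub: "{p, q} \<subseteq> ?G" "{p', q'} \<subseteq> ?G" and S: "S \<le> len g" "len h \<le> n" for p q p' q' g h S
  proof -
    obtain w where w: "h = word w" "set w \<subseteq> {p', q'}" "length w = len h" by (rule sp_geodesic_word[OF gh(2)])
    have "reach (sp_outside ?G S) (length w) g (g + word w)"
    proof (rule reach_word)
      fix i
      have "word (take i w) \<in> sp {p', q'}" using w(2) by (intro sp_word) (meson in_set_takeD subset_iff)
      then show "g + word (take i w) \<in> sp_outside ?G S"
        using len_ge[OF gh(1) _ D, of "word (take i w)"] S gh sp_mono[OF sub(1)] sp_mono[OF sub(2)]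
        by (auto simp: sp_outside_def intro: sp_add)
    qed
    then show ?thesis using w S by (auto intro: reach_mono)
  qed
  have ne: "va 1 0 \<notin> ?B" "vb 1 0 \<notin> ?B" "va 1 1 \<notin> ?A" "vb 1 1 \<notin> ?A" by auto
  have corner: "reach (sp_outside ?G n) (2 * n) (word (alt (va 1 1) (vb 1 1) n)) (rho 1 n)"
    using a by (intro join_corner) (auto simp del: adj_Ix)
  have Rn: "reach (sp_outside ?G R) m y z" if "reach (sp_outside ?G n) m y z" for m y z
    using reach_mono[OF that order.refl sp_outside_mono[OF len(4)]] .
  have ray: "word (alt (va 1 1) (vb 1 1) n) \<in> sp ?B" "rho 1 n \<in> sp ?A" by (auto intro: alt_sp)
  have lray: "len (word (alt (va 1 1) (vb 1 1) n)) = n" "len (rho 1 n) = n"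
    using chain_word_reduced[OF alt_chain, of "va 1 1" "vb 1 1" n] chain_word_reduced[OF alt_chain, of "va 1 0" "vb 1 0" n] not_adj_pair
    by (auto simp: reduced_word_def simp del: adj_Ix)
  \<comment> \<open>One factor alone keeps the path outside the ball while the other one is changed
    freely.\<close>
  have "R \<le> len u \<or> R \<le> len v" using len(1) len_add[of u v] by linarith
  then show ?thesis
  proof
    assume Ru: "R \<le> len u"
    let ?r = "word (alt (va 1 1) (vb 1 1) n)"
    have 1: "reach (sp_outside ?G R) n u (u + v)"
      using move[OF u v ne(1,2) not_adj_pair(1) AB Ru len(3)] .
    have 2: "reach (sp_outside ?G R) n u (u + ?r)"
      using move[OF u ray(1) ne(1,2) not_adj_pair(1) AB Ru] lray by simp
    have 3: "reach (sp_outside ?G R) n ?r (?r + u)"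
      using move[OF ray(1) u ne(3,4) not_adj_pair(1) AB(2,1), of R] lray len by simp
    have "u + ?r = ?r + u" using comm[OF u ray(1)] .
    then show ?thesis
      using reach_trans[OF reach_trans[OF reach_trans[OF reach_sym[OF 1] 2[unfolded \<open>u + ?r = ?r + u\<close>]] reach_sym[OF 3]] Rn[OF corner]]
      by (auto intro: reach_mono)
  next
    assume Rv: "R \<le> len v"
    have 1: "reach (sp_outside ?G R) n v (v + u)"
      using move[OF v u ne(3,4) not_adj_pair(1) AB(2,1) Rv len(2)] .
    have 2: "reach (sp_outside ?G R) n v (v + rho 1 n)"
      using move[OF v ray(2) ne(3,4) not_adj_pair(1) AB(2,1) Rv] lray by simp
    have 3: "reach (sp_outside ?G R) n (rho 1 n) (rho 1 n + v)"
      using move[OF ray(2) v ne(1,2) not_adj_pair(1) AB, of R] lray len by simp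
    have "v + rho 1 n = rho 1 n + v" "v + u = u + v" using comm[OF ray(2) v] comm[OF u v] by simp_all
    then have "reach (sp_outside ?G R) (n + n + n) (u + v) (rho 1 n)"
      using reach_trans[OF reach_trans[OF reach_sym[OF 1] 2] ] reach_sym[OF 3] by simp
    then show ?thesis by (rule reach_mono) auto
  qed
qed

lemma sp_product:
  assumes "x \<in> sp (A \<union> B)" "\<And>s t. s \<in> A \<Longrightarrow> t \<in> B \<Longrightarrow> adj s t"
  obtains u v where "x = u + v" "u \<in> sp A" "v \<in> sp B"
proof -
  have "\<exists>u v. x = u + v \<and> u \<in> sp A \<and> v \<in> sp B" using assms(1)
  proof (induction rule: sp_induct)
    case zero
    then show ?case by (intro exI[of _ 0]) simp
  next
    case (gen x t)
    then obtain u v where uv: "x = u + v" "u \<in> sp A" "v \<in> sp B" by blast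
    show ?case
    proof (cases "t \<in> B")
      case True
      then show ?thesis using uv sp_add[OF uv(3) sp_gen] by (intro exI[of _ u] exI[of _ "v + gen t"]) (simp add: add.assoc)
    next
      case False
      then have t: "t \<in> A" using gen by simp
      then have "gen t + v = v + gen t" using uv assms(2) by (intro sp_commute[of A B]) (auto intro: sp_gen)
      then show ?thesis using uv sp_add[OF uv(2) sp_gen[OF t]]
        by (intro exI[of _ "u + gen t"] exI[of _ v]) (simp add: add.assoc)
    qed
  qed
  with that show thesis by blast
qed

text \<open>The ends lie at radius 2 * R because a factor 2 is lost: in \<open>ray_direction\<close>
  for d \<ge> 2, and in the choice of the longer factor for d = 1.\<close>

theorem Gam_divergence:
  assumes "1 \<le> d"
  shows "\<exists>C. \<forall>n R x y. x \<in> sp (Gam d) \<longrightarrow> y \<in> sp (Gam d) \<longrightarrow> 2 * R \<le> len x \<longrightarrow> 2 * R \<le> len y \<longrightarrow>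
     len x \<le> n \<longrightarrow> len y \<le> n \<longrightarrow> 1 \<le> n \<longrightarrow> reach (sp_outside (Gam d) R) (C * n ^ d) x y"
proof (cases "d = 1")
  case True
  have ray: "reach (sp_outside (Gam 1) R) (10 * n) x (rho 1 (2 * n))"
    if x: "x \<in> sp (Gam 1)" "2 * R \<le> len x" "len x \<le> n" for x R n
  proof -
    have "Gam 1 = {va 1 0, vb 1 0} \<union> {va 1 1, vb 1 1}"
      by (auto simp: Gam_def le_Suc_eq)
    then have "x \<in> sp ({va 1 0, vb 1 0} \<union> {va 1 1, vb 1 1})" using x by simp
    then obtain u v where uv: "x = u + v" "u \<in> sp {va 1 0, vb 1 0}" "v \<in> sp {va 1 1, vb 1 1}"
      by (rule sp_product) (use adj_join[of 1 1] in \<open>auto simp del: adj_Ix\<close>)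
    text \<open>Each factor is a retract, so it does not increase the length.\<close>
    obtain w where w: "x = word w" "length w = len x" by (rule len_word)
    obtain wu wv where wuv: "u = word wu" "set wu \<subseteq> {va 1 0, vb 1 0}" "v = word wv" "set wv \<subseteq> {va 1 1, vb 1 1}"
      using uv by (auto elim!: spE)
    have "rac_eq w (wu @ wv)" using w uv wuv by (simp add: word_append flip: word_eq_iff)
    then have "word (filter P w) = word (filter P (wu @ wv))" for P unfolding word_eq_iff by (rule rac_eq_filter)
    moreover have "filter (\<lambda>s. s \<in> {va 1 0, vb 1 0}) (wu @ wv) = wu"
      "filter (\<lambda>s. s \<in> {va 1 1, vb 1 1}) (wu @ wv) = wv"
      using wuv by (auto simp: filter_empty_conv filter_id_conv subset_iff)
    ultimately have "word (filter (\<lambda>s. s \<in> {va 1 0, vb 1 0}) w) = u"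
      "word (filter (\<lambda>s. s \<in> {va 1 1, vb 1 1}) w) = v"
      using wuv by simp_all
    then have "len u \<le> len x" "len v \<le> len x"
      using len_word_le length_filter_le w(2) by (metis order_trans)+
    then show ?thesis
      using reach_product[OF uv(2,3), of R "2 * n"] x uv by auto
  qed
  have "reach (sp_outside (Gam 1) R) (20 * n ^ 1) x y"
    if "x \<in> sp (Gam 1)" "y \<in> sp (Gam 1)" "2 * R \<le> len x" "2 * R \<le> len y" "len x \<le> n" "len y \<le> n" for n R x y
    using reach_trans[OF ray[OF that(1,3,5)] reach_sym[OF ray[OF that(2,4,6)]]] by (auto intro: reach_mono)
  then show ?thesis using True by blast
next
  case False
  then have d: "2 \<le> d" using assms by simp
  obtain C where "\<forall>s\<in>Gam d. (\<forall>j. s = vb d j \<longrightarrow> j \<le> d) \<longrightarrow> letter_cost d C (d - 1) s"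
    using letter_cost_level[OF d order.refl] by blast
  then have C: "\<And>s. s \<in> Gam d \<Longrightarrow> letter_cost d C (d - 1) s" by auto
  define C' where "C' = 2 * (3 + 3 * (C * 2 ^ d))"
  have "reach (sp_outside (Gam d) R) (C' * n ^ d) x y"
    if xy: "x \<in> sp (Gam d)" "y \<in> sp (Gam d)" "2 * R \<le> len x" "2 * R \<le> len y" "len x \<le> n" "len y \<le> n" "1 \<le> n" for n R x y
  proof -
    have "n \<le> n ^ d" using xy d self_le_power[of n d] by simp
    then have "(3 * n + 3 * (C * 2 ^ d) * n ^ d) + (3 * n + 3 * (C * 2 ^ d) * n ^ d) \<le> C' * n ^ d"
      unfolding C'_def by (simp add: algebra_simps)
    with reach_trans[OF reach_ray_from[OF d C xy(1,3,5,7)] reach_sym[OF reach_ray_from[OF d C xy(2,4,6,7)]]]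
    show ?thesis by (rule_tac reach_mono) auto
  qed
  then show ?thesis by blast
qed

section \<open>Lengths of paths in metric spaces\<close>

fun chain_len :: "('a \<Rightarrow> 'a \<Rightarrow> real) \<Rightarrow> 'a list \<Rightarrow> real" where
  "chain_len d (x # y # zs) = d x y + chain_len d (y # zs)"
| "chain_len d _ = 0"

lemma sum_chain_len:
  assumes "\<And>x y. 0 \<le> d x y"
  shows "(\<Sum>i<length zs - 1. ennreal (d (zs ! i) (zs ! Suc i))) = ennreal (chain_len d zs)"
proof -
  have nonneg: "0 \<le> chain_len d zs" for zs using assms by (induction zs rule: induct_list012) auto
  show ?thesis
  proof (induction zs rule: induct_list012)
    case (3 x y zs)
    have "(\<Sum>i<length (x # y # zs) - 1. ennreal (d ((x # y # zs) ! i) ((x # y # zs) ! Suc i)))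
      = ennreal (d x y) + (\<Sum>i<length (y # zs) - 1. ennreal (d ((y # zs) ! i) ((y # zs) ! Suc i)))"
      using sum.lessThan_Suc_shift[of "\<lambda>i. ennreal (d ((x # y # zs) ! i) ((x # y # zs) ! Suc i))" "length zs"] by simp
    also have "\<dots> = ennreal (d x y) + ennreal (chain_len d (y # zs))" using 3 by simp
    finally show ?case using assms nonneg by (simp add: ennreal_plus)
  qed auto
qed

context Metric_space
begin

text \<open>A 1-Lipschitz map on [0, l] takes the place of a path with its length: it is easy to
  concatenate, and rescaling turns it into a path on the unit interval
  (\<open>joined_divergence\<close>).\<close>

definition joined :: "'a set \<Rightarrow> real \<Rightarrow> 'a \<Rightarrow> 'a \<Rightarrow> bool" where
  "joined B l x y \<longleftrightarrow> 0 \<le> l \<and> (\<exists>c. c 0 = x \<and> c l = y \<and> (\<forall>s\<in>{0..l}. c s \<in> B \<inter> M) \<and>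
     (\<forall>s\<in>{0..l}. \<forall>t\<in>{0..l}. d (c s) (c t) \<le> \<bar>s - t\<bar>))"

lemma joined_endpoints: "joined B l x y \<Longrightarrow> x \<in> B \<inter> M \<and> y \<in> B \<inter> M"
  unfolding joined_def by force

lemma joined_refl: "0 \<le> l \<Longrightarrow> x \<in> B \<Longrightarrow> x \<in> M \<Longrightarrow> joined B l x x"
  unfolding joined_def by (auto intro!: exI[of _ "\<lambda>_. x"])

lemma joined_sym: assumes "joined B l x y" shows "joined B l y x"
proof -
  obtain c where c: "c 0 = x" "c l = y" "\<And>s. s \<in> {0..l} \<Longrightarrow> c s \<in> B \<inter> M"
    "\<And>s t. s \<in> {0..l} \<Longrightarrow> t \<in> {0..l} \<Longrightarrow> d (c s) (c t) \<le> \<bar>s - t\<bar>" and l: "0 \<le> l"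
    using assms unfolding joined_def by blast
  have "d (c (l - s)) (c (l - t)) \<le> \<bar>s - t\<bar>" if "s \<in> {0..l}" "t \<in> {0..l}" for s t
    using c(4)[of "l - s" "l - t"] that by auto
  then show ?thesis unfolding joined_def using c l
    by (intro conjI exI[of _ "\<lambda>s. c (l - s)"]) auto
qed

lemma joined_trans: assumes "joined B k x y" "joined B l y z" shows "joined B (k + l) x z"
proof -
  obtain b where b: "b 0 = x" "b k = y" "\<And>s. s \<in> {0..k} \<Longrightarrow> b s \<in> B \<inter> M"
    "\<And>s t. s \<in> {0..k} \<Longrightarrow> t \<in> {0..k} \<Longrightarrow> d (b s) (b t) \<le> \<bar>s - t\<bar>" and k: "0 \<le> k"
    using assms(1) unfolding joined_def by blast
  obtain c where c: "c 0 = y" "c l = z" "\<And>s. s \<in> {0..l} \<Longrightarrow> c s \<in> B \<inter> M"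
    "\<And>s t. s \<in> {0..l} \<Longrightarrow> t \<in> {0..l} \<Longrightarrow> d (c s) (c t) \<le> \<bar>s - t\<bar>" and l: "0 \<le> l"
    using assms(2) unfolding joined_def by blast
  let ?h = "\<lambda>s. if s \<le> k then b s else c (s - k)"
  have h_le: "d (?h s) (?h t) \<le> t - s" if st: "0 \<le> s" "s \<le> t" "t \<le> k + l" for s t
  proof -
    consider "t \<le> k" | "s > k" | "s \<le> k" "k < t" by linarith
    then show ?thesis
    proof cases
      case 1
      then show ?thesis using b(4)[of s t] st by auto
    next
      case 2
      then show ?thesis using c(4)[of "s - k" "t - k"] st by auto
    next
      case 3
      have "d (b s) (b k) \<le> k - s" "d (c 0) (c (t - k)) \<le> t - k"
        using b(4)[of s k] c(4)[of 0 "t - k"] st 3 k l by auto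
      moreover have "b s \<in> M" "b k \<in> M" "c (t - k) \<in> M" using b(3) c(3) 3 st k by auto
      then have "d (b s) (c (t - k)) \<le> d (b s) (b k) + d (b k) (c (t - k))" by (rule triangle)
      ultimately show ?thesis using 3 b(2) c(1) by simp
    qed
  qed
  have "d (?h s) (?h t) \<le> \<bar>s - t\<bar>" if "s \<in> {0..k+l}" "t \<in> {0..k+l}" for s t
  proof (cases "s \<le> t")
    case True
    then show ?thesis using h_le[of s t] that by simp
  next
    case False
    then show ?thesis using h_le[of t s] that by (subst commute) simp
  qed
  moreover have "?h s \<in> B \<inter> M" if "s \<in> {0..k+l}" for s using b(3)[of s] c(3)[of "s - k"] that by auto
  moreover have "?h 0 = x" "?h (k + l) = z" using b c k l by auto
  ultimately show ?thesis unfolding joined_def using add_nonneg_nonneg[OF k l] by (intro conjI exI[of _ ?h]) blast+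
qed

lemma joined_mono: assumes "joined B k x y" "k \<le> l" "B \<inter> M \<subseteq> B'" shows "joined B' l x y"
proof -
  have "joined B (k + (l - k)) x y"
    using assms(1,2) joined_endpoints[OF assms(1)] by (intro joined_trans[of B k x y] joined_refl) auto
  then show ?thesis using assms(3) unfolding joined_def by fastforce
qed

lemma joined_divergence:
  assumes "joined (- mball (\<alpha> t) r) l (\<alpha> (t - r)) (\<alpha> (t + r))"
  shows "divergence_at \<alpha> r t \<le> ennreal l"
proof -
  obtain c where c: "c 0 = \<alpha> (t - r)" "c l = \<alpha> (t + r)" "\<And>s. s \<in> {0..l} \<Longrightarrow> c s \<in> M - mball (\<alpha> t) r"
    "\<And>s t. s \<in> {0..l} \<Longrightarrow> t \<in> {0..l} \<Longrightarrow> d (c s) (c t) \<le> \<bar>s - t\<bar>" and l: "0 \<le> l"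
    using assms unfolding joined_def by blast
  define p where "p \<tau> = c (l * \<tau>)" for \<tau> :: real
  have l01: "l * \<tau> \<in> {0..l}" if "\<tau> \<in> {0..1}" for \<tau> using that l by (auto simp: mult_left_le)
  have lip: "d (p s) (p t) \<le> l * \<bar>s - t\<bar>" if "s \<in> {0..1}" "t \<in> {0..1}" for s t
    using c(4)[OF l01[OF that(1)] l01[OF that(2)]] l by (simp add: p_def abs_mult flip: right_diff_distrib)
  have pM: "p s \<in> M" if "s \<in> {0..1}" for s using c(3)[OF l01[OF that]] by (simp add: p_def)
  have "pathin mtopology p"
    unfolding pathin_def continuous_map_to_metric
  proof (intro ballI allI impI)
    fix x \<epsilon> :: real assume x: "x \<in> topspace (top_of_set {0..1})" and \<epsilon>: "0 < \<epsilon>"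
    define U where "U = {0..1} \<inter> ball x (\<epsilon> / (l + 1))"
    have "openin (top_of_set {0..1}) U" unfolding U_def by (intro openin_open_Int) simp
    moreover have "x \<in> U" using x l \<epsilon> by (auto simp: U_def)
    moreover have "p y \<in> mball (p x) \<epsilon>" if y: "y \<in> U" for y
    proof -
      have "\<bar>x - y\<bar> < \<epsilon> / (l + 1)" using y by (auto simp: U_def dist_real_def)
      then have "(l + 1) * \<bar>x - y\<bar> < \<epsilon>" using l by (simp add: field_simps)
      moreover have "d (p x) (p y) \<le> (l + 1) * \<bar>x - y\<bar>"
        using lip[of x y] x y by (auto simp: U_def algebra_simps)
      ultimately show ?thesis using pM x y by (auto simp: U_def)
    qed
    ultimately show "\<exists>U. openin (top_of_set {0..1}) U \<and> x \<in> U \<and> (\<forall>y\<in>U. p y \<in> mball (p x) \<epsilon>)" by blast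
  qed
  moreover have "p 0 = \<alpha> (t - r)" "p 1 = \<alpha> (t + r)" using c by (simp_all add: p_def)
  moreover have "p ` {0..1} \<inter> mball (\<alpha> t) r = {}" using c(3)[OF l01] by (auto simp: p_def)
  moreover have "path_length p \<le> ennreal l"
    unfolding path_length_def
  proof (rule SUP_least)
    fix ts assume "ts \<in> {ts :: real list. sorted ts \<and> set ts \<subseteq> {0..1}}"
    then have ts: "sorted ts" "set ts \<subseteq> {0..1}" by auto
    have "(\<Sum>i<length ts - 1. ennreal (d (p (ts ! i)) (p (ts ! Suc i)))) = (\<Sum>i<length (map p ts) - 1. ennreal (d (map p ts ! i) (map p ts ! Suc i)))"
      by (intro sum.cong) auto
    also have "\<dots> = ennreal (chain_len d (map p ts))" by (rule sum_chain_len) simp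
    also have "chain_len d (map p ts) \<le> l"
    proof (cases ts)
      case (Cons a us)
      have "chain_len d (map p (a # us)) \<le> l * (1 - a)" if "sorted (a # us)" "set (a # us) \<subseteq> {0..1}" for a us
        using that
      proof (induction us arbitrary: a)
        case Nil
        then show ?case using l by simp
      next
        case (Cons b us)
        then have "chain_len d (map p (b # us)) \<le> l * (1 - b)" by simp
        moreover have "d (p a) (p b) \<le> l * (b - a)" using lip[of a b] Cons.prems by auto
        ultimately show ?case by (simp add: algebra_simps)
      qed
      from this[of a us] ts Cons have "chain_len d (map p ts) \<le> l * (1 - a)" by simp
      also have "\<dots> \<le> l" using ts Cons l by (simp add: mult_left_le)
      finally show ?thesis .
    qed (use l in simp)
    finally show "(\<Sum>i<length ts - 1. ennreal (d (p (ts ! i)) (p (ts ! Suc i)))) \<le> ennreal l"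
      by (simp add: ennreal_leI)
  qed
  ultimately show ?thesis unfolding divergence_at_def by (blast intro: INF_lower2)
qed

text \<open>A subdivision fine enough for continuity may have arbitrarily many points; merging short
  neighbouring steps makes their number proportional to the length.\<close>

lemma chain_thin_out:
  assumes "zs \<noteq> []" "successively (\<lambda>x y. d x y \<le> 1) zs" "set zs \<subseteq> M"
  obtains ys where "ys \<noteq> []" "hd ys = hd zs" "last ys = last zs" "set ys \<subseteq> set zs"
    "successively (\<lambda>x y. d x y \<le> 1) ys" "real (length ys) \<le> 2 + 2 * chain_len d zs"
proof -
  text \<open>Merge the next step into the first one whenever their lengths \<open>\<delta>\<close>, \<open>e\<close> have sum at most 1.\<close>
  have "\<exists>y y' ys \<delta>. y = hd zs \<and> last (y # y' # ys) = last zs \<and> set (y # y' # ys) \<subseteq> set zs \<and>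
      successively (\<lambda>x y. d x y \<le> 1) (y # y' # ys) \<and> d y y' \<le> \<delta> \<and> \<delta> \<le> 1 \<and>
      real (length (y # y' # ys)) \<le> 2 + 2 * chain_len d zs - \<delta>"
    using assms
  proof (induction zs rule: list_nonempty_induct)
    case (single x)
    then show ?case by (intro exI[of _ x] exI[of _ "[]"] exI[of _ 0]) auto
  next
    case (cons x zs)
    then have "successively (\<lambda>x y. d x y \<le> 1) zs" "set zs \<subseteq> M" "d x (hd zs) \<le> 1"
      by (auto simp: successively_Cons)
    with cons.IH obtain y y' ys \<delta> where IH: "y = hd zs" "last (y # y' # ys) = last zs" "set (y # y' # ys) \<subseteq> set zs"
      "successively (\<lambda>x y. d x y \<le> 1) (y # y' # ys)" "d y y' \<le> \<delta>" "\<delta> \<le> 1"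
      "real (length (y # y' # ys)) \<le> 2 + 2 * chain_len d zs - \<delta>" by blast
    define e where "e = d x y"
    have e: "0 \<le> e" "e \<le> 1" "chain_len d (x # zs) = e + chain_len d zs"
      using \<open>d x (hd zs) \<le> 1\<close> IH(1) cons.hyps by (auto simp: e_def neq_Nil_conv)
    show ?case
    proof (cases "e + \<delta> \<le> 1")
      case True
      have "x \<in> M" "y \<in> M" "y' \<in> M" using cons.prems IH(3) by auto
      then have "d x y' \<le> e + \<delta>" using triangle[of x y y'] IH(5) by (simp add: e_def)
      moreover have "last (x # y' # ys) = last (x # zs)" "set (x # y' # ys) \<subseteq> set (x # zs)"
        using IH(2,3) cons.hyps by auto
      moreover have "successively (\<lambda>x y. d x y \<le> 1) (x # y' # ys)"
        using IH(4) \<open>d x y' \<le> e + \<delta>\<close> True by (auto simp: successively_Cons)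
      moreover have "real (length (x # y' # ys)) \<le> 2 + 2 * chain_len d (x # zs) - (e + \<delta>)"
        using IH(7) e by simp
      moreover have "x = hd (x # zs)" by simp
      ultimately show ?thesis using True by blast
    next
      case False
      then have "real (length (x # y # y' # ys)) \<le> 2 + 2 * chain_len d (x # zs) - e"
        using IH(7) e by simp
      moreover have "last (x # y # y' # ys) = last (x # zs)" "set (x # y # y' # ys) \<subseteq> set (x # zs)"
        using IH(2,3) cons.hyps by auto
      moreover have "successively (\<lambda>x y. d x y \<le> 1) (x # y # y' # ys)"
        using IH(4) e by (simp add: e_def)
      moreover have "x = hd (x # zs)" "d x y \<le> e" by (simp_all add: e_def)
      ultimately show ?thesis using e(2) by blast
    qed
  qed
  then obtain y y' ys \<delta> where y: "y = hd zs" "last (y # y' # ys) = last zs" "set (y # y' # ys) \<subseteq> set zs"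
      "successively (\<lambda>x y. d x y \<le> 1) (y # y' # ys)" "d y y' \<le> \<delta>"
      "real (length (y # y' # ys)) \<le> 2 + 2 * chain_len d zs - \<delta>" by blast
  moreover have "0 \<le> \<delta>" using y(5) nonneg[of y y'] by linarith
  ultimately show thesis using that[of "y # y' # ys"] by auto
qed

lemma path_sample:
  assumes p: "pathin mtopology p" and len: "path_length p \<le> ennreal l" and l: "0 \<le> l"
  obtains ys where "ys \<noteq> []" "hd ys = p 0" "last ys = p 1" "set ys \<subseteq> p ` {0..1}"
    "successively (\<lambda>x y. d x y \<le> 1) ys" "real (length ys) \<le> 2 + 2 * l"
proof -
  have cont: "continuous_map (top_of_set {0..1}) mtopology p" using p by (simp add: pathin_def)
  have pM: "p s \<in> M" if "s \<in> {0..1}" for s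
    using continuous_map_image_subset_topspace[OF cont] that by auto
  \<comment> \<open>The property of intervals to which \<open>Bolzano\<close> is applied: it holds
    locally by continuity, and subdivisions of adjacent intervals can be concatenated.\<close>
  define P where "P a b \<longleftrightarrow> (0 \<le> a \<longrightarrow> a \<le> b \<longrightarrow> b \<le> 1 \<longrightarrow> (\<exists>ts. ts \<noteq> [] \<and> hd ts = a \<and> last ts = b \<and> sorted ts \<and>
     set ts \<subseteq> {a..b} \<and> successively (\<lambda>x y. d (p x) (p y) \<le> 1) ts))" for a b :: real
  have "P 0 1" using zero_le_one[where 'a = real]
  proof (induction rule: Bolzano)
    case (trans a b c)
    show ?case unfolding P_def
    proof (intro impI)
      assume *: "0 \<le> a" "a \<le> c" "c \<le> 1"
      obtain ts where ts: "ts \<noteq> []" "hd ts = a" "last ts = b" "sorted ts" "set ts \<subseteq> {a..b}"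
        "successively (\<lambda>x y. d (p x) (p y) \<le> 1) ts" using trans * unfolding P_def by auto
      obtain us where us: "us \<noteq> []" "hd us = b" "last us = c" "sorted us" "set us \<subseteq> {b..c}"
        "successively (\<lambda>x y. d (p x) (p y) \<le> 1) us" using trans * unfolding P_def by auto
      have "b \<in> {0..1}" using trans * by auto
      then have "d (p b) (p b) \<le> 1" using pM by simp
      moreover have "\<forall>x\<in>set ts. \<forall>y\<in>set us. x \<le> y" using ts(5) us(5) by fastforce
      ultimately show "\<exists>ts. ts \<noteq> [] \<and> hd ts = a \<and> last ts = c \<and> sorted ts \<and>
         set ts \<subseteq> {a..c} \<and> successively (\<lambda>x y. d (p x) (p y) \<le> 1) ts"
        using ts us trans(3,4)
        by (intro exI[of _ "ts @ us"]) (auto simp: sorted_append successively_append_iff)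
    qed
  next
    case (local x)
    have "x \<in> topspace (top_of_set {0..1})" using local by simp
    then obtain U where U: "openin (top_of_set {0..1}) U" "x \<in> U" "\<And>y. y \<in> U \<Longrightarrow> p y \<in> mball (p x) (1/2)"
      using cont unfolding continuous_map_to_metric by (meson half_gt_zero zero_less_one)
    then obtain \<epsilon> where \<epsilon>: "\<epsilon> > 0" "\<And>y. y \<in> {0..1} \<Longrightarrow> dist y x < \<epsilon> \<Longrightarrow> y \<in> U"
      unfolding openin_euclidean_subtopology_iff by meson
    have "P a b" if "a \<le> x" "x \<le> b" "b - a < \<epsilon>" for a b
      unfolding P_def
    proof (intro impI)
      assume *: "0 \<le> a" "a \<le> b" "b \<le> 1"
      have "a \<in> U" "b \<in> U" using * that by (auto intro!: \<epsilon>(2) simp: dist_real_def)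
      then have "d (p x) (p a) < 1/2" "d (p x) (p b) < 1/2" "p x \<in> M" "p a \<in> M" "p b \<in> M" using U(3) by auto
      then have "d (p a) (p b) \<le> 1" using triangle[of "p a" "p x" "p b"] commute[of "p a" "p x"] by simp
      then show "\<exists>ts. ts \<noteq> [] \<and> hd ts = a \<and> last ts = b \<and> sorted ts \<and>
         set ts \<subseteq> {a..b} \<and> successively (\<lambda>x y. d (p x) (p y) \<le> 1) ts"
        using * by (intro exI[of _ "[a, b]"]) auto
    qed
    then show ?case using \<epsilon>(1) by blast
  qed
  then obtain ts where ts: "ts \<noteq> []" "hd ts = 0" "last ts = 1" "sorted ts" "set ts \<subseteq> {0..1}"
    "successively (\<lambda>x y. d (p x) (p y) \<le> 1) ts" unfolding P_def by auto
  have sub: "set (map p ts) \<subseteq> M" using ts(5) pM by auto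
  obtain ys where ys: "ys \<noteq> []" "hd ys = hd (map p ts)" "last ys = last (map p ts)" "set ys \<subseteq> set (map p ts)"
    "successively (\<lambda>x y. d x y \<le> 1) ys" "real (length ys) \<le> 2 + 2 * chain_len d (map p ts)"
    using chain_thin_out[of "map p ts"] ts sub by (auto simp: successively_map)
  have "ennreal (chain_len d (map p ts)) = (\<Sum>i<length ts - 1. ennreal (d (p (ts ! i)) (p (ts ! Suc i))))"
    unfolding sum_chain_len[of d "map p ts", OF nonneg, symmetric] by (intro sum.cong) auto
  also have "\<dots> \<le> path_length p"
    unfolding path_length_def using ts by (intro SUP_upper2[of ts]) auto
  finally have "chain_len d (map p ts) \<le> l" using len l by (meson ennreal_le_iff order_trans)
  then show thesis using that[of ys] ys ts by (auto simp: hd_map last_map)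
qed

end

section \<open>Spaces modelled on a right-angled Coxeter group\<close>

lemma list_reach:
  assumes "ys \<noteq> []" "successively (\<lambda>x y. wd x y \<le> J) ys"
  shows "reach {w. \<exists>y\<in>set ys. wd y w \<le> J} (length ys * J) (hd ys) (last ys)"
  using assms
proof (induction ys rule: list_nonempty_induct)
  case (single x)
  show ?case by (simp add: reach_refl)
next
  case (cons x ys)
  let ?B = "{w. \<exists>y\<in>set (x # ys). wd y w \<le> J}"
  have "reach ?B (length ys * J) (hd ys) (last ys)"
    using cons.IH cons.prems by (rule_tac reach_mono) (auto simp: successively_Cons cons.hyps)
  moreover have "reach ?B J x (hd ys)"
  proof -
    obtain f where f: "edge_path f (wd x (hd ys))" "f 0 = x" "f (wd x (hd ys)) = hd ys" by (rule geodesic_path)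
    have le: "wd x (hd ys) \<le> J" using cons.prems cons.hyps by (auto simp: successively_Cons)
    have "f i \<in> ?B" if "i \<le> wd x (hd ys)" for i
      using edge_path_wd[OF f(1), of 0 i] that le f(2) by auto
    then have "reach ?B (wd x (hd ys)) x (hd ys)" unfolding reach_def using f by blast
    then show ?thesis using le by (auto intro: reach_mono)
  qed
  ultimately show ?case using reach_trans cons.hyps by (fastforce simp: add.commute)
qed

text \<open>A space quasi-isometric to a special subgroup, with one natural number K for all
  constants. The last axiom stands in for geodesics: paths that are shortest up to 1 suffice, and
  the infimum in \<open>graph_dist\<close> supplies them.\<close>

locale coarse_model = Metric_space M d for M :: "'a set" and d :: "'a \<Rightarrow> 'a \<Rightarrow> real" +
  fixes \<psi> :: "'a \<Rightarrow> 'v::simple_graph rac" and A :: "'v set" and K :: nat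
  assumes K: "1 \<le> K"
    and \<psi>_sp: "x \<in> M \<Longrightarrow> \<psi> x \<in> sp A"
    and \<psi>_upper: "x \<in> M \<Longrightarrow> y \<in> M \<Longrightarrow> real (wd (\<psi> x) (\<psi> y)) \<le> K * d x y + K"
    and \<psi>_lower: "x \<in> M \<Longrightarrow> y \<in> M \<Longrightarrow> d x y \<le> K * real (wd (\<psi> x) (\<psi> y)) + K"
    and \<psi>_onto: "w \<in> sp A \<Longrightarrow> \<exists>x\<in>M. wd (\<psi> x) w \<le> K"
    and length_space: "x \<in> M \<Longrightarrow> y \<in> M \<Longrightarrow> \<exists>l\<le>d x y + 1. joined M l x y"
begin

lemma joined_near:
  assumes "x \<in> M" "y \<in> M" "z \<in> M" "r + d x y + 1 \<le> d z x" "d x y + 1 \<le> l"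
  shows "joined (- mball z r) l x y"
proof -
  obtain l' where l': "l' \<le> d x y + 1" "joined M l' x y" using length_space[OF assms(1,2)] by blast
  then obtain c where c: "c 0 = x" "c l' = y" "\<And>s. s \<in> {0..l'} \<Longrightarrow> c s \<in> M"
    "\<And>s t. s \<in> {0..l'} \<Longrightarrow> t \<in> {0..l'} \<Longrightarrow> d (c s) (c t) \<le> \<bar>s - t\<bar>" and l0: "0 \<le> l'"
    unfolding joined_def by blast
  have "c s \<notin> mball z r" if s: "s \<in> {0..l'}" for s
  proof -
    have "d z x \<le> d z (c s) + d (c s) x" using assms c(3)[OF s] by (intro triangle)
    moreover have "d (c s) x \<le> l'" using c(4)[OF s, of 0] c(1) l0 s by auto
    ultimately show ?thesis using assms l'(1) by auto
  qed
  then have "joined (- mball z r) l' x y" unfolding joined_def using c l0 by (intro conjI exI[of _ c]) auto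
  then show ?thesis by (rule joined_mono) (use l'(1) assms(5) in auto)
qed

text \<open>For lower bounds: sample the path at scale 1, map the samples by \<open>\<psi>\<close>,
  and fill the gaps, of size at most 2 K, by geodesic edge paths. These fillings and an additive
  error reduce the radius r / K by at most 3 K.\<close>

lemma path_to_reach:
  assumes p: "pathin mtopology p" and len: "path_length p \<le> ennreal l" and l: "0 \<le> l"
    and z: "z \<in> M" and avoid: "p ` {0..1} \<inter> mball z r = {}"
  obtains n where "reach {w. r / K \<le> real (wd (\<psi> z) w) + 3 * K} n (\<psi> (p 0)) (\<psi> (p 1))"
    "real n \<le> (2 + 2 * l) * (2 * K)"
proof -
  obtain ys where ys: "ys \<noteq> []" "hd ys = p 0" "last ys = p 1" "set ys \<subseteq> p ` {0..1}"
    "successively (\<lambda>x y. d x y \<le> 1) ys" "real (length ys) \<le> 2 + 2 * l"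
    by (rule path_sample[OF p len l])
  have pM: "p s \<in> M" if "s \<in> {0..1}" for s
    using p continuous_map_image_subset_topspace[of "top_of_set {0..1}" mtopology p] that
    by (auto simp: pathin_def)
  have yM: "set ys \<subseteq> M" using ys(4) pM by auto
  have succ: "successively (\<lambda>x y. wd x y \<le> 2 * K) (map \<psi> ys)"
    unfolding successively_map
  proof (rule successively_mono[OF ys(5)])
    fix x y assume "x \<in> set ys" "y \<in> set ys" "d x y \<le> 1"
    then have "x \<in> M" "y \<in> M" "real K * d x y \<le> real K * 1" using yM mult_left_mono[of "d x y" 1 "real K"] by auto
    with \<psi>_upper[of x y] show "wd (\<psi> x) (\<psi> y) \<le> 2 * K" by linarith
  qed
  have ball: "r / K \<le> real (wd (\<psi> z) w) + 3 * K" if "y \<in> set ys" "wd (\<psi> y) w \<le> 2 * K" for y w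
  proof -
    have yM': "y \<in> M" using that yM by auto
    have "y \<notin> mball z r" using that(1) ys(4) avoid by auto
    then have "r \<le> d z y" using z yM' by auto
    also have "\<dots> \<le> K * real (wd (\<psi> z) (\<psi> y)) + K" using \<psi>_lower z yM' by blast
    also have "\<dots> \<le> K * (real (wd (\<psi> z) w) + 2 * K) + K"
      using wd_triangle[of "\<psi> z" "\<psi> y" w] wd_sym[of w "\<psi> y"] that(2)
      by (intro add_right_mono mult_left_mono) auto
    finally have "r / K \<le> (K * (real (wd (\<psi> z) w) + 2 * K) + K) / K" by (rule divide_right_mono) simp
    also have "\<dots> = real (wd (\<psi> z) w) + 2 * K + 1" using K by (simp add: add_divide_distrib)
    finally show ?thesis using K by simp
  qed
  have "reach {w. \<exists>y\<in>set (map \<psi> ys). wd y w \<le> 2 * K} (length (map \<psi> ys) * (2 * K)) (hd (map \<psi> ys)) (last (map \<psi> ys))"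
    using list_reach[OF _ succ] ys(1) by simp
  then have "reach {w. \<exists>y\<in>set (map \<psi> ys). wd y w \<le> 2 * K} (length ys * (2 * K)) (\<psi> (p 0)) (\<psi> (p 1))"
    using ys by (simp add: hd_map last_map)
  then have "reach {w. r / K \<le> real (wd (\<psi> z) w) + 3 * K} (length ys * (2 * K)) (\<psi> (p 0)) (\<psi> (p 1))"
    by (rule reach_mono) (use ball in auto)
  moreover have "real (length ys * (2 * K)) \<le> (2 + 2 * l) * (2 * K)"
    using ys(6) by (simp add: mult_right_mono)
  ultimately show thesis using that by blast
qed

text \<open>K * (2 * N + 1) + K bounds the distance between points whose images are N-close to
  adjacent vertices; the last 1 is the slack in \<open>length_space\<close>.\<close>

definition lift_step :: "nat \<Rightarrow> real" where "lift_step N = K * (2 + 2 * real N) + 1"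

lemma \<psi>_near:
  assumes "x \<in> M" "y \<in> M" "wd (\<psi> x) v \<le> N" "wd (\<psi> y) w \<le> N" "wd v w \<le> 1"
  shows "d x y + 1 \<le> lift_step N"
proof -
  have "wd (\<psi> x) (\<psi> y) \<le> N + 1 + N"
    using wd_triangle[of "\<psi> x" "\<psi> y" v] wd_triangle[of v "\<psi> y" w] assms wd_sym[of "\<psi> y" w] by linarith
  then have "real K * real (wd (\<psi> x) (\<psi> y)) \<le> real K * real (N + 1 + N)"
    by (intro mult_left_mono) (simp_all only: of_nat_le_iff of_nat_0_le_iff)
  then show ?thesis using \<psi>_lower[OF assms(1,2)] by (simp add: lift_step_def algebra_simps)
qed

text \<open>For upper bounds: lift the vertices of an edge path by \<open>\<psi>_onto\<close> and
  join the lifts by almost shortest paths. The condition on \<rho> keeps each lift so far from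
  \<open>z\<close> that these paths cannot enter the ball.\<close>

lemma reach_to_joined:
  assumes r: "reach B n x y" and B: "B \<subseteq> sp A" "\<And>w. w \<in> B \<Longrightarrow> \<rho> \<le> wd (\<psi> z) w"
    and z: "z \<in> M" and N: "K \<le> N" and u: "u \<in> M" "wd (\<psi> u) x \<le> N" and v: "v \<in> M" "wd (\<psi> v) y \<le> N"
    and \<rho>: "K * (r + lift_step N + 1) + N \<le> real \<rho>"
  shows "joined (- mball z r) (real (n + 1) * lift_step N) u v"
proof -
  obtain f where f: "edge_path f n" "f 0 = x" "f n = y" "\<And>i. i \<le> n \<Longrightarrow> f i \<in> B"
    using r unfolding reach_def by blast
  have far: "r + lift_step N \<le> d z x" if "x \<in> M" "wd (\<psi> x) w \<le> N" "w \<in> B" for x w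
  proof -
    have "wd (\<psi> z) w \<le> wd (\<psi> z) (\<psi> x) + N" using wd_triangle[of "\<psi> z" w "\<psi> x"] that(2) by simp
    then have "real \<rho> \<le> real (wd (\<psi> z) (\<psi> x)) + N" using B(2)[OF that(3)] by linarith
    moreover have "real (wd (\<psi> z) (\<psi> x)) \<le> K * d z x + K" using \<psi>_upper z that by blast
    ultimately have "K * (r + lift_step N + 1) \<le> K * (d z x + 1)" using \<rho> by (simp add: algebra_simps)
    then show ?thesis using K by simp
  qed
  have "joined (- mball z r) (real (i + 1) * lift_step N) u x'" if "i \<le> n" "x' \<in> M" "wd (\<psi> x') (f i) \<le> N" for i x'
    using that
  proof (induction i arbitrary: x')
    case 0
    have "d u x' + 1 \<le> lift_step N" using 0 u f(2) by (intro \<psi>_near) auto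
    moreover have "r + lift_step N \<le> d z u" using far[OF u(1), of x] u f(2) f(4)[of 0] by auto
    ultimately show ?case using u 0 z by (intro joined_near) auto
  next
    case (Suc i)
    obtain x'' where x'': "x'' \<in> M" "wd (\<psi> x'') (f i) \<le> K" using \<psi>_onto[of "f i"] f(4)[of i] B Suc.prems by auto
    then have N': "wd (\<psi> x'') (f i) \<le> N" using N by simp
    have "wd (f i) (f (Suc i)) \<le> 1" using f(1) Suc.prems by (simp add: edge_path_def)
    then have "d x'' x' + 1 \<le> lift_step N" using Suc.prems x'' N' by (intro \<psi>_near) auto
    moreover have "r + lift_step N \<le> d z x''" using far[OF x''(1) N'] f(4)[of i] Suc.prems by auto
    ultimately have "joined (- mball z r) (lift_step N) x'' x'"
      using Suc.prems x'' z by (intro joined_near) auto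
    with Suc.IH[OF _ x''(1) N'] Suc.prems(1)
    have "joined (- mball z r) (real (i + 1) * lift_step N + lift_step N) u x'" by (auto intro: joined_trans)
    moreover have "real (i + 1) * lift_step N + lift_step N = real (Suc i + 1) * lift_step N" by (simp add: algebra_simps)
    ultimately show ?case by simp
  qed
  then show ?thesis using v f(3) by auto
qed

lemma geodesicD:
  assumes "geodesic UNIV \<gamma>" shows "\<gamma> t \<in> M" "d (\<gamma> s) (\<gamma> t) = \<bar>s - t\<bar>"
  using assms unfolding geodesic_def quasi_geodesic_def by (auto intro: antisym)

lemma joined_geodesic:
  assumes g: "geodesic UNIV \<gamma>" and "s \<le> s'" "\<And>\<tau>. s \<le> \<tau> \<Longrightarrow> \<tau> \<le> s' \<Longrightarrow> r \<le> \<bar>t - \<tau>\<bar>"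
  shows "joined (- mball (\<gamma> t) r) (s' - s) (\<gamma> s) (\<gamma> s')"
proof -
  define c where "c \<tau> = \<gamma> (s + \<tau>)" for \<tau>
  have "c \<tau> \<in> - mball (\<gamma> t) r \<inter> M" if "\<tau> \<in> {0..s' - s}" for \<tau>
  proof -
    have "r \<le> d (\<gamma> t) (c \<tau>)" using assms(3)[of "s + \<tau>"] that unfolding c_def geodesicD(2)[OF g] by simp
    then show ?thesis using geodesicD(1)[OF g] by (auto simp: c_def)
  qed
  moreover have "d (c \<tau>) (c \<tau>') \<le> \<bar>\<tau> - \<tau>'\<bar>" for \<tau> \<tau>'
    using geodesicD(2)[OF g] by (simp add: c_def)
  moreover have "0 \<le> s' - s" "c 0 = \<gamma> s" "c (s' - s) = \<gamma> s'" using assms(2) by (simp_all add: c_def)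
  ultimately show ?thesis unfolding joined_def by blast
qed

text \<open>The path follows the geodesic outwards to t - a, crosses over there and returns from t +
  a; the two excursions add at most 2 a.\<close>

lemma divergence_from_reach:
  assumes g: "geodesic UNIV \<gamma>" and r: "reach B n x y" and B: "B \<subseteq> sp A" "\<And>w. w \<in> B \<Longrightarrow> \<rho> \<le> wd (\<psi> (\<gamma> t)) w"
    and N: "K \<le> N" and a: "wd (\<psi> (\<gamma> (t - a))) x \<le> N" "wd (\<psi> (\<gamma> (t + a))) y \<le> N"
    and \<rho>: "K * (r + lift_step N + 1) + N \<le> real \<rho>" and ra: "0 \<le> r" "r \<le> a"
  shows "divergence_at \<gamma> r t \<le> ennreal (real (n + 1) * lift_step N + 2 * a)"
proof -
  note [simp] = geodesicD(1)[OF g]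
  have 1: "joined (- mball (\<gamma> t) r) (real (n + 1) * lift_step N) (\<gamma> (t - a)) (\<gamma> (t + a))"
    using reach_to_joined[OF r B _ N _ a(1) _ a(2) \<rho>] by simp
  have 2: "joined (- mball (\<gamma> t) r) (t - r - (t - a)) (\<gamma> (t - a)) (\<gamma> (t - r))"
    using ra by (intro joined_geodesic[OF g]) auto
  have 3: "joined (- mball (\<gamma> t) r) (t + a - (t + r)) (\<gamma> (t + r)) (\<gamma> (t + a))"
    using ra by (intro joined_geodesic[OF g]) auto
  show ?thesis
    by (rule joined_divergence, rule joined_mono[OF joined_trans[OF joined_trans[OF joined_sym[OF 2] 1] joined_sym[OF 3]]])
      (use ra in auto)
qed

end

section \<open>Bounds for the lower divergence\<close>

definition power_fun :: "nat \<Rightarrow> real \<Rightarrow> ennreal" where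
  "power_fun e x = ennreal (x ^ e)"

lemma fun_preceqI:
  assumes "A > 0" "B > 0" "C > 0" "D > 0" "\<And>x. x > D \<Longrightarrow> f x \<le> ennreal A * g (B * x) + ennreal (C * x)"
  shows "fun_preceq f g"
  using assms unfolding fun_preceq_def by blast

lemma fun_preceq_trans:
  assumes "fun_preceq f g" "fun_preceq g h" shows "fun_preceq f h"
proof -
  obtain A B C D where 1: "A > 0" "B > 0" "C > 0" "D > 0"
    "\<And>x. x > D \<Longrightarrow> f x \<le> ennreal A * g (B * x) + ennreal (C * x)"
    using assms(1) unfolding fun_preceq_def by blast
  obtain A' B' C' D' where 2: "A' > 0" "B' > 0" "C' > 0" "D' > 0"
    "\<And>x. x > D' \<Longrightarrow> g x \<le> ennreal A' * h (B' * x) + ennreal (C' * x)"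
    using assms(2) unfolding fun_preceq_def by blast
  have "f x \<le> ennreal (A * A') * h ((B' * B) * x) + ennreal ((A * C' * B + C) * x)" if x: "x > max D (D' / B)" for x
  proof -
    have "B * x > D'" using x 1 by (simp add: field_simps)
    then have "g (B * x) \<le> ennreal A' * h (B' * (B * x)) + ennreal (C' * (B * x))" by (rule 2)
    then have "f x \<le> ennreal A * (ennreal A' * h (B' * (B * x)) + ennreal (C' * (B * x))) + ennreal (C * x)"
      using 1(5)[of x] x by (meson add_right_mono mult_left_mono order_trans max_less_iff_conj zero_le)
    also have "ennreal A * (ennreal A' * h (B' * (B * x)) + ennreal (C' * (B * x))) + ennreal (C * x)
      = ennreal (A * A') * h (B' * (B * x)) + (ennreal (A * (C' * (B * x))) + ennreal (C * x))"
      using 1 2 by (simp add: distrib_left ennreal_mult' mult.assoc add.assoc)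
    also have "ennreal (A * (C' * (B * x))) + ennreal (C * x) = ennreal ((A * C' * B + C) * x)"
    proof -
      have "0 \<le> x" using x 1 by linarith
      then show ?thesis using 1 2 by (subst ennreal_plus[symmetric]) (auto simp: algebra_simps)
    qed
    finally show ?thesis by (simp add: mult.assoc)
  qed
  moreover have "A * A' > 0" "B' * B > 0" "A * C' * B + C > 0" "max D (D' / B) > 0" using 1 2 by (auto intro!: add_pos_pos)
  ultimately show ?thesis unfolding fun_preceq_def by blast
qed

text \<open>With e \<ge> 1, the power x ^ e absorbs the linear term of \<open>fun_preceq\<close>;
  degrees 0 and 1 are not distinguished by that relation.\<close>

lemma power_fun_strict:
  assumes "e < e'" "0 < e'" "1 \<le> e" shows "\<not> fun_preceq (power_fun e') (power_fun e)"
proof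
  assume "fun_preceq (power_fun e') (power_fun e)"
  then obtain A B C D where 1: "A > 0" "B > 0" "C > 0" "D > 0"
    "\<And>x. x > D \<Longrightarrow> power_fun e' x \<le> ennreal A * power_fun e (B * x) + ennreal (C * x)"
    unfolding fun_preceq_def by blast
  define x where "x = max D 1 + A * B ^ e + C"
  have "0 \<le> A * B ^ e" using 1 by simp
  then have x: "x > D" "x \<ge> 1" "x > A * B ^ e + C" "A * B ^ e \<ge> 0" using 1(3,4) unfolding x_def by linarith+
  have "ennreal (x ^ e') \<le> ennreal (A * (B * x) ^ e + C * x)"
    using 1(5)[OF x(1)] 1 x by (simp add: power_fun_def ennreal_mult' ennreal_plus)
  then have "x ^ e' \<le> A * (B * x) ^ e + C * x" using 1 x by (subst (asm) ennreal_le_iff) auto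
  also have "\<dots> = A * B ^ e * x ^ e + C * x" by (simp add: power_mult_distrib)
  also have "\<dots> \<le> A * B ^ e * x ^ e + C * x ^ e"
    using 1 x assms by (intro add_left_mono mult_left_mono self_le_power) auto
  also have "\<dots> = (A * B ^ e + C) * x ^ e" by (simp add: algebra_simps)
  also have "\<dots> < x * x ^ e" using x by (intro mult_strict_right_mono) auto
  also have "\<dots> \<le> x ^ e'" using x(2) power_increasing[of "Suc e" e' x] assms by simp
  finally show False by simp
qed

lemma nat_ceiling_le_add_one: "0 \<le> x \<Longrightarrow> real (nat \<lceil>x\<rceil>) \<le> x + 1" for x :: real
  using of_int_ceiling_le_add_one[of x] by simp

context Metric_space
begin

text \<open>The infima in the lower divergence need not be attained. A path of length below y + 1 is
  used instead, and the surplus goes into the linear term.\<close>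

lemma lower_divergence_geI:
  assumes "A > 0" "D > 0"
    and bound: "\<And>r t p l. r > D \<Longrightarrow> pathin mtopology p \<Longrightarrow> p 0 = \<gamma> (t - r) \<Longrightarrow> p 1 = \<gamma> (t + r) \<Longrightarrow>
      p ` {0..1} \<inter> mball (\<gamma> t) r = {} \<Longrightarrow> 0 \<le> l \<Longrightarrow> path_length p \<le> ennreal l \<Longrightarrow> r ^ e \<le> A * (l + 1)"
  shows "fun_preceq (power_fun e) (lower_divergence \<gamma>)"
proof -
  have "power_fun e r \<le> ennreal A * lower_divergence \<gamma> (1 * r) + ennreal (2 * A * r)" if r: "r > max D 1" for r
  proof (cases "lower_divergence \<gamma> r = \<infinity>")
    case True
    then show ?thesis using assms by (simp add: ennreal_mult_top)
  next
    case False
    define y where "y = enn2real (lower_divergence \<gamma> r)"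
    have y: "lower_divergence \<gamma> r = ennreal y" "0 \<le> y" using False by (simp_all add: y_def less_top)
    then have "lower_divergence \<gamma> r < ennreal (y + 1)" by (simp add: ennreal_less_iff)
    then obtain t p where p: "pathin mtopology p" "p 0 = \<gamma> (t - r)" "p 1 = \<gamma> (t + r)"
      "p ` {0..1} \<inter> mball (\<gamma> t) r = {}" "path_length p < ennreal (y + 1)"
      unfolding lower_divergence_def divergence_at_def by (auto simp: INF_less_iff)
    have "r ^ e \<le> A * (y + 1 + 1)" using r p y by (intro bound[of r p t]) auto
    also have "\<dots> \<le> A * y + 2 * A * r" using r assms by (simp add: algebra_simps)
    finally have "ennreal (r ^ e) \<le> ennreal (A * y + 2 * A * r)" by (rule ennreal_leI)
    then show ?thesis using y assms r by (simp add: power_fun_def ennreal_mult' ennreal_plus)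
  qed
  then show ?thesis using assms by (rule_tac fun_preceqI[of A 1 "2 * A" "max D 1"]) auto
qed

lemma lower_divergence_leI:
  assumes "A > 0" "B > 0"
    and bound: "\<And>r. r > 1 \<Longrightarrow> \<exists>t. divergence_at \<gamma> r t \<le> ennreal (A * (B * r) ^ e)"
  shows "fun_preceq (lower_divergence \<gamma>) (power_fun e)"
proof -
  have "lower_divergence \<gamma> r \<le> ennreal A * power_fun e (B * r) + ennreal (1 * r)" if r: "r > 1" for r
  proof -
    obtain t where "divergence_at \<gamma> r t \<le> ennreal (A * (B * r) ^ e)" using bound[OF r] by blast
    then have "lower_divergence \<gamma> r \<le> ennreal (A * (B * r) ^ e)"
      unfolding lower_divergence_def by (intro INF_lower2[of t]) auto
    also have "\<dots> = ennreal A * power_fun e (B * r)" using assms r by (simp add: power_fun_def ennreal_mult')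
    finally show ?thesis by (rule add_increasing2[OF zero_le])
  qed
  then show ?thesis using assms by (rule_tac fun_preceqI[of A B 1 1]) auto
qed

end

abbreviation letters :: "nat \<Rightarrow> indexed_vertex set" where "letters k \<equiv> Ix k ` omega_vertices k"

lemma letters_eq: "letters k = Gam k \<union> c_letters k"
  by (auto simp: omega_vertices_def Gam_def c_letters_def)

lemma Gam_letters: "Gam k \<subseteq> letters k"
  by (simp add: letters_eq)

context coarse_model
begin

text \<open>Both ends of the segment are close to one coset of \<open>sp B\<close>. Every exact
  length n has to occur, so the negation provides a single length that never does.\<close>

definition runs_along :: "'v set \<Rightarrow> (real \<Rightarrow> 'a) \<Rightarrow> nat \<Rightarrow> bool" where
  "runs_along B \<gamma> N \<longleftrightarrow> (\<forall>n. \<exists>s t x y. x \<in> sp A \<and> wd (\<psi> (\<gamma> s)) x \<le> N \<and> wd (\<psi> (\<gamma> t)) y \<le> N \<and>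
     - x + y \<in> sp B \<and> wd x y = n)"

lemma runs_alongD:
  assumes "runs_along B \<gamma> N" "B \<subseteq> A"
  obtains s t x y where "s \<le> t" "x \<in> sp A" "wd (\<psi> (\<gamma> s)) x \<le> N" "wd (\<psi> (\<gamma> t)) y \<le> N" "- x + y \<in> sp B" "wd x y = n"
proof -
  obtain s t x y where *: "x \<in> sp A" "wd (\<psi> (\<gamma> s)) x \<le> N" "wd (\<psi> (\<gamma> t)) y \<le> N" "- x + y \<in> sp B" "wd x y = n"
    using assms(1) unfolding runs_along_def by meson
  show thesis
  proof (cases "s \<le> t")
    case True
    then show ?thesis using that * by blast
  next
    case False
    have "x + (- x + y) \<in> sp A" using *(1,4) sp_mono[OF assms(2)] by (blast intro: sp_add)
    then have "y \<in> sp A" by (simp flip: add.assoc)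
    moreover have "- y + x \<in> sp B" using sp_uminus[OF *(4)] by (simp add: minus_add)
    ultimately show ?thesis using that[of t s y x] * False by (simp add: wd_sym)
  qed
qed

end

locale omega_model = coarse_model M d \<psi> "letters k" K
  for M :: "'a set" and d :: "'a \<Rightarrow> 'a \<Rightarrow> real" and \<psi> :: "'a \<Rightarrow> indexed_vertex rac" and K k :: nat +
  assumes k: "1 \<le> k"
begin

text \<open>For radius r take a run of length of order r and the ball about the midpoint of its
  geodesic segment. Either the coset stays away from the ball, and a direct path in the coset works,
  or the detour of \<open>Gam_divergence\<close> is made in the coset around the point nearest to
  the centre.\<close>

theorem runs_along_upper:
  assumes g: "geodesic UNIV \<gamma>" and runs: "runs_along (Gam k) \<gamma> N0"
  shows "fun_preceq (lower_divergence \<gamma>) (power_fun k)"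
proof -
  note [simp] = geodesicD(1)[OF g]
  define N where "N = max N0 K"
  have N: "N0 \<le> N" "K \<le> N" by (simp_all add: N_def)
  obtain C where C: "\<And>n R x y. x \<in> sp (Gam k) \<Longrightarrow> y \<in> sp (Gam k) \<Longrightarrow> 2 * R \<le> len x \<Longrightarrow> 2 * R \<le> len y \<Longrightarrow>
     len x \<le> n \<Longrightarrow> len y \<le> n \<Longrightarrow> 1 \<le> n \<Longrightarrow> reach (sp_outside (Gam k) R) (C * n ^ k) x y"
    using Gam_divergence[OF k] by blast
  define q where "q = K * (2 + 2 * N) + 1"
  have q: "lift_step N = real q" by (simp add: lift_step_def q_def algebra_simps)
  define c1 where "c1 = K * (q + 2) + N + 1"
  \<comment> \<open>The constants make n' = \<alpha> * \<rho> + \<beta> below, which is linear in r;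
    \<open>n0\<close> absorbs the additive errors in the proof that the half-length \<open>a\<close>
    is at least K * (5 * \<rho> + 1 + N).\<close>
  define \<alpha> where "\<alpha> = 1 + K * K * (10 * K * K)"
  define n0 where "n0 = 2 * N + K + 2 * K * K * (1 + N)"
  define \<beta> where "\<beta> = N + K * K * (n0 + 2 * N + 1) + K"
  define A0 where "A0 = (C + 2) * q + 2"
  define B0 where "B0 = \<alpha> * c1 + \<beta>"
  have pos: "A0 > 0" "B0 > 0" by (simp_all add: A0_def B0_def \<alpha>_def c1_def)
  have "\<exists>t. divergence_at \<gamma> r t \<le> ennreal (A0 * (B0 * r) ^ k)" if r: "r > 1" for r :: real
  proof -
    define \<rho> where "\<rho> = nat \<lceil>K * (r + q + 1) + N\<rceil>"
    have \<rho>: "K * (r + q + 1) + N \<le> real \<rho>" unfolding \<rho>_def by (rule real_nat_ceiling_ge)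
    have "real \<rho> \<le> K * (r + q + 1) + N + 1"
      using nat_ceiling_le_add_one r by (simp add: \<rho>_def)
    also have "\<dots> = K * r + (K * (q + 1) + N + 1) * (1 :: real)" by (simp add: algebra_simps)
    also have "\<dots> \<le> K * r + (K * (q + 1) + N + 1) * r"
      using r by (intro add_left_mono mult_left_mono) auto
    also have "\<dots> = c1 * r" by (simp add: c1_def algebra_simps)
    finally have \<rho>_le: "real \<rho> \<le> c1 * r" .
    define n where "n = 10 * K * K * \<rho> + n0"
    define n' where "n' = \<rho> + N + K * (K * (n + 2 * N + 1)) + K"
    have n'_eq: "n' = \<alpha> * \<rho> + \<beta>" by (simp add: n'_def \<alpha>_def \<beta>_def n_def algebra_simps)
    obtain s t x y where st: "s \<le> t" "x \<in> sp (letters k)" "wd (\<psi> (\<gamma> s)) x \<le> N0" "wd (\<psi> (\<gamma> t)) y \<le> N0"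
      "- x + y \<in> sp (Gam k)" "wd x y = n"
      by (rule runs_alongD[OF runs Gam_letters])
    have near: "wd (\<psi> (\<gamma> s)) x \<le> N" "wd (\<psi> (\<gamma> t)) y \<le> N" using st N by simp_all
    define a where "a = (t - s) / 2"
    define t0 where "t0 = (s + t) / 2"
    have t0: "t0 - a = s" "t0 + a = t" by (simp_all add: t0_def a_def field_simps)
    have dst: "d (\<gamma> s) (\<gamma> t) = 2 * a" "d (\<gamma> t0) (\<gamma> s) = a" "d (\<gamma> t0) (\<gamma> t) = a"
      using geodesicD(2)[OF g] st(1) by (auto simp: a_def t0_def field_simps)
    have a_ge: "real K * (5 * \<rho> + 1 + N) \<le> a"
    proof -
      have "n \<le> 2 * N + wd (\<psi> (\<gamma> s)) (\<psi> (\<gamma> t))"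
        using wd_triangle[of x y "\<psi> (\<gamma> s)"] wd_triangle[of "\<psi> (\<gamma> s)" y "\<psi> (\<gamma> t)"] near st(6)
        by (simp add: wd_sym[of x])
      then have "real n \<le> 2 * N + real (wd (\<psi> (\<gamma> s)) (\<psi> (\<gamma> t)))" by linarith
      also have "\<dots> \<le> 2 * N + (K * (2 * a) + K)" using \<psi>_upper[of "\<gamma> s" "\<gamma> t"] dst by simp
      finally have "K * (2 * (real K * (5 * \<rho> + 1 + N))) \<le> K * (2 * a)"
        by (simp add: n_def n0_def algebra_simps)
      then show ?thesis using K by simp
    qed
    have a_le: "2 * a \<le> K * (n + 2 * N + 1)"
    proof -
      have "wd (\<psi> (\<gamma> s)) (\<psi> (\<gamma> t)) \<le> n + 2 * N"
        using wd_triangle[of "\<psi> (\<gamma> s)" "\<psi> (\<gamma> t)" x] wd_triangle[of x "\<psi> (\<gamma> t)" y] near st(6)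
        by (simp add: wd_sym[of y])
      then have "real K * wd (\<psi> (\<gamma> s)) (\<psi> (\<gamma> t)) + K \<le> real K * real (n + 2 * N) + K"
        by (intro add_right_mono mult_left_mono) (simp_all only: of_nat_le_iff of_nat_0_le_iff)
      then show ?thesis using \<psi>_lower[of "\<gamma> s" "\<gamma> t"] dst by (simp add: algebra_simps)
    qed
    have a0: "0 \<le> a" using st(1) by (simp add: a_def)
    define z where "z = \<psi> (\<gamma> t0)"
    \<comment> \<open>Distance 5 * \<rho> from the centre leaves 4 * \<rho> from a point within
      \<rho> of it, as \<open>Gam_divergence\<close> demands at radius 2 * \<rho>; a detour at that
      radius is still \<rho> away from the centre.\<close>
    have wd_z: "5 * \<rho> \<le> wd z w \<and> wd z w \<le> N + K * (K * (n + 2 * N + 1)) + K"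
      if u: "d (\<gamma> t0) (\<gamma> u) = a" "wd (\<psi> (\<gamma> u)) w \<le> N" for u w
    proof
      have "real K * (5 * \<rho> + 1 + N) \<le> K * real (wd z (\<psi> (\<gamma> u))) + K"
        using a_ge \<psi>_lower[of "\<gamma> t0" "\<gamma> u"] u by (simp add: z_def)
      then have "real K * (5 * \<rho> + N) \<le> K * real (wd z (\<psi> (\<gamma> u)))" by (simp add: algebra_simps)
      then have "real (5 * \<rho> + N) \<le> real (wd z (\<psi> (\<gamma> u)))" using K by simp
      then show "5 * \<rho> \<le> wd z w"
        using wd_triangle[of z "\<psi> (\<gamma> u)" w] u(2) wd_sym[of w] by simp
      have "real K * a \<le> real K * (K * (n + 2 * N + 1))" using a_le a0 by (intro mult_left_mono) auto
      then have "real (wd z (\<psi> (\<gamma> u))) \<le> real (K * (K * (n + 2 * N + 1)) + K)"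
        using \<psi>_upper[of "\<gamma> t0" "\<gamma> u"] u by (simp add: z_def)
      then show "wd z w \<le> N + K * (K * (n + 2 * N + 1)) + K"
        using wd_triangle[of z w "\<psi> (\<gamma> u)"] u(2) by linarith
    qed
    note zx = wd_z[OF dst(2) near(1)] and zy = wd_z[OF dst(3) near(2)]
    \<comment> \<open>A point of the coset nearest to the image of the centre.\<close>
    obtain m where m: "- x + m \<in> sp (Gam k)" "\<And>w. - x + w \<in> sp (Gam k) \<Longrightarrow> wd z m \<le> wd z w"
      using ex_has_least_nat[of "\<lambda>w. - x + w \<in> sp (Gam k)" x "wd z"] by auto
    have coset: "w \<in> sp (letters k)" if "- x + w \<in> sp (Gam k)" for w
    proof -
      have "x + (- x + w) \<in> sp (letters k)" using that st(2) sp_mono[OF Gam_letters] by (blast intro: sp_add)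
      then show ?thesis by (simp flip: add.assoc)
    qed
    define W where "W = {w \<in> sp (letters k). \<rho> \<le> wd z w}"
    have n'1: "1 \<le> n'" using K by (simp add: n'_def)
    have n'P: "n' \<le> n' ^ k" using n'1 k self_le_power[of n' k] by simp
    have path: "reach W ((C + 1) * n' ^ k) x y"
    proof (cases "\<rho> \<le> wd z m")
      case True
      obtain us where us: "- x + y = word us" "set us \<subseteq> Gam k" "length us = len (- x + y)"
        by (rule sp_geodesic_word[OF st(5)])
      have "reach W (length us) x (x + word us)"
      proof (rule reach_word)
        fix i
        have "word (take i us) \<in> sp (Gam k)" using us(2) by (intro sp_word) (meson in_set_takeD subset_iff)
        then have *: "- x + (x + word (take i us)) \<in> sp (Gam k)" by (simp flip: add.assoc)
        show "x + word (take i us) \<in> W" using coset[OF *] m(2)[OF *] True by (simp add: W_def)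
      qed
      moreover have "x + word us = y" by (simp flip: us(1) add.assoc)
      moreover have "length us \<le> (C + 1) * n' ^ k"
      proof -
        have "length us = n" using us(3) st(6) by (simp add: wd_def)
        also have "n \<le> K * (K * n)" using K by simp
        also have "\<dots> \<le> n'" by (simp add: n'_def algebra_simps)
        finally show ?thesis using n'P by simp
      qed
      ultimately show ?thesis by (auto intro: reach_mono)
    next
      case False
      have x': "- m + x \<in> sp (Gam k)" using sp_uminus[OF m(1)] by (simp add: minus_add)
      have "(- m + x) + (- x + y) \<in> sp (Gam k)" using x' st(5) by (rule sp_add)
      then have y': "- m + y \<in> sp (Gam k)" by (simp add: add.assoc)
      have len_m: "wd z w \<le> wd z m + len (- m + w)" "len (- m + w) \<le> wd z m + wd z w" for w
        using wd_triangle[of z w m] wd_triangle[of m w z] by (simp_all add: wd_def wd_sym[of m z, unfolded wd_def])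
      have "reach (sp_outside (Gam k) (2 * \<rho>)) (C * n' ^ k) (- m + x) (- m + y)"
        using len_m[of x] len_m[of y] zx zy False n'1
        by (intro C[OF x' y']) (auto simp: n'_def)
      then have "reach W (C * n' ^ k) (m + (- m + x)) (m + (- m + y))"
      proof (rule reach_translate)
        fix v assume v: "v \<in> sp_outside (Gam k) (2 * \<rho>)"
        then have "- x + (m + v) \<in> sp (Gam k)" using sp_add[OF m(1), of v] by (simp add: sp_outside_def add.assoc)
        then have "m + v \<in> sp (letters k)" by (rule coset)
        moreover have "\<rho> \<le> wd z (m + v)"
        proof -
          have "len v \<le> wd m z + wd z (m + v)" using wd_triangle[of m "m + v" z] by (simp add: wd_def flip: add.assoc)
          then show ?thesis using v False by (simp add: sp_outside_def wd_sym[of m])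
        qed
        ultimately show "m + v \<in> W" by (simp add: W_def)
      qed
      then have "reach W (C * n' ^ k) x y" by (simp flip: add.assoc)
      then show ?thesis by (rule reach_mono) auto
    qed
    have ra: "r \<le> a"
    proof -
      have "r \<le> real \<rho>"
      proof -
        have "1 * r \<le> K * r" using K r by (intro mult_right_mono) auto
        then show ?thesis using \<rho> by (simp add: algebra_simps) (smt (verit) of_nat_0_le_iff mult_nonneg_nonneg)
      qed
      also have "real \<rho> \<le> (1 :: real) * (5 * \<rho> + 1 + N)" by simp
      also have "\<dots> \<le> real K * (5 * \<rho> + 1 + N)" using K by (intro mult_right_mono) auto
      finally show ?thesis using a_ge by simp
    qed
    have "divergence_at \<gamma> r t0 \<le> ennreal (real ((C + 1) * n' ^ k + 1) * lift_step N + 2 * a)"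
    proof (rule divergence_from_reach[OF g path])
      show "W \<subseteq> sp (letters k)" by (auto simp: W_def)
      show "\<rho> \<le> wd (\<psi> (\<gamma> t0)) w" if "w \<in> W" for w using that by (simp add: W_def z_def)
      show "real K * (r + lift_step N + 1) + real N \<le> real \<rho>" using \<rho> by (simp add: q)
    qed (use N near t0 ra r in auto)
    also have "\<dots> \<le> ennreal (A0 * (B0 * r) ^ k)"
    proof (rule ennreal_leI)
      have "2 * a \<le> real n'"
      proof -
        have "K * (n + 2 * N + 1) \<le> n'" using K by (simp add: n'_def trans_le_add1 trans_le_add2)
        then show ?thesis using a_le by (metis of_nat_le_iff order_trans)
      qed
      also have "real n' \<le> real (n' ^ k)" using n'P by (simp only: of_nat_le_iff)
      finally have "real ((C + 1) * n' ^ k + 1) * lift_step N + 2 * a \<le> real ((C + 1) * n' ^ k + 1) * q + 2 * real (n' ^ k)"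
        using of_nat_0_le_iff[of "n' ^ k"] unfolding q by linarith
      also have "\<dots> \<le> real ((C + 1) * n' ^ k + n' ^ k) * q + 2 * real (n' ^ k)"
        using n'1 n'P by (intro add_right_mono mult_right_mono) (auto simp only: of_nat_le_iff)
      also have "\<dots> = A0 * real n' ^ k" by (simp add: A0_def algebra_simps)
      also have "\<dots> \<le> A0 * (B0 * r) ^ k"
      proof (intro mult_left_mono power_mono)
        have "real n' = \<alpha> * real \<rho> + \<beta> * (1 :: real)" by (simp add: n'_eq)
        also have "\<dots> \<le> \<alpha> * (c1 * r) + \<beta> * r" using \<rho>_le r by (intro add_mono mult_left_mono) auto
        also have "\<dots> = B0 * r" by (simp add: B0_def algebra_simps)
        finally show "real n' \<le> B0 * r" .
      qed auto
      finally show "real ((C + 1) * n' ^ k + 1) * lift_step N + 2 * a \<le> A0 * (B0 * r) ^ k" .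
    qed
    finally show ?thesis by blast
  qed
  then show ?thesis using pos lower_divergence_leI[of A0 B0 \<gamma> k] by simp
qed

end

section \<open>Morse geodesics with short runs along the peripheral subgroup\<close>

lemma discrete_ivt:
  fixes u :: "nat \<Rightarrow> real"
  assumes "\<And>i. i < n \<Longrightarrow> \<bar>u (Suc i) - u i\<bar> \<le> J" "u 0 \<le> y" "y \<le> u n" "0 \<le> J"
  obtains i where "i \<le> n" "\<bar>u i - y\<bar> \<le> J"
proof -
  have "\<exists>i\<le>n. \<bar>u i - y\<bar> \<le> J" using assms
  proof (induction n)
    case 0
    then show ?case by (intro exI[of _ 0]) auto
  next
    case (Suc n)
    show ?case
    proof (cases "y \<le> u n")
      case True
      with Suc.IH Suc.prems obtain i where "i \<le> n" "\<bar>u i - y\<bar> \<le> J" by (metis less_Suc_eq)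
      then show ?thesis by (intro exI[of _ i]) auto
    next
      case False
      then show ?thesis using Suc.prems(1)[of n] Suc.prems(3) by (intro exI[of _ n]) auto
    qed
  qed
  with that show thesis by blast
qed

lemma reduced_word_wd:
  assumes "reduced_word us" "i \<le> j" "j \<le> length us"
  shows "wd (g + word (take i us)) (g + word (take j us)) = j - i"
proof -
  have "take j us = take i us @ drop i (take j us)"
    using assms(2) by (metis append_take_drop_id min.absorb1 take_take)
  moreover have "reduced_word (take j us)" using assms(1) append_take_drop_id[of j us] reduced_word_append(1) by metis
  ultimately have "reduced_word (drop i (take j us))" "- word (take i us) + word (take j us) = word (drop i (take j us))"
    using reduced_word_append(2) by (metis, metis add.assoc left_minus add.left_neutral word_append)
  then show ?thesis using assms(3) by (simp add: wd_def[of "word _"] reduced_word_def)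
qed

definition corner_pairs :: "nat \<Rightarrow> (indexed_vertex \<times> indexed_vertex) set" where
  "corner_pairs k = {(s, t) \<in> letters k \<times> letters k. s \<noteq> t \<and> \<not> adj s t \<and> (s \<in> c_letters k \<or> t \<in> c_letters k)}"

lemma corner_pairs_cost:
  assumes "1 \<le> k"
  obtains c where "c > 0" "\<And>s t. (s, t) \<in> corner_pairs k \<Longrightarrow> corner c e s t"
proof -
  have "finite (corner_pairs k)"
    by (rule finite_subset[of _ "letters k \<times> letters k"]) (auto simp: corner_pairs_def finite_omega_vertices)
  moreover have "\<exists>c>0. corner c e s t" if "(s, t) \<in> corner_pairs k" for s t
    using that c_corner[OF assms, of s t e] c_corner[OF assms, of t s e] adj_sym[of t s] corner_sym
    unfolding corner_pairs_def by blast
  ultimately obtain c where "c > 0" "\<forall>(s, t)\<in>corner_pairs k. corner c e s t"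
    using corner_uniform[of "corner_pairs k" e] by blast
  then show thesis using that[of c] by blast
qed

text \<open>At most one commutation brings a corner pair to this place. If \<open>c\<close> commutes
  with \<open>t1\<close> but not with \<open>t2\<close>, swap \<open>c\<close> and
  \<open>t1\<close>; if it commutes with both, these are the two letters of its link, and one of
  them is a \<open>c\<close> letter.\<close>

lemma corner_near_c:
  assumes k: "1 \<le> k" and red: "reduced_word (p @ c # t1 # t2 # q)"
    and c: "c \<in> c_letters k" and lt: "set (p @ c # t1 # t2 # q) \<subseteq> letters k"
  obtains pp s t qq where "reduced_word (pp @ s # t # qq)" "word (pp @ s # t # qq) = word (p @ c # t1 # t2 # q)"
    "(s, t) \<in> corner_pairs k" "wd (word (pp @ [s])) (word (p @ [c, t1])) \<le> 1"
proof -
  have ne: "c \<noteq> t1" "t1 \<noteq> t2" using red reduced_word_twice[of p c "t2 # q"] reduced_word_twice[of "p @ [c]" t1 q] by auto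
  have C: "c_letters k \<subseteq> letters k" by (simp add: letters_eq)
  consider "\<not> adj c t1" | "adj c t1" "\<not> adj c t2" | "adj c t1" "adj c t2" by blast
  then show thesis
  proof cases
    case 1
    moreover have "wd (word (p @ [c])) (word (p @ [c, t1])) \<le> 1"
      using wd_gen[of "word (p @ [c])" t1] word_append[of "p @ [c]" "[t1]"] by simp
    ultimately show ?thesis using that[of p c t1 "t2 # q"] red c lt C ne by (auto simp: corner_pairs_def)
  next
    case 2
    then have comm: "gen c + gen t1 = gen t1 + gen c" by (rule_tac gen_commute)
    have "word [t1, c] = word [c, t1]"
      using comm word_append[of "[t1]" "[c]"] word_append[of "[c]" "[t1]"] by simp
    then have eq: "word (p @ [t1, c] @ r) = word (p @ [c, t1] @ r)" for r by (simp only: word_append)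
    from eq[of "t2 # q"] have eq': "word ((p @ [t1]) @ c # t2 # q) = word (p @ c # t1 # t2 # q)" by simp
    then have red': "reduced_word ((p @ [t1]) @ c # t2 # q)" using red by (simp add: reduced_word_def)
    then have "c \<noteq> t2" using reduced_word_twice[of "p @ [t1]" c q] by auto
    moreover have "word ((p @ [t1]) @ [c]) = word (p @ [c, t1])" using eq[of "[]"] by simp
    ultimately show ?thesis using that[of "p @ [t1]" c t2 q] red' eq' 2 c C lt by (simp add: corner_pairs_def)
  next
    case 3
    then have "t1 \<in> lk c" "t2 \<in> lk c" by (auto simp: lk_def)
    then have "\<not> adj t1 t2" "t1 \<in> c_letters k \<or> t2 \<in> c_letters k"
      using c_indep[OF k c] c ne by (auto simp: c_letters_def lk_c simp del: One_nat_def)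
    then show ?thesis using that[of "p @ [c]" t1 t2 q] red lt ne by (simp add: corner_pairs_def)
  qed
qed

context coarse_model
begin

text \<open>The consequence of the Morse property from which the lower bound in
  \<open>tracked_dichotomy\<close> is derived.\<close>

definition tracked :: "(real \<Rightarrow> 'a) \<Rightarrow> nat \<Rightarrow> bool" where
  "tracked \<gamma> N \<longleftrightarrow> (\<forall>s t us. set us \<subseteq> A \<longrightarrow> reduced_word us \<longrightarrow> \<psi> (\<gamma> s) + word us = \<psi> (\<gamma> t) \<longrightarrow>
     (\<forall>i\<le>length us. \<exists>u. wd (\<psi> (\<gamma> u)) (\<psi> (\<gamma> s) + word (take i us)) \<le> N))"

lemma Morse_tracked:
  assumes g: "geodesic UNIV \<gamma>" and morse: "Morse UNIV \<gamma>"
  obtains N where "tracked \<gamma> N"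
proof -
  note [simp] = geodesicD(1)[OF g]
  \<comment> \<open>Large enough for both estimates on the lifted word: K * (2 * K + 2) + K \<le> L
    from above and 3 * K + 2 \<le> K * L from below.\<close>
  define L :: real where "L = K * (2 * K + 4)"
  have L: "L > 0" using K by (simp add: L_def add_pos_nonneg)
  obtain N0 where N0: "\<And>a b \<sigma>. a \<le> b \<Longrightarrow> quasi_geodesic K L {a..b} \<sigma> \<Longrightarrow> \<sigma> a \<in> range \<gamma> \<Longrightarrow> \<sigma> b \<in> range \<gamma> \<Longrightarrow>
        (\<forall>s\<in>{a..b}. \<exists>t. d (\<sigma> s) (\<gamma> t) < N0)"
    using morse K L unfolding Morse_def by (metis UNIV_I of_nat_1 of_nat_le_iff)
  define N where "N = nat \<lceil>K * N0 + K\<rceil> + K"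
  have "\<exists>u. wd (\<psi> (\<gamma> u)) (\<psi> (\<gamma> s) + word (take i us)) \<le> N"
    if us: "set us \<subseteq> A" "reduced_word us" "\<psi> (\<gamma> s) + word us = \<psi> (\<gamma> t)" and i: "i \<le> length us" for s t us i
  proof (cases "length us = 0")
    case True
    then show ?thesis by (intro exI[of _ s]) simp
  next
    case False
    define n where "n = length us"
    have KK: "real K \<le> real K * real K" using K by simp
    define f where "f j = \<psi> (\<gamma> s) + word (take j us)" for j
    have f_sp: "f j \<in> sp A" for j
    proof -
      have "word (take j us) \<in> sp A" using us(1) by (intro sp_word) (meson in_set_takeD subset_iff)
      then show ?thesis unfolding f_def using \<psi>_sp by (intro sp_add) auto
    qed
    have f_wd: "real (wd (f i) (f j)) = \<bar>real i - real j\<bar>" if "i \<le> n" "j \<le> n" for i j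
      using reduced_word_wd[OF us(2), of i j] reduced_word_wd[OF us(2), of j i] that
      unfolding f_def n_def by (cases "i \<le> j") (auto simp: wd_sym)
    obtain z where z: "\<And>j. z j \<in> M" "\<And>j. wd (\<psi> (z j)) (f j) \<le> K" using \<psi>_onto[OF f_sp] by metis
    \<comment> \<open>A step function through lifts of the vertices, with its ends exactly on
      \<gamma> as the Morse condition requires; quasi-geodesics need not be continuous.\<close>
    define \<sigma> where "\<sigma> \<tau> = (if \<tau> \<le> 0 then \<gamma> s else if \<tau> \<ge> n then \<gamma> t else z (nat \<lfloor>\<tau>\<rfloor>))" for \<tau> :: real
    have f0: "f 0 = \<psi> (\<gamma> s)" and fn: "f n = \<psi> (\<gamma> t)" using us(3) by (simp_all add: f_def n_def)
    have \<sigma>M: "\<sigma> \<tau> \<in> M" for \<tau> using z by (simp add: \<sigma>_def)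
    have \<sigma>_near: "wd (\<psi> (\<sigma> \<tau>)) (f (nat \<lfloor>\<tau>\<rfloor>)) \<le> K" if "\<tau> \<in> {0..real n}" for \<tau>
      using that z f0 fn by (auto simp: \<sigma>_def)
    have fl: "nat \<lfloor>\<tau>\<rfloor> \<le> n" "\<bar>real (nat \<lfloor>\<tau>\<rfloor>) - \<tau>\<bar> \<le> 1" if "\<tau> \<in> {0..real n}" for \<tau>
      using that by (simp_all add: le_nat_floor nat_le_iff floor_le_iff) linarith+
    have "quasi_geodesic K L {0..real n} \<sigma>"
      unfolding quasi_geodesic_def
    proof (intro conjI ballI)
      show "is_interval {0..real n}" by (rule is_interval_cc)
      show "\<sigma> \<in> {0..real n} \<rightarrow> M" using \<sigma>M by simp
      fix \<tau> \<tau>' assume t: "\<tau> \<in> {0..real n}" "\<tau>' \<in> {0..real n}"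
      let ?i = "nat \<lfloor>\<tau>\<rfloor>" and ?j = "nat \<lfloor>\<tau>'\<rfloor>" and ?w = "real (wd (\<psi> (\<sigma> \<tau>)) (\<psi> (\<sigma> \<tau>')))"
      have "wd (f ?i) (f ?j) \<le> wd (\<psi> (\<sigma> \<tau>)) (\<psi> (\<sigma> \<tau>')) + 2 * K"
        using wd_triangle[of "f ?i" "f ?j" "\<psi> (\<sigma> \<tau>)"] wd_triangle[of "\<psi> (\<sigma> \<tau>)" "f ?j" "\<psi> (\<sigma> \<tau>')"]
          \<sigma>_near[OF t(1)] \<sigma>_near[OF t(2)] by (simp add: wd_sym[of "f ?i"])
      moreover have "wd (\<psi> (\<sigma> \<tau>)) (\<psi> (\<sigma> \<tau>')) \<le> wd (f ?i) (f ?j) + 2 * K"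
        using wd_triangle[of "\<psi> (\<sigma> \<tau>)" "\<psi> (\<sigma> \<tau>')" "f ?i"] wd_triangle[of "f ?i" "\<psi> (\<sigma> \<tau>')" "f ?j"]
          \<sigma>_near[OF t(1)] \<sigma>_near[OF t(2)] by (simp add: wd_sym[of "f ?j"])
      ultimately have "\<bar>?w - \<bar>real ?i - real ?j\<bar>\<bar> \<le> 2 * K"
        unfolding f_wd[OF fl(1)[OF t(1)] fl(1)[OF t(2)], symmetric] by linarith
      moreover have "\<bar>\<bar>real ?i - real ?j\<bar> - \<bar>\<tau> - \<tau>'\<bar>\<bar> \<le> 2"
      proof -
        have "\<bar>(real ?i - real ?j) - (\<tau> - \<tau>')\<bar> \<le> \<bar>real ?i - \<tau>\<bar> + \<bar>real ?j - \<tau>'\<bar>" by linarith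
        then show ?thesis
          using fl(2)[OF t(1)] fl(2)[OF t(2)] abs_triangle_ineq3[of "real ?i - real ?j" "\<tau> - \<tau>'"] by linarith
      qed
      moreover have "\<bar>a - b\<bar> \<le> c \<Longrightarrow> \<bar>b - b'\<bar> \<le> 2 \<Longrightarrow> \<bar>a - b'\<bar> \<le> c + 2" for a b b' c :: real by linarith
      ultimately have w: "\<bar>?w - \<bar>\<tau> - \<tau>'\<bar>\<bar> \<le> 2 * K + 2" by (simp only: of_nat_add of_nat_numeral)
      have "d (\<sigma> \<tau>) (\<sigma> \<tau>') \<le> K * ?w + K" using \<psi>_lower \<sigma>M by blast
      also have "\<dots> \<le> K * (\<bar>\<tau> - \<tau>'\<bar> + (2 * K + 2)) + K"
      proof (intro add_right_mono mult_left_mono)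
        show "?w \<le> \<bar>\<tau> - \<tau>'\<bar> + (2 * K + 2)" using w by (simp only: abs_le_iff) linarith
      qed simp
      finally show "d (\<sigma> \<tau>) (\<sigma> \<tau>') \<le> K * \<bar>\<tau> - \<tau>'\<bar> + L"
        by (simp add: L_def algebra_simps)
      have "?w \<le> K * d (\<sigma> \<tau>) (\<sigma> \<tau>') + K" using \<psi>_upper \<sigma>M by blast
      moreover have "3 * real K + 2 \<le> K * L"
      proof -
        have "real K \<ge> 1" using K by simp
        moreover have "L = 2 * (real K * real K) + 4 * real K" by (simp add: L_def algebra_simps)
        ultimately have "3 * real K + 2 \<le> 1 * L" using KK by linarith
        also have "\<dots> \<le> K * L" using K L by (intro mult_right_mono) auto
        finally show ?thesis .
      qed
      ultimately have "\<bar>\<tau> - \<tau>'\<bar> \<le> K * (d (\<sigma> \<tau>) (\<sigma> \<tau>') + L)"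
        using w by (simp add: distrib_left)
      then show "1 / K * \<bar>\<tau> - \<tau>'\<bar> - L \<le> d (\<sigma> \<tau>) (\<sigma> \<tau>')" using K by (simp add: field_simps)
    qed
    moreover have "\<sigma> 0 \<in> range \<gamma>" "\<sigma> (real n) \<in> range \<gamma>" using False by (auto simp: \<sigma>_def n_def)
    moreover have "real i \<in> {0..real n}" using i by (simp add: n_def)
    ultimately have "real i \<in> {0..real n}" "\<forall>s\<in>{0..real n}. \<exists>t. d (\<sigma> s) (\<gamma> t) < N0" using N0[of 0 "real n" \<sigma>] by simp_all
    then obtain u where u: "d (\<sigma> (real i)) (\<gamma> u) < N0" by blast
    have "real (wd (\<psi> (\<sigma> (real i))) (\<psi> (\<gamma> u))) \<le> K * d (\<sigma> (real i)) (\<gamma> u) + K" using \<psi>_upper \<sigma>M by simp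
    also have "\<dots> \<le> K * N0 + K" using u by (intro add_right_mono mult_left_mono) auto
    finally have "wd (\<psi> (\<sigma> (real i))) (\<psi> (\<gamma> u)) \<le> nat \<lceil>K * N0 + K\<rceil>" by linarith
    then have "wd (\<psi> (\<gamma> u)) (f i) \<le> N"
      using wd_triangle[of "\<psi> (\<gamma> u)" "f i" "\<psi> (\<sigma> (real i))"] \<sigma>_near[of "real i"] i
      by (simp add: N_def n_def wd_sym[of "\<psi> (\<gamma> u)"])
    then show ?thesis by (auto simp: f_def)
  qed
  then show thesis using that[of N] unfolding tracked_def by blast
qed

end

context omega_model
begin

text \<open>Without runs, every piece of the tracked word of a certain length contains c_1 or c_2,
  so there is a corner pair close to \<gamma> t. A path around the ball has to turn this single
  corner, whose exponent is arbitrary.\<close>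

theorem tracked_dichotomy:
  assumes g: "geodesic UNIV \<gamma>" and tracked: "tracked \<gamma> N"
    and no_runs: "\<not> runs_along (Gam k) \<gamma> N"
  shows "fun_preceq (power_fun e) (lower_divergence \<gamma>)"
proof -
  note [simp] = geodesicD(1)[OF g]
  \<comment> \<open>A length that no run has: a subword of length n0 of a tracked word contains a
    letter outside \<open>Gam k\<close>.\<close>
  obtain n0 where n0: "\<And>s t x y. x \<in> sp (letters k) \<Longrightarrow> wd (\<psi> (\<gamma> s)) x \<le> N \<Longrightarrow> wd (\<psi> (\<gamma> t)) y \<le> N \<Longrightarrow>
     - x + y \<in> sp (Gam k) \<Longrightarrow> wd x y \<noteq> n0"
    using no_runs unfolding runs_along_def by metis
  obtain c where c: "c > 0" "\<And>s t. (s, t) \<in> corner_pairs k \<Longrightarrow> corner c e s t"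
    using corner_pairs_cost[OF k] by blast
  define J :: nat where "J = K * (2 * N + 1) + K"
  define N1 :: nat where "N1 = N + K * J + K"
  define N2 :: nat where "N2 = N1 + n0 + 3"
  \<comment> \<open>D gives r / K \<ge> 2 * (N2 + 3 * K + 1), so that at least half of r / K
    survives as the radius R' about the corner.\<close>
  define D :: real where "D = 2 * K * (real N2 + 3 * K + 1)"
  define A0 :: real where "A0 = (2 * K) ^ e * (4 * K) / c"
  have K1: "real K \<ge> 1" using K by simp
  show ?thesis
  proof (rule lower_divergence_geI)
    show "A0 > 0" "D > 0" using K c by (auto simp: A0_def D_def intro!: mult_pos_pos add_nonneg_pos)
    fix r t l and p :: "real \<Rightarrow> 'a"
    assume r: "r > D" and p: "pathin mtopology p" "p 0 = \<gamma> (t - r)" "p 1 = \<gamma> (t + r)"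
      "p ` {0..1} \<inter> mball (\<gamma> t) r = {}" and l: "0 \<le> l" "path_length p \<le> ennreal l"
    have r0: "r > 0" using r \<open>D > 0\<close> by simp
    have rK: "r / K \<ge> 2 * (real N2 + 3 * K + 1)"
      using r K1 by (simp add: D_def field_simps)
    obtain n where n: "reach {w. r / K \<le> real (wd (\<psi> (\<gamma> t)) w) + 3 * K} n (\<psi> (\<gamma> (t - r))) (\<psi> (\<gamma> (t + r)))"
      "real n \<le> (2 + 2 * l) * (2 * K)"
      using path_to_reach[OF p(1) l(2,1) _ p(4)] p(2,3) by auto
    define b where "b = \<psi> (\<gamma> (t - r))"
    have "- b + \<psi> (\<gamma> (t + r)) \<in> sp (letters k)" using \<psi>_sp by (simp add: b_def sp_add sp_uminus)
    then obtain us where us: "- b + \<psi> (\<gamma> (t + r)) = word us" "set us \<subseteq> letters k" "length us = len (- b + \<psi> (\<gamma> (t + r)))"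
      by (rule sp_geodesic_word)
    have red: "reduced_word us" using us by (simp add: reduced_word_def)
    have end_us: "b + word us = \<psi> (\<gamma> (t + r))" by (simp flip: us(1) add.assoc)
    define m where "m = length us"
    define f where "f i = b + word (take i us)" for i
    have f_sp: "f i \<in> sp (letters k)" for i
    proof -
      have "word (take i us) \<in> sp (letters k)" using us(2) by (intro sp_word) (meson in_set_takeD subset_iff)
      then show ?thesis unfolding f_def b_def using \<psi>_sp by (intro sp_add) auto
    qed
    have near: "\<exists>u. wd (\<psi> (\<gamma> u)) (f i) \<le> N" if "i \<le> m" for i
      using tracked us(2) red end_us that unfolding tracked_def f_def b_def m_def by blast
    have f0: "f 0 = \<psi> (\<gamma> (t - r))" and fm: "f m = \<psi> (\<gamma> (t + r))" using end_us by (simp_all add: f_def m_def b_def)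
    have f_wd: "wd (f i) (f j) = j - i" if "i \<le> j" "j \<le> m" for i j
      unfolding f_def using reduced_word_wd[OF red] that by (simp add: m_def)
    obtain u0 where u0: "\<And>i. i \<le> m \<Longrightarrow> wd (\<psi> (\<gamma> (u0 i))) (f i) \<le> N" using near by metis
    \<comment> \<open>The ends get their true parameters, so that the intermediate value argument
      finds a vertex with parameter near t.\<close>
    define u where "u i = (if i = 0 then t - r else if i = m then t + r else u0 i)" for i
    have u: "wd (\<psi> (\<gamma> (u i))) (f i) \<le> N" if "i \<le> m" for i using that u0 f0 fm by (simp add: u_def)
    have dist_r: "(r - K) / K \<le> real (wd (\<psi> (\<gamma> t)) (\<psi> (\<gamma> (t - r))))" "(r - K) / K \<le> real (wd (\<psi> (\<gamma> t)) (\<psi> (\<gamma> (t + r))))"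
      using \<psi>_lower[of "\<gamma> t" "\<gamma> (t - r)"] \<psi>_lower[of "\<gamma> t" "\<gamma> (t + r)"] geodesicD(2)[OF g] r0 K1
      by (simp_all add: field_simps)
    have m0: "m \<noteq> 0"
    proof
      assume "m = 0"
      then have "\<psi> (\<gamma> (t - r)) = \<psi> (\<gamma> (t + r))" using f0 fm by simp
      then have "2 * r \<le> K" using \<psi>_lower[of "\<gamma> (t - r)" "\<gamma> (t + r)"] geodesicD(2)[OF g] r0 by simp
      then have "r / K \<le> 1" using r0 K1 by (simp add: field_simps)
      from order_trans[OF rK this] show False by simp
    qed
    obtain i where i: "i \<le> m" "\<bar>u i - t\<bar> \<le> J"
    proof (rule discrete_ivt[of m u J t])
      fix i assume i: "i < m"
      have "wd (\<psi> (\<gamma> (u (Suc i)))) (\<psi> (\<gamma> (u i))) \<le> 2 * N + 1"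
        using wd_triangle[of "\<psi> (\<gamma> (u (Suc i)))" "\<psi> (\<gamma> (u i))" "f (Suc i)"] wd_triangle[of "f (Suc i)" "\<psi> (\<gamma> (u i))" "f i"]
          u[of i] u[of "Suc i"] f_wd[of i "Suc i"] i wd_sym[of "f (Suc i)" "f i"] wd_sym[of "f i" "\<psi> (\<gamma> (u i))"] by simp
      then have "real K * real (wd (\<psi> (\<gamma> (u (Suc i)))) (\<psi> (\<gamma> (u i)))) \<le> real K * real (2 * N + 1)"
        by (intro mult_left_mono) (simp_all only: of_nat_le_iff of_nat_0_le_iff)
      then show "\<bar>u (Suc i) - u i\<bar> \<le> J"
        using \<psi>_lower[of "\<gamma> (u (Suc i))" "\<gamma> (u i)"] geodesicD(2)[OF g] by (simp add: J_def algebra_simps)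
    qed (use m0 r0 in \<open>simp_all add: u_def\<close>)
    have fi: "wd (\<psi> (\<gamma> t)) (f i) \<le> N1"
    proof -
      have "real K * \<bar>t - u i\<bar> \<le> real K * J" using i(2) by (intro mult_left_mono) auto
      then have "real (wd (\<psi> (\<gamma> t)) (\<psi> (\<gamma> (u i)))) \<le> real (K * J + K)"
        using \<psi>_upper[of "\<gamma> t" "\<gamma> (u i)"] geodesicD(2)[OF g] by simp
      then show ?thesis using wd_triangle[of "\<psi> (\<gamma> t)" "f i" "\<psi> (\<gamma> (u i))"] u[OF i(1)]
        unfolding of_nat_le_iff by (simp add: N1_def)
    qed
    \<comment> \<open>Room for a \<open>c\<close> letter within n0 steps and for the two letters
      after it that \<open>corner_near_c\<close> inspects.\<close>
    have "n0 + 3 \<le> m - i"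
    proof -
      have "wd (\<psi> (\<gamma> t)) (f m) \<le> N1 + (m - i)"
        using wd_triangle[of "\<psi> (\<gamma> t)" "f m" "f i"] fi f_wd[of i m] i(1) by simp
      then have "(r - K) / K \<le> real (N1 + (m - i))" using dist_r(2) fm by (smt (verit) of_nat_le_iff)
      then have "r / K - 1 \<le> real (N1 + (m - i))" using K1 by (simp add: diff_divide_distrib)
      then have "real (N2 + 3 * K + 1) \<le> real (N1 + (m - i))" using rK by simp
      then show ?thesis unfolding of_nat_le_iff N2_def by simp
    qed
    obtain j where j: "i \<le> j" "j < i + n0" "us ! j \<in> c_letters k"
    proof -
      have "\<not> set (drop i (take (i + n0) us)) \<subseteq> Gam k"
      proof
        assume "set (drop i (take (i + n0) us)) \<subseteq> Gam k"
        moreover have "take (i + n0) us = take i us @ drop i (take (i + n0) us)"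
          by (metis append_take_drop_id min.absorb1 take_take le_add1)
        ultimately have "- f i + f (i + n0) \<in> sp (Gam k)"
        proof -
          have "f (i + n0) = f i + word (drop i (take (i + n0) us))"
            unfolding f_def by (metis \<open>take (i + n0) us = _\<close> word_append add.assoc)
          then show ?thesis using \<open>set (drop i _) \<subseteq> _\<close> by (simp add: sp_word flip: add.assoc)
        qed
        moreover have "wd (f i) (f (i + n0)) = n0" using f_wd[of i "i + n0"] \<open>n0 + 3 \<le> m - i\<close> i(1) by simp
        ultimately show False
          using n0[OF f_sp u[OF i(1)] u[of "i + n0"]] \<open>n0 + 3 \<le> m - i\<close> by simp
      qed
      then obtain s where "s \<in> set (drop i (take (i + n0) us))" "s \<notin> Gam k" by blast
      moreover from this(1) obtain j' where "j' < length (drop i (take (i + n0) us))" "s = drop i (take (i + n0) us) ! j'"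
        by (metis in_set_conv_nth)
      ultimately have j': "s = us ! (i + j')" "i + j' < length us" "j' < n0" by auto
      then have "us ! (i + j') \<in> letters k" using us(2) nth_mem by blast
      then have "us ! (i + j') \<in> c_letters k" using j' \<open>s \<notin> Gam k\<close> by (auto simp: letters_eq)
      then show thesis using that[of "i + j'"] j' by simp
    qed
    have jm: "j + 2 < length us" using j \<open>n0 + 3 \<le> m - i\<close> by (simp add: m_def)
    define P where "P = take j us"
    define R where "R = drop (j + 3) us"
    have split: "us = P @ us ! j # us ! (j + 1) # us ! (j + 2) # R"
      unfolding P_def R_def using jm
      by (metis (no_types, lifting) Cons_nth_drop_Suc Suc_eq_plus1 Suc_lessD add_2_eq_Suc' add_Suc_right append_take_drop_id numeral_2_eq_2 numeral_3_eq_3 add.right_neutral)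
    obtain pp s t' qq where cn: "reduced_word (pp @ s # t' # qq)" "word (pp @ s # t' # qq) = word us"
      "(s, t') \<in> corner_pairs k" "wd (word (pp @ [s])) (word (P @ [us ! j, us ! (j + 1)])) \<le> 1"
      using corner_near_c[OF k, of P "us ! j" "us ! (j + 1)" "us ! (j + 2)" R] red us(2) j(3) split by metis
    define uu where "uu i = [s, t'] ! i" for i
    define v where "v i = (b + word pp) + word (take i [s, t'])" for i
    \<comment> \<open>Two walls, hence one corner, suffice: all of the growth comes from the
      exponent.\<close>
    have chain: "wall_chain uu v 2"
      using wall_chain_word[of "[s, t']" "b + word pp"] cn(3) unfolding uu_def v_def corner_pairs_def
      by (simp add: nth_Cons numeral_2_eq_2)
    obtain x where x: "edge_path x n" "x 0 = b" "x n = \<psi> (\<gamma> (t + r))"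
      "\<And>i. i \<le> n \<Longrightarrow> r / K \<le> real (wd (\<psi> (\<gamma> t)) (x i)) + 3 * K"
      using n(1) unfolding reach_def b_def by auto
    have v1: "wd (\<psi> (\<gamma> t)) (v 1) \<le> N2"
    proof -
      have "P @ [us ! j, us ! (j + 1)] = take (j + 2) us" using jm by (simp add: P_def take_Suc_conv_app_nth)
      then have "wd (v 1) (f (j + 2)) \<le> 1"
        using cn(4) by (simp add: v_def f_def add.assoc word_append[of pp])
      moreover have "wd (f i) (f (j + 2)) \<le> n0 + 2" using f_wd[of i "j + 2"] j jm by (simp add: m_def)
      ultimately show ?thesis
        using wd_triangle[of "\<psi> (\<gamma> t)" "v 1" "f i"] wd_triangle[of "f i" "v 1" "f (j + 2)"] fi
          wd_sym[of "v 1" "f (j + 2)"] by (simp add: N2_def)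
    qed
    \<comment> \<open>The path stays r / K - 3 * K away from the image of \<gamma> t, and the corner
      \<open>v 1\<close> is within N2 of that image.\<close>
    define R' where "R' = nat \<lfloor>r / K - 3 * K - N2\<rfloor>"
    have R'_le: "real R' \<le> r / K - 3 * K - N2" using rK by (simp add: R'_def)
    have R'_ge: "r / (2 * K) \<le> real R'"
    proof -
      have "r / K - 3 * K - N2 - 1 \<le> real R'" unfolding R'_def by linarith
      moreover have "x - a - b - 1 \<le> y \<Longrightarrow> 2 * (b + a + 1) \<le> x \<Longrightarrow> x / 2 \<le> y" for x a b y :: real by simp
      ultimately have "(r / K) / 2 \<le> real R'" using rK by blast
      then show ?thesis by (simp add: mult.commute)
    qed
    have "real (2 - 1) * (c * real R' ^ e) \<le> real n"
    proof (rule chain_cost[OF chain _ x(1)])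
      have red1: "\<not> far s (- word pp)" using reduced_word_far(2)[OF cn(1)] .
      then show "x 0 \<notin> beyond uu v 0" unfolding x(2) by (simp add: beyond_def uu_def v_def minus_add add.assoc diff_conv_add_uminus del: add_uminus_conv_diff)
      have "far t' (- word (pp @ [s]) + word ((pp @ [s]) @ t' # qq))"
        using reduced_word_far(1)[of "pp @ [s]" t' qq] cn(1) by simp
      moreover have "- v 1 + x n = - word (pp @ [s]) + word ((pp @ [s]) @ t' # qq)"
      proof -
        have "x n = b + word ((pp @ [s]) @ t' # qq)" using x(3) end_us cn(2) by simp
        moreover have "v 1 = b + word (pp @ [s])" by (simp add: v_def word_append add.assoc)
        ultimately show ?thesis by (simp add: minus_add diff_conv_add_uminus add.assoc del: add_uminus_conv_diff)
      qed
      ultimately show "x n \<in> beyond uu v (2 - 1)" by (simp add: beyond_def uu_def)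
      show "corner c e (uu i) (uu (Suc i))" if "Suc i < 2" for i using that c(2)[OF cn(3)] by (simp add: uu_def)
      show "R' \<le> wd (v (Suc i)) (x j)" if "Suc i < 2" "j \<le> n" for i j
      proof -
        have i: "i = 0" using that by simp
        have "real (wd (\<psi> (\<gamma> t)) (x j)) \<le> N2 + real (wd (v 1) (x j))"
          using wd_triangle[of "\<psi> (\<gamma> t)" "x j" "v 1"] v1 by linarith
        then have "real R' \<le> real (wd (v 1) (x j))" using x(4)[OF that(2)] R'_le by linarith
        then show ?thesis using i by simp
      qed
    qed simp
    then have "c * real R' ^ e \<le> (2 + 2 * l) * (2 * K)" using n(2) by simp
    moreover have "c * (r / (2 * K)) ^ e \<le> c * real R' ^ e"
      using R'_ge r0 c by (intro mult_left_mono power_mono) auto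
    ultimately have "c * (r / (2 * K)) ^ e \<le> 4 * K * (l + 1)" by (simp add: algebra_simps)
    then show "r ^ e \<le> A0 * (l + 1)"
      using c K1 by (simp add: A0_def power_divide power_mult_distrib field_simps)
  qed
qed

end

section \<open>Morse lines\<close>

lemma alt_snoc: "alt p q (Suc n) = alt p q n @ [if even n then p else q]"
proof (induction n arbitrary: p q)
  case (Suc n)
  have "alt p q (Suc (Suc n)) = p # alt q p (Suc n)" by simp
  also have "\<dots> = p # alt q p n @ [if even n then q else p]" unfolding Suc ..
  finally show ?case by simp
qed simp

definition line_letter :: "'v \<Rightarrow> 'v \<Rightarrow> int \<Rightarrow> 'v" where
  "line_letter p q i = (if even i then p else q)"

text \<open>The vertices of a bi-infinite alternating word; \<open>line_letter\<close> labels the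
  edge from i to i + 1.\<close>

definition line :: "'v::simple_graph \<Rightarrow> 'v \<Rightarrow> int \<Rightarrow> 'v rac" where
  "line p q i = (if 0 \<le> i then word (alt p q (nat i)) else word (alt q p (nat (- i))))"

lemma line_0 [simp]: "line p q 0 = 0" by (simp add: line_def)

lemma line_next: "line p q (i + 1) = line p q i + gen (line_letter p q i)"
proof (cases "0 \<le> i")
  case True
  then have "nat (i + 1) = Suc (nat i)" "even (nat i) = even i" by (auto simp: even_nat_iff)
  then show ?thesis using True alt_snoc[of p q "nat i"] by (simp add: line_def line_letter_def word_append)
next
  case False
  define n where "n = nat (- i - 1)"
  have i: "i = - int n - 1" "nat (- i) = Suc n" using False by (auto simp: n_def)
  have "line p q i = word (alt q p n) + gen (line_letter p q i)"
    using False i alt_snoc[of q p n] by (simp add: line_def line_letter_def word_append)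
  moreover have "line p q (i + 1) = word (alt q p n)"
  proof (cases "n = 0")
    case False
    have "i + 1 = - int n" using i by simp
    then show ?thesis using False by (simp add: line_def)
  qed (use i in simp)
  ultimately show ?thesis by (simp add: add.assoc)
qed

lemma line_Suc: "line p q (l + int (Suc i)) = line p q (l + int i) + gen (line_letter p q (l + int i))"
  using line_next[of p q "l + int i"] by (simp add: ac_simps)

lemma line_sp: "p \<in> A \<Longrightarrow> q \<in> A \<Longrightarrow> line p q i \<in> sp A"
  by (simp add: line_def alt_sp)

definition line_beyond :: "'v::simple_graph \<Rightarrow> 'v \<Rightarrow> int \<Rightarrow> 'v rac set" where
  "line_beyond p q l = {x. far (line_letter p q l) (- line p q l + x)}"

context
  fixes p q :: "'v::simple_graph"
  assumes pq: "p \<noteq> q" "\<not> adj p q"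
begin

lemma line_chain: "wall_chain (\<lambda>i. line_letter p q (l + int i)) (\<lambda>i. line p q (l + int i)) m"
  unfolding wall_chain_def line_Suc using pq adj_sym[of q p] by (auto simp: line_letter_def)

lemma line_beyond_eq:
  "beyond (\<lambda>i. line_letter p q (l + int i)) (\<lambda>i. line p q (l + int i)) i = line_beyond p q (l + int i)"
  by (simp add: beyond_def line_beyond_def)

lemma line_not_beyond: assumes "i \<le> l" "int (wd (line p q i) x) < l + 1 - i" shows "x \<notin> line_beyond p q l"
proof
  assume "x \<in> line_beyond p q l"
  define m where "m = nat (l + 1 - i)"
  have m: "i + int (m - 1) = l" using assms(1) by (simp add: m_def)
  have "m \<le> wd (line p q i) x"
    using chain_wd[OF line_chain[of i m], unfolded line_beyond_eq, of "line p q i" x]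
      chain_start[of "\<lambda>j. line p q (i + int j)" "\<lambda>j. line_letter p q (i + int j)", unfolded line_beyond_eq]
      \<open>x \<in> line_beyond p q l\<close> m by simp
  then show False using assms by (simp add: m_def)
qed

lemma line_beyondI: assumes "l < i" "int (wd (line p q i) x) < i - l" shows "x \<in> line_beyond p q l"
proof (rule ccontr)
  assume "x \<notin> line_beyond p q l"
  define m where "m = nat (i - l)"
  have m: "l + int m = i" "0 < m" using assms(1) by (simp_all add: m_def)
  have "line p q i \<in> line_beyond p q (l + int (m - 1))"
    using chain_end[OF line_chain[of l m] m(2), unfolded line_beyond_eq, of 0 "{}"] m by simp
  then have "m \<le> wd x (line p q i)"
    using chain_wd[OF line_chain[of l m], unfolded line_beyond_eq, of x "line p q i"] \<open>x \<notin> line_beyond p q l\<close> by simp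
  then show False using assms m by (simp add: wd_sym[of x])
qed

lemma line_wd: "wd (line p q i) (line p q j) = nat \<bar>i - j\<bar>"
proof -
  have "wd (line p q i) (line p q (i + int n)) = n" for i n
  proof (rule antisym)
    show "wd (line p q i) (line p q (i + int n)) \<le> n"
    proof (induction n)
      case (Suc n)
      have "wd (line p q (i + int n)) (line p q (i + int (Suc n))) \<le> 1"
        unfolding line_Suc by (rule wd_gen)
      then show ?case using Suc wd_triangle[of "line p q i" "line p q (i + int (Suc n))" "line p q (i + int n)"] by linarith
    qed simp
    show "n \<le> wd (line p q i) (line p q (i + int n))"
    proof (rule ccontr)
      assume *: "\<not> ?thesis"
      then have "line p q (i + int n) \<notin> line_beyond p q (i + int n - 1)" by (intro line_not_beyond[of i]) auto
      moreover have "line p q (i + int n) \<in> line_beyond p q (i + int n - 1)" by (rule line_beyondI[of _ "i + int n"]) auto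
      ultimately show False by blast
    qed
  qed
  from this[of i "nat (j - i)"] this[of j "nat (i - j)"] show ?thesis
    by (cases "i \<le> j") (auto simp: wd_sym)
qed

lemma line_cost:
  assumes corners: "corner c e p q" "corner c e q p"
    and x: "edge_path x n" "x 0 \<notin> line_beyond p q l" "x n \<in> line_beyond p q (l + int m - 1)" and m: "0 < m"
    and avoid: "\<And>i j. i < m \<Longrightarrow> j \<le> n \<Longrightarrow> R \<le> wd (line p q (l + int i)) (x j)"
  shows "real (m - 1) * (c * real R ^ e) \<le> real n"
proof (rule chain_cost[OF line_chain[of l m] m x(1), unfolded line_beyond_eq])
  have "l + int (m - 1) = l + int m - 1" using m by simp
  then show "x n \<in> line_beyond p q (l + int (m - 1))" using x(3) by (simp only:)
  show "corner c e (line_letter p q (l + int i)) (line_letter p q (l + int (Suc i)))" for i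
    using corners by (auto simp: line_letter_def)
  show "R \<le> wd (line p q (l + int (Suc i))) (x j)" if "Suc i < m" "j \<le> n" for i j
    using avoid[OF that] .
qed (use x(2) in auto)

text \<open>An excursion of a quasi-geodesic away from the line must cross all walls in between far from
  the line, which costs more than it gains.\<close>

lemma line_Morse:
  assumes corners: "corner c e p q" "corner c e q p" and c: "c > 0" and e: "1 \<le> e"
  shows "\<exists>N. \<forall>n \<sigma> i0 j0. (\<forall>i\<le>n. \<forall>j\<le>n. real i - real j \<le> K * real (wd (\<sigma> i) (\<sigma> j)) + K) \<longrightarrow>
      (\<forall>i<n. wd (\<sigma> i) (\<sigma> (Suc i)) \<le> K) \<longrightarrow> wd (line p q i0) (\<sigma> 0) \<le> K \<longrightarrow> wd (line p q j0) (\<sigma> n) \<le> K \<longrightarrow>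
      (\<forall>i\<le>n. \<exists>l. wd (line p q l) (\<sigma> i) \<le> N)"
proof -
  \<comment> \<open>At distance S from the line a corner costs at least 2 * K * K edges, twice what
    a quasi-geodesic can afford per step along the line.\<close>
  define S where "S = nat \<lceil>2 * real K * real K / c\<rceil> + 1"
  have S: "1 \<le> S" "2 * real K * real K \<le> c * real S"
  proof -
    have "2 * real K * real K / c \<le> real S" unfolding S_def by linarith
    then show "2 * real K * real K \<le> c * real S" using c by (simp add: field_simps)
  qed (simp add: S_def)
  \<comment> \<open>Filling the gaps of \<sigma> loses K, and the first and last step of an
    excursion lose another K; S is left.\<close>
  define R where "R = S + 2 * K"
  define T where "T = K * (8 * R + 5) + K"
  define N where "N = R + K * T"
  have "\<exists>l. wd (line p q l) (\<sigma> i) \<le> N"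
    if lower: "\<And>i j. i \<le> n \<Longrightarrow> j \<le> n \<Longrightarrow> real i - real j \<le> K * real (wd (\<sigma> i) (\<sigma> j)) + K"
      and step: "\<And>i. i < n \<Longrightarrow> wd (\<sigma> i) (\<sigma> (Suc i)) \<le> K"
      and ends: "wd (line p q i0) (\<sigma> 0) \<le> K" "wd (line p q j0) (\<sigma> n) \<le> K" and i: "i \<le> n" for n \<sigma> i0 j0 i
  proof (cases "\<exists>l. wd (line p q l) (\<sigma> i) \<le> R")
    case True
    then show ?thesis unfolding N_def using trans_le_add1 by blast
  next
    case far: False
    define near where "near w \<longleftrightarrow> (\<exists>l. wd (line p q l) w \<le> R)" for w
    have KR: "K \<le> R" by (simp add: R_def)
    have near0: "near (\<sigma> 0)" "near (\<sigma> n)" unfolding near_def using ends KR by (meson order_trans)+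
    \<comment> \<open>The excursion around \<open>i\<close>: \<open>u\<close> is the last time
      before it and \<open>v\<close> the first time after it at distance at most R from the
      line.\<close>
    have "\<exists>u\<le>i. near (\<sigma> u) \<and> (\<forall>t. u < t \<longrightarrow> t \<le> i \<longrightarrow> \<not> near (\<sigma> t))"
    proof (intro exI conjI allI impI)
      let ?u = "GREATEST u. u \<le> i \<and> near (\<sigma> u)"
      have *: "?u \<le> i \<and> near (\<sigma> ?u)" by (rule GreatestI_nat[of _ 0 i]) (use near0 in auto)
      then show "?u \<le> i" "near (\<sigma> ?u)" by auto
      show "\<not> near (\<sigma> t)" if "?u < t" "t \<le> i" for t
        using that Greatest_le_nat[of "\<lambda>u. u \<le> i \<and> near (\<sigma> u)" t i] by auto
    qed
    then obtain u where u: "u \<le> i" "near (\<sigma> u)" "\<And>t. u < t \<Longrightarrow> t \<le> i \<Longrightarrow> \<not> near (\<sigma> t)" by blast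
    have "\<exists>v\<ge>i. v \<le> n \<and> near (\<sigma> v) \<and> (\<forall>t. i \<le> t \<longrightarrow> t < v \<longrightarrow> \<not> near (\<sigma> t))"
    proof (intro exI conjI allI impI)
      let ?v = "LEAST v. i \<le> v \<and> near (\<sigma> v)"
      have *: "i \<le> ?v \<and> near (\<sigma> ?v)" by (rule LeastI[of _ n]) (use near0 i in auto)
      then show "i \<le> ?v" "near (\<sigma> ?v)" by auto
      show "?v \<le> n" by (rule Least_le) (use near0 i in auto)
      show "\<not> near (\<sigma> t)" if "i \<le> t" "t < ?v" for t
        using that not_less_Least[of t "\<lambda>v. i \<le> v \<and> near (\<sigma> v)"] by auto
    qed
    then obtain v where v: "i \<le> v" "v \<le> n" "near (\<sigma> v)" "\<And>t. i \<le> t \<Longrightarrow> t < v \<Longrightarrow> \<not> near (\<sigma> t)" by blast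
    have out: "\<not> near (\<sigma> t)" if "u < t" "t < v" for t using u(3)[of t] v(4)[of t] that by (cases "t \<le> i") auto
    have "\<not> near (\<sigma> i)" using far by (simp add: near_def)
    then have uv: "u < i" "i < v" using u v by (metis le_neq_implies_less)+
    obtain a b where ab: "wd (line p q a) (\<sigma> u) \<le> R" "wd (line p q b) (\<sigma> v) \<le> R" using u v unfolding near_def by blast
    define D where "D = nat \<bar>a - b\<bar>"
    have uv_wd: "wd (\<sigma> v) (\<sigma> u) \<le> 2 * R + D"
      using wd_triangle[of "\<sigma> v" "\<sigma> u" "line p q b"] wd_triangle[of "line p q b" "\<sigma> u" "line p q a"] ab line_wd[of b a]
      by (simp add: D_def wd_sym[of "\<sigma> v"] abs_minus_commute)
    have len_uv: "real v - real u \<le> K * real (2 * R + D) + K"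
    proof -
      have "real v - real u \<le> K * real (wd (\<sigma> v) (\<sigma> u)) + K" using lower[of v u] v uv by simp
      also have "\<dots> \<le> K * real (2 * R + D) + K" using uv_wd by (intro add_right_mono mult_left_mono) (simp_all only: of_nat_le_iff of_nat_0_le_iff)
      finally show ?thesis .
    qed
    have far_line: "S \<le> wd (line p q l) w" if t: "u \<le> t" "t \<le> v" "wd (\<sigma> t) w \<le> K" for t w l
    proof -
      have "R \<le> wd (line p q l) (\<sigma> t) + K"
      proof -
        consider "u < t \<and> t < v" | "t = u" | "t = v" using t by linarith
        then show ?thesis
        proof cases
          case 1
          then show ?thesis using out[of t] unfolding near_def by (metis le_add1 le_trans linear)
        next
          case 2
          then have "\<not> near (\<sigma> (Suc t))" using uv v by (metis out Suc_lessI le_less_trans less_eq_Suc_le lessI)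
          then have "R \<le> wd (line p q l) (\<sigma> (Suc t))" unfolding near_def by (meson linear)
          then show ?thesis using wd_triangle[of "line p q l" "\<sigma> (Suc t)" "\<sigma> t"] step[of t] 2 uv v by linarith
        next
          case 3
          then obtain t' where t': "t = Suc t'" using uv by (cases t) auto
          then have "\<not> near (\<sigma> t')" using 3 uv v by (intro v(4)) auto
          then have "R \<le> wd (line p q l) (\<sigma> t')" unfolding near_def by (meson linear)
          then show ?thesis using wd_triangle[of "line p q l" "\<sigma> t'" "\<sigma> t"] step[of t'] 3 t' v
              wd_sym[of "\<sigma> t" "\<sigma> t'"] by simp
        qed
      qed
      then show ?thesis using wd_triangle[of "line p q l" "\<sigma> t" w] t(3) by (simp add: R_def wd_sym[of w])
    qed
    define W where "W = {w. \<forall>l. S \<le> wd (line p q l) w}"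
    have path: "reach W ((v - u + 1) * K) (\<sigma> u) (\<sigma> v)"
    proof -
      let ?ys = "map \<sigma> [u..<Suc v]"
      have "successively (\<lambda>x y. wd x y \<le> K) ?ys"
        unfolding successively_conv_nth using step v uv by (auto simp: nth_append simp del: upt_Suc)
      then have "reach {w. \<exists>y\<in>set ?ys. wd y w \<le> K} (length ?ys * K) (hd ?ys) (last ?ys)"
        using uv by (intro list_reach) auto
      moreover have "{w. \<exists>y\<in>set ?ys. wd y w \<le> K} \<subseteq> W" using far_line by (auto simp: W_def)
      moreover have "length ?ys = v - u + 1" using uv by simp
      moreover have "hd ?ys = \<sigma> u"
      proof -
        have "[u..<Suc v] = u # [Suc u..<Suc v]" using uv by (intro upt_conv_Cons) simp
        then show ?thesis by (simp only: list.map list.sel)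
      qed
      moreover have "last ?ys = \<sigma> v" using uv by simp
      ultimately show ?thesis using reach_mono[OF _ order.refl] by fastforce
    qed
    have cost: "real (D - 2 * R - 1) * (c * real S) \<le> (v - u + 1) * K"
    proof -
      have aux: "real (D - 2 * R - 1) * (c * real S) \<le> (v - u + 1) * K"
        if r: "reach W ((v - u + 1) * K) x y" and xy: "wd (line p q a') x \<le> R" "wd (line p q b') y \<le> R" and ab': "D = nat (b' - a')" for x y a' b'
      proof (cases "D \<le> 2 * R + 1")
        case False
        obtain f where f: "edge_path f ((v - u + 1) * K)" "f 0 = x" "f ((v - u + 1) * K) = y" "\<And>j. j \<le> (v - u + 1) * K \<Longrightarrow> f j \<in> W"
          using r unfolding reach_def by blast
        have "real (D - 2 * R - 1) * (c * real S ^ e) \<le> real ((v - u + 1) * K)"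
        proof (rule line_cost[OF corners f(1)])
          show "f 0 \<notin> line_beyond p q (a' + int R)" unfolding f(2) using xy by (intro line_not_beyond[of a']) auto
          show "f ((v - u + 1) * K) \<in> line_beyond p q (a' + int R + int (D - 2 * R) - 1)"
            unfolding f(3) using xy ab' False by (intro line_beyondI[of _ b']) auto
          show "S \<le> wd (line p q (a' + int R + int i)) (f j)" if "j \<le> (v - u + 1) * K" for i j
            using f(4)[OF that] by (simp add: W_def)
        qed (use False in auto)
        moreover have "real (D - 2 * R - 1) * (c * real S) \<le> real (D - 2 * R - 1) * (c * real S ^ e)"
        proof (intro mult_left_mono)
          show "real S \<le> real S ^ e" using S e self_le_power[of "real S" e] by simp
        qed (use c in auto)
        ultimately show ?thesis by simp
      qed simp
      show ?thesis
      proof (cases "a \<le> b")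
        case True
        then show ?thesis using aux[OF path ab] by (simp add: D_def)
      next
        case False
        then show ?thesis using aux[OF reach_sym[OF path] ab(2,1)] by (simp add: D_def)
      qed
    qed
    \<comment> \<open>At least D - 2 * R of the walls between the feet of the excursion are crossed.
      The cost 2 * K * K per corner, against the length bound K * K * (D + 2 * R + 2), bounds
      D.\<close>
    have "D \<le> 6 * R + 4"
    proof (cases "D \<le> 2 * R + 1 \<or> K = 0")
      case True
      then show ?thesis
      proof
        assume "K = 0"
        have "\<sigma> j = \<sigma> u" if "u \<le> j" "j \<le> v" for j
          using that
        proof (induction rule: dec_induct)
          case (step m)
          then show ?case using \<open>\<And>i. i < n \<Longrightarrow> wd (\<sigma> i) (\<sigma> (Suc i)) \<le> K\<close>[of m] \<open>K = 0\<close> v by simp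
        qed simp
        from this[of i] uv have "near (\<sigma> i)" using u by simp
        then show ?thesis using \<open>\<not> near (\<sigma> i)\<close> by blast
      qed simp
    next
      case False
      have "real (D - 2 * R - 1) * (2 * real K * real K) \<le> real (D - 2 * R - 1) * (c * real S)"
        using S by (intro mult_left_mono) auto
      also have "\<dots> \<le> real ((v - u + 1) * K)" using cost by simp
      also have "\<dots> = (real v - real u + 1) * K" 
      proof -
        have "real (v - u) = real v - real u" using uv by simp
        then show ?thesis by (simp only: of_nat_mult of_nat_add of_nat_1)
      qed
      also have "\<dots> \<le> (K * real (2 * R + D) + K + K) * K"
        using len_uv False by (intro mult_right_mono) auto
      also have "\<dots> = (2 * R + D + 2) * (real K * real K)" by (simp add: algebra_simps)
      finally have "(2 * real (D - 2 * R - 1)) * (real K * real K) \<le> (2 * R + D + 2) * (real K * real K)"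
        by (simp add: algebra_simps)
      then have "2 * real (D - 2 * R - 1) \<le> 2 * R + D + 2" using False by (subst (asm) mult_le_cancel_right) auto
      then show ?thesis using False by linarith
    qed
    then have "real K * real (2 * R + D) \<le> real K * real (8 * R + 4)" by (intro mult_left_mono) (simp_all only: of_nat_le_iff of_nat_0_le_iff)
    then have "real v - real u \<le> real T" using len_uv by (simp add: T_def algebra_simps)
    then have "i - u \<le> T" using uv by linarith
    have "wd (\<sigma> u) (\<sigma> j) \<le> K * (j - u)" if "u \<le> j" "j \<le> i" for j
      using that
    proof (induction rule: dec_induct)
      case (step m)
      then have "wd (\<sigma> u) (\<sigma> (Suc m)) \<le> K * (m - u) + K"
        using wd_triangle[of "\<sigma> u" "\<sigma> (Suc m)" "\<sigma> m"] \<open>\<And>i. i < n \<Longrightarrow> wd (\<sigma> i) (\<sigma> (Suc i)) \<le> K\<close>[of m] i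
        by linarith
      also have "K * (m - u) + K = K * (Suc m - u)" using step(1) by (simp add: Suc_diff_le)
      finally show ?case .
    qed simp
    then have "wd (\<sigma> u) (\<sigma> i) \<le> K * (i - u)" using uv(1) by simp
    also have "\<dots> \<le> K * T" using \<open>i - u \<le> T\<close> by (rule mult_le_mono2)
    finally have "wd (\<sigma> u) (\<sigma> i) \<le> K * T" .
    then have "wd (line p q a) (\<sigma> i) \<le> N" using wd_triangle[of "line p q a" "\<sigma> i" "\<sigma> u"] ab(1) by (simp add: N_def)
    then show ?thesis by blast
  qed
  note main = this
  show ?thesis
  proof (intro exI[of _ N] allI impI)
    fix n \<sigma> i0 j0 i
    assume "\<forall>i\<le>n. \<forall>j\<le>n. real i - real j \<le> K * real (wd (\<sigma> i) (\<sigma> j)) + K" "\<forall>i<n. wd (\<sigma> i) (\<sigma> (Suc i)) \<le> K"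
      "wd (line p q i0) (\<sigma> 0) \<le> K" "wd (line p q j0) (\<sigma> n) \<le> K" "i \<le> n"
    then show "\<exists>l. wd (line p q l) (\<sigma> i) \<le> N" by (intro main) auto
  qed
qed

end

section \<open>A Morse geodesic with lower divergence of degree exactly \<open>k\<close>\<close>

abbreviation ax :: "nat \<Rightarrow> int \<Rightarrow> indexed_vertex rac" where "ax k \<equiv> line (va k k) (vb k k)"

lemma ax_pair: "va k k \<noteq> vb k k" "\<not> adj (va k k) (vb k k)"
  using not_adj_pair by (auto simp del: adj_Ix)

lemmas ax_wd = line_wd[OF ax_pair]

lemma ax_Gam: "ax k i \<in> sp (Gam k)"
  by (intro line_sp) auto

context omega_model
begin

text \<open>Finite Hausdorff distance between the image of \<alpha> and the axis.\<close>

definition near_ax :: "(real \<Rightarrow> 'a) \<Rightarrow> nat \<Rightarrow> bool" where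
  "near_ax \<alpha> N \<longleftrightarrow> (\<forall>t. \<exists>u. wd (ax k u) (\<psi> (\<alpha> t)) \<le> N) \<and> (\<forall>l. \<exists>t. wd (ax k l) (\<psi> (\<alpha> t)) \<le> N)"

lemma near_ax_runs:
  assumes "near_ax \<alpha> N" shows "runs_along (Gam k) \<alpha> N"
  unfolding runs_along_def
proof
  fix n
  obtain s t where "wd (ax k 0) (\<psi> (\<alpha> s)) \<le> N" "wd (ax k (int n)) (\<psi> (\<alpha> t)) \<le> N"
    using assms unfolding near_ax_def by meson
  moreover have "wd (ax k 0) (ax k (int n)) = n" unfolding ax_wd by simp
  ultimately show "\<exists>s t x y. x \<in> sp (letters k) \<and> wd (\<psi> (\<alpha> s)) x \<le> N \<and> wd (\<psi> (\<alpha> t)) y \<le> N \<and>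
      - x + y \<in> sp (Gam k) \<and> wd x y = n"
    using ax_Gam[of k "int n"] by (intro exI[of _ s] exI[of _ t] exI[of _ 0] exI[of _ "ax k (int n)"]) (simp add: wd_sym)
qed

lemma ax_Morse:
  assumes k2: "2 \<le> k"
  obtains N where "J \<le> N" "\<And>n \<sigma> i0 j0 i. (\<And>i j. i \<le> n \<Longrightarrow> j \<le> n \<Longrightarrow> real i - real j \<le> J * real (wd (\<sigma> i) (\<sigma> j)) + J) \<Longrightarrow>
      (\<And>i. i < n \<Longrightarrow> wd (\<sigma> i) (\<sigma> (Suc i)) \<le> J) \<Longrightarrow> wd (ax k i0) (\<sigma> 0) \<le> J \<Longrightarrow> wd (ax k j0) (\<sigma> n) \<le> J \<Longrightarrow>
      i \<le> n \<Longrightarrow> \<exists>l. wd (ax k l) (\<sigma> i) \<le> N"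
proof -
  obtain c where c: "c > 0" "corner c (k - 1) (vb k k) (va k k)" "corner c (k - 1) (va k k) (vb k k)"
    by (rule ab_corner[OF k2])
  have "1 \<le> k - 1" using k2 by simp
  from line_Morse[OF ax_pair c(3,2,1) this, of J] obtain N where N: "\<forall>n \<sigma> i0 j0. (\<forall>i\<le>n. \<forall>j\<le>n. real i - real j \<le> J * real (wd (\<sigma> i) (\<sigma> j)) + J) \<longrightarrow>
      (\<forall>i<n. wd (\<sigma> i) (\<sigma> (Suc i)) \<le> J) \<longrightarrow> wd (ax k i0) (\<sigma> 0) \<le> J \<longrightarrow> wd (ax k j0) (\<sigma> n) \<le> J \<longrightarrow>
      (\<forall>i\<le>n. \<exists>l. wd (ax k l) (\<sigma> i) \<le> N)" ..
  show thesis
  proof (rule that[of "max J N"])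
    fix n \<sigma> i0 j0 i
    assume "\<And>i j. i \<le> n \<Longrightarrow> j \<le> n \<Longrightarrow> real i - real j \<le> J * real (wd (\<sigma> i) (\<sigma> j)) + J"
      "\<And>i. i < n \<Longrightarrow> wd (\<sigma> i) (\<sigma> (Suc i)) \<le> J" "wd (ax k i0) (\<sigma> 0) \<le> J" "wd (ax k j0) (\<sigma> n) \<le> J" "i \<le> n"
    then have "\<exists>l. wd (ax k l) (\<sigma> i) \<le> N" using N[rule_format, of n \<sigma> i0 j0 i] by blast
    then show "\<exists>l. wd (ax k l) (\<sigma> i) \<le> max J N" by (meson max.coboundedI2)
  qed simp
qed

text \<open>Sampled at unit steps and mapped by \<open>\<psi>\<close>, a quasi-geodesic with ends on
  \<alpha> satisfies the discrete hypotheses of \<open>ax_Morse\<close>; points of the axis in turn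
  lie near \<alpha>.\<close>

lemma near_ax_Morse:
  assumes k2: "2 \<le> k" and g: "geodesic UNIV \<alpha>" and near: "near_ax \<alpha> N0"
  shows "Morse UNIV \<alpha>"
  unfolding Morse_def
proof (intro conjI allI impI)
  note [simp] = geodesicD(1)[OF g]
  show "\<exists>K\<ge>1. \<exists>L\<ge>0. quasi_geodesic K L UNIV \<alpha>"
    using g unfolding geodesic_def by (intro exI[of _ 1] conjI exI[of _ 0]) auto
  fix K' L :: real assume K': "1 \<le> K'" and L: "0 < L"
  define J where "J = max (nat \<lceil>K' * K + K' * K + K' * L + 1\<rceil>) (max (nat \<lceil>K * (K' + L) + K\<rceil>) N0)"
  have J: "K' * K + K' * K + K' * L + 1 \<le> real J" "K * (K' + L) + K \<le> real J" "N0 \<le> J"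
    unfolding J_def by (rule order_trans[OF real_nat_ceiling_ge], simp only: of_nat_le_iff, simp)+
  obtain N1 where N1: "\<And>n \<sigma> i0 j0 i. (\<And>i j. i \<le> n \<Longrightarrow> j \<le> n \<Longrightarrow> real i - real j \<le> J * real (wd (\<sigma> i) (\<sigma> j)) + J) \<Longrightarrow>
      (\<And>i. i < n \<Longrightarrow> wd (\<sigma> i) (\<sigma> (Suc i)) \<le> J) \<Longrightarrow> wd (ax k i0) (\<sigma> 0) \<le> J \<Longrightarrow> wd (ax k j0) (\<sigma> n) \<le> J \<Longrightarrow>
      i \<le> n \<Longrightarrow> \<exists>l. wd (ax k l) (\<sigma> i) \<le> N1"
    by (rule ax_Morse[OF k2, of J]) blast
  define N :: real where "N = K' + L + (K * (real N1 + real N0) + K) + 1"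
  have "\<exists>t. d (\<sigma> s) (\<alpha> t) < N"
    if ab: "a \<le> b" and \<sigma>: "quasi_geodesic K' L {a..b} \<sigma>" and ends: "\<sigma> a \<in> range \<alpha>" "\<sigma> b \<in> range \<alpha>" and s: "s \<in> {a..b}" for a b \<sigma> s
  proof -
    define n where "n = nat \<lceil>b - a\<rceil>"
    \<comment> \<open>Capped at \<open>b\<close>, so that the last sample is the endpoint
      itself.\<close>
    define \<tau> where "\<tau> i = min (a + real i) b" for i :: nat
    have \<tau>: "\<tau> i \<in> {a..b}" for i using ab by (auto simp: \<tau>_def)
    have \<tau>n: "\<tau> n = b" "\<tau> 0 = a" using ab unfolding \<tau>_def n_def by (auto simp: min_def) linarith+
    have \<tau>_dist: "\<bar>\<tau> i - \<tau> j\<bar> \<le> \<bar>real i - real j\<bar>" for i j by (auto simp: \<tau>_def min_def)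
    have \<tau>_dist': "real i - real j \<le> \<bar>\<tau> i - \<tau> j\<bar> + 1" if "i \<le> n" for i j
    proof -
      have "real n < b - a + 1" using ab unfolding n_def by linarith
      then have "real i < b - a + 1" using that by linarith
      then show ?thesis by (auto simp: \<tau>_def min_def)
    qed
    have \<sigma>M: "\<sigma> t \<in> M" if "t \<in> {a..b}" for t using \<sigma> that unfolding quasi_geodesic_def by auto
    have \<sigma>_lower: "\<bar>t - t'\<bar> \<le> K' * (d (\<sigma> t) (\<sigma> t') + L)" and \<sigma>_upper: "d (\<sigma> t) (\<sigma> t') \<le> K' * \<bar>t - t'\<bar> + L"
      if "t \<in> {a..b}" "t' \<in> {a..b}" for t t'
    proof -
      have "1 / K' * \<bar>t - t'\<bar> - L \<le> d (\<sigma> t) (\<sigma> t')" using \<sigma> that unfolding quasi_geodesic_def by blast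
      then show "\<bar>t - t'\<bar> \<le> K' * (d (\<sigma> t) (\<sigma> t') + L)" using K' by (simp add: field_simps)
      show "d (\<sigma> t) (\<sigma> t') \<le> K' * \<bar>t - t'\<bar> + L" using \<sigma> that unfolding quasi_geodesic_def by blast
    qed
    define i where "i = nat \<lfloor>s - a\<rfloor>"
    have i: "i \<le> n" "\<bar>s - \<tau> i\<bar> \<le> 1"
    proof -
      have "real i \<le> s - a" "s - a < real i + 1" using s unfolding i_def by auto
      then show "\<bar>s - \<tau> i\<bar> \<le> 1" using s by (auto simp: \<tau>_def min_def)
      have "real i \<le> b - a" using \<open>real i \<le> s - a\<close> s by auto
      then show "i \<le> n" unfolding n_def by linarith
    qed
    have "\<exists>u. wd (ax k u) (\<psi> (\<sigma> t)) \<le> J" if "\<sigma> t \<in> range \<alpha>" for t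
      using near that J(3) unfolding near_ax_def by (metis imageE order_trans)
    then obtain i0 j0 where i0: "wd (ax k i0) (\<psi> (\<sigma> (\<tau> 0))) \<le> J" and j0: "wd (ax k j0) (\<psi> (\<sigma> (\<tau> n))) \<le> J"
      using ends \<tau>n by metis
    have "\<exists>l. wd (ax k l) (\<psi> (\<sigma> (\<tau> i))) \<le> N1"
    proof (rule N1[of n "\<lambda>i. \<psi> (\<sigma> (\<tau> i))" i0 j0])
      show "real i - real j \<le> J * real (wd (\<psi> (\<sigma> (\<tau> i))) (\<psi> (\<sigma> (\<tau> j)))) + J" if "i \<le> n" "j \<le> n" for i j
      proof -
        let ?w = "real (wd (\<psi> (\<sigma> (\<tau> i))) (\<psi> (\<sigma> (\<tau> j))))"
        have "d (\<sigma> (\<tau> i)) (\<sigma> (\<tau> j)) \<le> K * ?w + K" using \<psi>_lower \<sigma>M \<tau> by blast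
        then have "K' * (d (\<sigma> (\<tau> i)) (\<sigma> (\<tau> j)) + L) \<le> K' * (K * ?w + K + L)" using K' by (intro mult_left_mono) auto
        then have "real i - real j \<le> K' * (K * ?w + K + L) + 1" using \<tau>_dist'[OF that(1), of j] \<sigma>_lower[OF \<tau> \<tau>, of i j] by linarith
        also have "\<dots> = (K' * K) * ?w + (K' * K + K' * L + 1)" by (simp add: algebra_simps)
        also have "\<dots> \<le> real J * ?w + real J"
        proof (intro add_mono mult_right_mono)
          have "0 \<le> K' * K" "0 \<le> K' * L" using K' L by simp_all
          then show "K' * K \<le> real J" "K' * K + K' * L + 1 \<le> real J" using J(1) by linarith+
        qed simp
        finally show ?thesis .
      qed
      show "wd (\<psi> (\<sigma> (\<tau> i))) (\<psi> (\<sigma> (\<tau> (Suc i)))) \<le> J" for i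
      proof -
        have "K' * \<bar>\<tau> i - \<tau> (Suc i)\<bar> \<le> K' * 1" using \<tau>_dist[of i "Suc i"] K' by (intro mult_left_mono) auto
        then have "d (\<sigma> (\<tau> i)) (\<sigma> (\<tau> (Suc i))) \<le> K' + L" using \<sigma>_upper[OF \<tau> \<tau>, of i "Suc i"] by simp
        then have "K * d (\<sigma> (\<tau> i)) (\<sigma> (\<tau> (Suc i))) + K \<le> K * (K' + L) + K" by (intro add_right_mono mult_left_mono) auto
        then have "real (wd (\<psi> (\<sigma> (\<tau> i))) (\<psi> (\<sigma> (\<tau> (Suc i))))) \<le> real J"
          using \<psi>_upper[OF \<sigma>M[OF \<tau>] \<sigma>M[OF \<tau>], of i "Suc i"] J(2) by linarith
        then show ?thesis by simp
      qed
    qed (use i0 j0 i(1) in simp_all)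
    then obtain l where l: "wd (ax k l) (\<psi> (\<sigma> (\<tau> i))) \<le> N1" ..
    obtain t where t: "wd (ax k l) (\<psi> (\<alpha> t)) \<le> N0" using near unfolding near_ax_def by blast
    have "real (wd (\<psi> (\<sigma> (\<tau> i))) (\<psi> (\<alpha> t))) \<le> real N1 + real N0"
      using wd_triangle[of "\<psi> (\<sigma> (\<tau> i))" "\<psi> (\<alpha> t)" "ax k l"] l t wd_sym[of "ax k l" "\<psi> (\<sigma> (\<tau> i))"] by simp
    then have "K * real (wd (\<psi> (\<sigma> (\<tau> i))) (\<psi> (\<alpha> t))) + K \<le> K * (real N1 + real N0) + K"
      by (intro add_right_mono mult_left_mono) auto
    then have 1: "d (\<sigma> (\<tau> i)) (\<alpha> t) \<le> K * (real N1 + real N0) + K"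
      using \<psi>_lower[OF \<sigma>M[OF \<tau>], of "\<alpha> t" i] by simp
    have "K' * \<bar>s - \<tau> i\<bar> \<le> K' * 1" using i(2) K' by (intro mult_left_mono) auto
    then have 2: "d (\<sigma> s) (\<sigma> (\<tau> i)) \<le> K' + L" using \<sigma>_upper[OF s \<tau>, of i] by simp
    have "d (\<sigma> s) (\<alpha> t) \<le> d (\<sigma> s) (\<sigma> (\<tau> i)) + d (\<sigma> (\<tau> i)) (\<alpha> t)" using \<sigma>M[OF s] \<sigma>M[OF \<tau>] by (intro triangle) auto
    then have "d (\<sigma> s) (\<alpha> t) < N" using 1 2 by (simp add: N_def)
    then show ?thesis ..
  qed
  then show "\<exists>N. \<forall>a b \<sigma>. a \<le> b \<longrightarrow> quasi_geodesic K' L {a..b} \<sigma> \<longrightarrow> \<sigma> a \<in> range \<alpha> \<longrightarrow> \<sigma> b \<in> range \<alpha> \<longrightarrow>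
      (\<forall>s\<in>{a..b}. \<exists>t\<in>UNIV. d (\<sigma> s) (\<alpha> t) < N)" by blast
qed

text \<open>The parameter along the axis is a quasi-isometry from the reals to the integers and
  preserves betweenness on a large scale: the points at t - r and t + r lie on different sides of
  the one at t.\<close>

lemma coarse_order:
  fixes u :: "real \<Rightarrow> int"
  assumes upper: "\<And>s t. \<bar>real_of_int (u s - u t)\<bar> \<le> P * \<bar>s - t\<bar> + P"
    and lower: "\<And>s t. \<bar>s - t\<bar> \<le> P * \<bar>real_of_int (u s - u t)\<bar> + P"
    and P: "1 \<le> P" and r: "2 * P * P + P < r"
  shows "u (t - r) < u t \<and> u t < u (t + r) \<or> u (t + r) < u t \<and> u t < u (t - r)"
proof -
  have r0: "r > 0" using r P by (smt (verit) mult_nonneg_nonneg)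
  text \<open>If \<open>u\<close> goes back after \<open>t\<close>, then it nearly takes the value at \<open>t - \<eta> * r\<close> again between \<open>t\<close> and
    \<open>t + \<eta> * r\<close>, at least \<open>r\<close> apart, against the lower bound.\<close>
  have key: False
    if \<epsilon>: "\<epsilon> = 1 \<or> \<epsilon> = (-1 :: real)" and \<eta>: "\<eta> = 1 \<or> \<eta> = (-1 :: real)"
      and le: "\<epsilon> * real_of_int (u t) \<le> \<epsilon> * real_of_int (u (t - \<eta> * r))" "\<epsilon> * real_of_int (u (t - \<eta> * r)) \<le> \<epsilon> * real_of_int (u (t + \<eta> * r))"
    for \<epsilon> \<eta>
  proof -
    define n where "n = nat \<lceil>r\<rceil>"
    define \<tau> where "\<tau> i = min (real i) r" for i :: nat
    have \<tau>n: "\<tau> n = r" "\<tau> 0 = 0" using r0 real_nat_ceiling_ge[of r] by (simp_all add: \<tau>_def n_def)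
    define v where "v i = \<epsilon> * real_of_int (u (t + \<eta> * \<tau> i))" for i
    have "\<bar>v (Suc i) - v i\<bar> \<le> 2 * P" for i
    proof -
      have "\<bar>v (Suc i) - v i\<bar> = \<bar>real_of_int (u (t + \<eta> * \<tau> (Suc i)) - u (t + \<eta> * \<tau> i))\<bar>"
        using \<epsilon> by (auto simp: v_def abs_minus_commute)
      also have "\<dots> \<le> P * \<bar>(t + \<eta> * \<tau> (Suc i)) - (t + \<eta> * \<tau> i)\<bar> + P" by (rule upper)
      also have "\<dots> \<le> P * 1 + P" using P \<eta> by (intro add_right_mono mult_left_mono) (auto simp: \<tau>_def min_def)
      finally show ?thesis by simp
    qed
    then obtain i where i: "i \<le> n" "\<bar>v i - \<epsilon> * real_of_int (u (t - \<eta> * r))\<bar> \<le> 2 * P"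
      using discrete_ivt[of n v "2 * P" "\<epsilon> * real_of_int (u (t - \<eta> * r))"] le \<tau>n P by (auto simp: v_def)
    have "\<bar>real_of_int (u (t + \<eta> * \<tau> i) - u (t - \<eta> * r))\<bar> \<le> 2 * P" using i(2) \<epsilon> by (auto simp: v_def)
    then have "P * \<bar>real_of_int (u (t + \<eta> * \<tau> i) - u (t - \<eta> * r))\<bar> \<le> P * (2 * P)" using P by (intro mult_left_mono) auto
    then have "\<bar>(t + \<eta> * \<tau> i) - (t - \<eta> * r)\<bar> \<le> 2 * P * P + P" using lower[of "t + \<eta> * \<tau> i" "t - \<eta> * r"] by simp
    moreover have "r \<le> \<bar>(t + \<eta> * \<tau> i) - (t - \<eta> * r)\<bar>" using \<eta> r0 by (auto simp: \<tau>_def)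
    ultimately show False using r by simp
  qed
  show ?thesis
  proof (rule ccontr)
    assume "\<not> ?thesis"
    then consider "u t \<le> u (t - r)" "u t \<le> u (t + r)" | "u (t - r) \<le> u t" "u (t + r) \<le> u t" by linarith
    then show False
    proof cases
      case 1
      then show False using key[of 1 1] key[of 1 "-1"] by (cases "u (t - r) \<le> u (t + r)") auto
    next
      case 2
      then show False using key[of "-1" 1] key[of "-1" "-1"] by (cases "u (t + r) \<le> u (t - r)") auto
    qed
  qed
qed

text \<open>A path around the ball crosses about r / (4 K) consecutive walls of the axis next to
  \<alpha> t, with a corner of exponent k - 1 between any two neighbours; together this gives degree
  k.\<close>

lemma near_ax_lower:
  assumes k2: "2 \<le> k" and g: "geodesic UNIV \<alpha>" and near: "near_ax \<alpha> N"
  shows "fun_preceq (power_fun k) (lower_divergence \<alpha>)"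
proof -
  note [simp] = geodesicD(1)[OF g]
  obtain c where c: "c > 0" "corner c (k - 1) (vb k k) (va k k)" "corner c (k - 1) (va k k) (vb k k)"
    by (rule ab_corner[OF k2])
  obtain u where u: "\<And>t. wd (ax k (u t)) (\<psi> (\<alpha> t)) \<le> N" using near unfolding near_ax_def by metis
  define P :: real where "P = K * (2 * real N + 1) + K + 2 * real N"
  have K1: "real K \<ge> 1" using K by simp
  have u_wd: "real (wd (ax k (u s)) (ax k (u t))) = \<bar>real_of_int (u s - u t)\<bar>" for s t
    unfolding ax_wd by simp
  have wd_le: "\<bar>real_of_int (u s - u t)\<bar> \<le> real (wd (\<psi> (\<alpha> s)) (\<psi> (\<alpha> t))) + 2 * real N"
    and wd_ge: "real (wd (\<psi> (\<alpha> s)) (\<psi> (\<alpha> t))) \<le> \<bar>real_of_int (u s - u t)\<bar> + 2 * real N" for s t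
    using wd_triangle[of "ax k (u s)" "ax k (u t)" "\<psi> (\<alpha> s)"] wd_triangle[of "\<psi> (\<alpha> s)" "ax k (u t)" "\<psi> (\<alpha> t)"]
      wd_triangle[of "\<psi> (\<alpha> s)" "\<psi> (\<alpha> t)" "ax k (u s)"] wd_triangle[of "ax k (u s)" "\<psi> (\<alpha> t)" "ax k (u t)"]
      u[of s] u[of t] wd_sym[of "\<psi> (\<alpha> s)" "ax k (u s)"] wd_sym[of "\<psi> (\<alpha> t)" "ax k (u t)"]
    unfolding u_wd[symmetric] by linarith+
  have KN: "0 \<le> real K * real N" by simp
  have P_eq: "P = 2 * real K + 2 * (real K * real N) + 2 * real N" by (simp add: P_def algebra_simps)
  have P: "1 \<le> P" "real K \<le> P" "K + 2 * real N \<le> P" "K * (2 * real N) + K \<le> P"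
    using K1 KN of_nat_0_le_iff[of N, where 'a = real] unfolding P_eq by linarith+
  have upper: "\<bar>real_of_int (u s - u t)\<bar> \<le> P * \<bar>s - t\<bar> + P" for s t
  proof -
    have "\<bar>real_of_int (u s - u t)\<bar> \<le> K * \<bar>s - t\<bar> + (K + 2 * real N)"
      using wd_le[of s t] \<psi>_upper[of "\<alpha> s" "\<alpha> t"] geodesicD(2)[OF g] by simp
    also have "\<dots> \<le> P * \<bar>s - t\<bar> + P" using P by (intro add_mono mult_right_mono) auto
    finally show ?thesis .
  qed
  have lower: "\<bar>s - t\<bar> \<le> K * \<bar>real_of_int (u s - u t)\<bar> + (K * (2 * real N) + K)" for s t
  proof -
    have "\<bar>s - t\<bar> \<le> K * real (wd (\<psi> (\<alpha> s)) (\<psi> (\<alpha> t))) + K"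
      using \<psi>_lower[of "\<alpha> s" "\<alpha> t"] geodesicD(2)[OF g] by simp
    also have "\<dots> \<le> K * (\<bar>real_of_int (u s - u t)\<bar> + 2 * real N) + K"
      using wd_ge by (intro add_right_mono mult_left_mono) auto
    finally show ?thesis by (simp add: algebra_simps)
  qed
  have lower': "\<bar>s - t\<bar> \<le> P * \<bar>real_of_int (u s - u t)\<bar> + P" for s t
  proof -
    have "K * \<bar>real_of_int (u s - u t)\<bar> + (K * (2 * real N) + K) \<le> P * \<bar>real_of_int (u s - u t)\<bar> + P"
      using P by (intro add_mono mult_right_mono) auto
    with lower[of s t] show ?thesis by linarith
  qed
  define D :: real where "D = 2 * P * P + P + 2 * K * (3 * real K + 3 * real N + 20)"
  define A0 where "A0 = (8 * K) ^ k * (4 * K) / c"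
  show ?thesis
  proof (rule lower_divergence_geI)
    show "A0 > 0" using K c by (simp add: A0_def)
    have D_pos: "0 < 2 * P * P + P" "0 \<le> 2 * K * (3 * real K + 3 * real N + 20)" using P by (simp_all add: add_nonneg_pos)
    then show "D > 0" unfolding D_def by (rule add_pos_nonneg)
    fix r t l and p :: "real \<Rightarrow> 'a"
    assume r: "r > D" and p: "pathin mtopology p" "p 0 = \<alpha> (t - r)" "p 1 = \<alpha> (t + r)"
      "p ` {0..1} \<inter> mball (\<alpha> t) r = {}" and l: "0 \<le> l" "path_length p \<le> ennreal l"
    have rP: "2 * P * P + P < r" and r2: "2 * K * (3 * real K + 3 * real N + 20) < r" and r0: "0 < r"
      using r D_pos unfolding D_def by linarith+
    define x where "x = r / K"
    have x: "2 * (3 * real K + 3 * real N + 20) \<le> x" using r2 K1 by (simp add: x_def field_simps)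
    then have x': "6 * real K + 6 * real N + 40 \<le> x" by simp
    obtain n where n: "reach {w. x \<le> real (wd (\<psi> (\<alpha> t)) w) + 3 * K} n (\<psi> (\<alpha> (t - r))) (\<psi> (\<alpha> (t + r)))"
      "real n \<le> (2 + 2 * l) * (2 * K)"
      using path_to_reach[OF p(1) l(2,1) _ p(4)] p(2,3) unfolding x_def by auto
    have gap: "x \<le> \<bar>real_of_int (u s - u t)\<bar> + 2 * real N + 1" if "s = t - r \<or> s = t + r" for s
    proof -
      have "r \<le> K * (\<bar>real_of_int (u s - u t)\<bar> + 2 * real N + 1)"
        using lower[of s t] that r0 by (auto simp: algebra_simps)
      then show ?thesis using K1 by (simp add: x_def field_simps)
    qed
    \<comment> \<open>Vertices of the axis within x / 4 of the centre keep distance at least x / 4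
      from the path, and the foot of the far endpoint lies beyond all m walls.\<close>
    define m where "m = nat \<lfloor>x / 4\<rfloor>"
    have m: "real m \<le> x / 4" "x / 4 < real m + 1" using x' unfolding m_def by linarith+
    have m1: "0 < m" "x / 8 \<le> real (m - 1)" using m x' by linarith+
    have "real (m - 1) * (c * real m ^ (k - 1)) \<le> real n"
      if rc: "reach {w. x \<le> real (wd (\<psi> (\<alpha> t)) w) + 3 * K} n (\<psi> (\<alpha> s)) (\<psi> (\<alpha> s'))"
        and s: "s = t - r \<or> s = t + r" "s' = t - r \<or> s' = t + r" "u s < u t" "u t < u s'" for s s'
    proof -
      obtain f where f: "edge_path f n" "f 0 = \<psi> (\<alpha> s)" "f n = \<psi> (\<alpha> s')"
        "\<And>i. i \<le> n \<Longrightarrow> x \<le> real (wd (\<psi> (\<alpha> t)) (f i)) + 3 * K" using rc unfolding reach_def by auto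
      have us: "x - 2 * real N - 1 \<le> real_of_int (u t - u s)" "x - 2 * real N - 1 \<le> real_of_int (u s' - u t)"
        using gap[OF s(1)] gap[OF s(2)] s(3,4) by linarith+
      show ?thesis
      proof (rule line_cost[OF ax_pair c(3,2) f(1) _ _ m1(1)])
        show "f 0 \<notin> line_beyond (va k k) (vb k k) (u t)"
          unfolding f(2) using u[of s] us(1) s(3) x' by (intro line_not_beyond[OF ax_pair, of "u s"]) linarith+
        show "f n \<in> line_beyond (va k k) (vb k k) (u t + int m - 1)"
        proof (unfold f(3), rule line_beyondI[OF ax_pair, of _ "u s'"])
          have *: "real_of_int (u t + int m - 1) + real N + 1 \<le> real_of_int (u s')"
            using us(2) m(1) x' by simp
          then show "u t + int m - 1 < u s'" by linarith
          show "int (wd (ax k (u s')) (\<psi> (\<alpha> s'))) < u s' - (u t + int m - 1)" using u[of s'] * by linarith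
        qed
        show "m \<le> wd (ax k (u t + int i)) (f j)" if "i < m" "j \<le> n" for i j
        proof -
          have "wd (\<psi> (\<alpha> t)) (f j) \<le> N + i + wd (ax k (u t + int i)) (f j)"
            using wd_triangle[of "\<psi> (\<alpha> t)" "f j" "ax k (u t)"] wd_triangle[of "ax k (u t)" "f j" "ax k (u t + int i)"]
              u[of t] ax_wd[of k "u t" "u t + int i"] wd_sym[of "\<psi> (\<alpha> t)" "ax k (u t)"] by simp
          then have "x \<le> real N + real i + real (wd (ax k (u t + int i)) (f j)) + 3 * K" using f(4)[OF that(2)] by linarith
          moreover have "real i \<le> x / 4" using that(1) m(1) by linarith
          ultimately have "real m \<le> real (wd (ax k (u t + int i)) (f j))" using m(1) x' by linarith
          then show ?thesis by simp
        qed
      qed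
    qed
    then have "real (m - 1) * (c * real m ^ (k - 1)) \<le> real n"
      using coarse_order[of u P r t, OF upper lower' P(1) rP] n(1) reach_sym[OF n(1)] by blast
    moreover have "c * (x / 8) ^ k \<le> real (m - 1) * (c * real m ^ (k - 1))"
    proof -
      have "c * (x / 8) ^ k = x / 8 * (c * (x / 8) ^ (k - 1))" using k2 by (simp add: power_eq_if)
      also have "x / 8 * (c * (x / 8) ^ (k - 1)) \<le> real (m - 1) * (c * real m ^ (k - 1))"
        using m1 x' c by (intro mult_mono mult_left_mono power_mono) auto
      finally show ?thesis .
    qed
    ultimately have "c * (x / 8) ^ k \<le> 4 * K * (l + 1)" using n(2) by (simp add: algebra_simps)
    then have "c * (r / (8 * K)) ^ k \<le> 4 * K * (l + 1)" by (simp add: x_def mult.commute)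
    then show "r ^ k \<le> A0 * (l + 1)"
      using c K1 by (simp add: A0_def power_divide power_mult_distrib field_simps)
  qed
qed

end

section \<open>A geodesic near the axis as a limit of segments\<close>

text \<open>A coarse model need not contain a geodesic line near the axis. The axioms added here
  express what a locally finite graph provides: geodesics through vertices, and a compactness
  property by which growing segments through a bounded region have a limit.\<close>

locale omega_graph = omega_model M d \<psi> K k
  for M :: "'a set" and d :: "'a \<Rightarrow> 'a \<Rightarrow> real" and \<psi> :: "'a \<Rightarrow> indexed_vertex rac" and K k :: nat +
  fixes V :: "'a set"
  assumes V_sub: "V \<subseteq> M"
    and V_dense: "x \<in> M \<Longrightarrow> \<exists>v\<in>V. d x v \<le> 1"
    and V_geodesic: "x \<in> V \<Longrightarrow> y \<in> V \<Longrightarrow> \<exists>n v. v 0 = x \<and> v n = y \<and> (\<forall>i\<le>n. v i \<in> V) \<and>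
      (\<forall>i\<le>n. \<forall>j\<le>n. d (v i) (v j) = \<bar>real i - real j\<bar>)"
    and V_limit: "(\<And>m i. \<bar>i\<bar> \<le> int m \<Longrightarrow> w m i \<in> V) \<Longrightarrow>
      (\<And>m i j. \<bar>i\<bar> \<le> int m \<Longrightarrow> \<bar>j\<bar> \<le> int m \<Longrightarrow> d (w m i) (w m j) = \<bar>real_of_int (i - j)\<bar>) \<Longrightarrow>
      (\<And>m. d (w 0 0) (w m 0) \<le> C) \<Longrightarrow>
      \<exists>\<alpha>. geodesic UNIV \<alpha> \<and> (\<forall>m. \<exists>m'\<ge>m. \<forall>i. \<bar>i\<bar> \<le> int m \<longrightarrow> \<alpha> (of_int i) = w m' i)"
begin

text \<open>In the last clause the parameter range for \<open>l\<close> does not depend on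
  \<open>m\<close>; otherwise the covering of the axis could be lost in the limit.\<close>

definition axis_window :: "nat \<Rightarrow> nat \<Rightarrow> nat \<Rightarrow> (int \<Rightarrow> 'a) \<Rightarrow> bool" where
  "axis_window N P m w \<longleftrightarrow> (\<forall>i. \<bar>i\<bar> \<le> int m \<longrightarrow> w i \<in> V \<and> (\<exists>u. wd (ax k u) (\<psi> (w i)) \<le> N)) \<and>
    (\<forall>i j. \<bar>i\<bar> \<le> int m \<longrightarrow> \<bar>j\<bar> \<le> int m \<longrightarrow> d (w i) (w j) = \<bar>real_of_int (i - j)\<bar>) \<and>
    wd (ax k 0) (\<psi> (w 0)) \<le> N \<and>
    (\<forall>l. P * nat \<bar>l\<bar> + P \<le> m \<longrightarrow> (\<exists>i. \<bar>i\<bar> \<le> int (P * nat \<bar>l\<bar> + P) \<and> wd (ax k l) (\<psi> (w i)) \<le> N))"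

text \<open>A geodesic between lifts of \<open>ax k (- n)\<close> and \<open>ax k n\<close> follows
  the axis by \<open>ax_Morse\<close>. Its footpoints move by bounded steps, so it passes near every
  point in between; it is recentred at a vertex near 0.\<close>

lemma axis_segment:
  assumes k2: "2 \<le> k"
  shows "\<exists>N P. \<forall>m. \<exists>w. axis_window N P m w"
proof -
  obtain N0 where N0: "3 * K \<le> N0" "\<And>n \<sigma> i0 j0 i. (\<And>i j. i \<le> n \<Longrightarrow> j \<le> n \<Longrightarrow> real i - real j \<le> (3 * K) * real (wd (\<sigma> i) (\<sigma> j)) + 3 * K) \<Longrightarrow>
      (\<And>i. i < n \<Longrightarrow> wd (\<sigma> i) (\<sigma> (Suc i)) \<le> 3 * K) \<Longrightarrow> wd (ax k i0) (\<sigma> 0) \<le> 3 * K \<Longrightarrow> wd (ax k j0) (\<sigma> n) \<le> 3 * K \<Longrightarrow>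
      i \<le> n \<Longrightarrow> \<exists>l. wd (ax k l) (\<sigma> i) \<le> N0"
    by (rule ax_Morse[OF k2, of "3 * K"]) blast
  define J where "J = 2 * N0 + 2 * K"
  define N where "N = N0 + J"
  \<comment> \<open>Makes P * |l| + P a bound for K * (2 * N + |l|) + K, the parameter distance
    between vertices near \<open>ax k l\<close> and near 0.\<close>
  define P where "P = K * (2 * N + 1) + K"
  have near_V: "\<exists>v\<in>V. wd (\<psi> v) (ax k l) \<le> 3 * K" for l
  proof -
    have "ax k l \<in> sp (letters k)" using ax_Gam sp_mono[OF Gam_letters] by blast
    then obtain x where x: "x \<in> M" "wd (\<psi> x) (ax k l) \<le> K" using \<psi>_onto by blast
    obtain v where v: "v \<in> V" "d x v \<le> 1" using V_dense[OF x(1)] by blast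
    have "real K * d x v \<le> real K * 1" using v by (intro mult_left_mono) auto
    then have "real (wd (\<psi> x) (\<psi> v)) \<le> real (2 * K)" using \<psi>_upper[OF x(1), of v] v V_sub by auto
    then have "wd (\<psi> v) (ax k l) \<le> 3 * K"
      using wd_triangle[of "\<psi> v" "ax k l" "\<psi> x"] x(2) wd_sym[of "\<psi> v" "\<psi> x"] unfolding of_nat_le_iff by simp
    then show ?thesis using v by blast
  qed
  have "\<exists>w. axis_window N P m w" for m
  proof -
    \<comment> \<open>The surplus 4 * K + N absorbs the errors, so that the centre has at least m
      vertices on either side.\<close>
    define n where "n = K * m + 4 * K + N"
    obtain x y where x: "x \<in> V" "wd (\<psi> x) (ax k (- int n)) \<le> 3 * K" and y: "y \<in> V" "wd (\<psi> y) (ax k (int n)) \<le> 3 * K"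
      using near_V by meson
    obtain h v where v: "v 0 = x" "v h = y" "\<And>i. i \<le> h \<Longrightarrow> v i \<in> V"
      "\<And>i j. i \<le> h \<Longrightarrow> j \<le> h \<Longrightarrow> d (v i) (v j) = \<bar>real i - real j\<bar>" using V_geodesic[OF x(1) y(1)] by metis
    have vM: "v i \<in> M" if "i \<le> h" for i using v(3)[OF that] V_sub by blast
    have v_lower: "\<bar>real i - real j\<bar> \<le> K * real (wd (\<psi> (v i)) (\<psi> (v j))) + K"
      and v_upper: "real (wd (\<psi> (v i)) (\<psi> (v j))) \<le> K * \<bar>real i - real j\<bar> + K" if "i \<le> h" "j \<le> h" for i j
      using \<psi>_lower[OF vM vM] \<psi>_upper[OF vM vM] that v(4) by metis+
    have step: "wd (\<psi> (v i)) (\<psi> (v (Suc i))) \<le> 2 * K" if "i < h" for i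
    proof -
      have "real (wd (\<psi> (v i)) (\<psi> (v (Suc i)))) \<le> real (2 * K)" using v_upper[of i "Suc i"] that by simp
      then show ?thesis by (simp only: of_nat_le_iff)
    qed
    have "\<exists>l. wd (ax k l) (\<psi> (v i)) \<le> N0" if "i \<le> h" for i
    proof (rule N0(2)[of h "\<lambda>i. \<psi> (v i)" "- int n" "int n"])
      show "real i - real j \<le> real (3 * K) * real (wd (\<psi> (v i)) (\<psi> (v j))) + real (3 * K)" if "i \<le> h" "j \<le> h" for i j
      proof -
        have "real i - real j \<le> K * real (wd (\<psi> (v i)) (\<psi> (v j))) + K" using v_lower[OF that] by linarith
        also have "\<dots> \<le> real (3 * K) * real (wd (\<psi> (v i)) (\<psi> (v j))) + real (3 * K)"
          by (intro add_mono mult_right_mono) auto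
        finally show ?thesis .
      qed
      show "wd (\<psi> (v i)) (\<psi> (v (Suc i))) \<le> 3 * K" if "i < h" for i using step[OF that] by simp
    qed (use that x y v in \<open>simp_all add: wd_sym\<close>)
    then obtain u0 where u0: "\<And>i. i \<le> h \<Longrightarrow> wd (ax k (u0 i)) (\<psi> (v i)) \<le> N0" by metis
    define u where "u i = (if i = 0 then - int n else if i = h then int n else u0 i)" for i
    have u: "wd (ax k (u i)) (\<psi> (v i)) \<le> N0" if "i \<le> h" for i
      using that u0 x y v N0(1) wd_sym[of "\<psi> x"] wd_sym[of "\<psi> y"] by (simp add: u_def)
    have wd0n: "wd (ax k (- int n)) (ax k (int n)) = 2 * n" unfolding ax_wd by simp
    have n0: "n > 0" using K by (simp add: n_def)
    have N_K: "3 * K \<le> N" using N0 by (simp add: N_def)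
    have h0: "h \<noteq> 0"
    proof
      assume "h = 0"
      then have "2 * n \<le> 6 * K"
        using wd_triangle[of "ax k (- int n)" "ax k (int n)" "\<psi> x"] x y v wd_sym[of "\<psi> x" "ax k (- int n)"] wd0n by simp
      then show False using K N_K by (simp add: n_def)
    qed
    have cover: "\<exists>i\<le>h. wd (ax k l) (\<psi> (v i)) \<le> N" if l: "\<bar>l\<bar> \<le> int n" for l
    proof -
      obtain i where i: "i \<le> h" "\<bar>real_of_int (u i) - real_of_int l\<bar> \<le> real J"
      proof (rule discrete_ivt[of h "\<lambda>i. real_of_int (u i)" "real J" "real_of_int l"])
        fix i assume i: "i < h"
        have "wd (ax k (u (Suc i))) (ax k (u i)) \<le> J"
          using wd_triangle[of "ax k (u (Suc i))" "ax k (u i)" "\<psi> (v (Suc i))"] wd_triangle[of "\<psi> (v (Suc i))" "ax k (u i)" "\<psi> (v i)"]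
            u[of i] u[of "Suc i"] step[OF i] i wd_sym[of "\<psi> (v i)" "\<psi> (v (Suc i))"] wd_sym[of "\<psi> (v i)" "ax k (u i)"]
          by (simp add: J_def)
        then show "\<bar>real_of_int (u (Suc i)) - real_of_int (u i)\<bar> \<le> real J" unfolding ax_wd by linarith
      qed (use l h0 in \<open>auto simp: u_def\<close>)
      have "wd (ax k l) (ax k (u i)) \<le> J" unfolding ax_wd using i(2) by linarith
      then have "wd (ax k l) (\<psi> (v i)) \<le> N"
        using wd_triangle[of "ax k l" "\<psi> (v i)" "ax k (u i)"] u[OF i(1)] by (simp add: N_def)
      then show ?thesis using i(1) by blast
    qed
    obtain i0 where i0: "i0 \<le> h" "wd (ax k 0) (\<psi> (v i0)) \<le> N" using cover[of 0] by auto
    have room: "m \<le> i0" "m \<le> h - i0"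
    proof -
      have far: "real m \<le> \<bar>real i0 - real j\<bar>" if j: "j \<le> h" "wd (\<psi> (v j)) (ax k l) \<le> 3 * K" "\<bar>l\<bar> = int n" for j l
      proof -
        have "n = wd (ax k 0) (ax k l)" unfolding ax_wd using j(3) by simp
        also have "\<dots> \<le> N + wd (\<psi> (v i0)) (\<psi> (v j)) + 3 * K"
          using wd_triangle[of "ax k 0" "ax k l" "\<psi> (v i0)"] wd_triangle[of "\<psi> (v i0)" "ax k l" "\<psi> (v j)"] i0 j(2) by linarith
        finally have "real n \<le> real N + (K * \<bar>real i0 - real j\<bar> + K) + 3 * K"
          using v_upper[OF i0(1) j(1)] by linarith
        then have "real K * real m \<le> K * \<bar>real i0 - real j\<bar>" by (simp add: n_def)
        then show ?thesis using K by simp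
      qed
      from far[of 0 "- int n"] far[of h "int n"] x y v i0(1) show "m \<le> i0" "m \<le> h - i0" by auto
    qed
    define w where "w i = v (nat (int i0 + i))" for i :: int
    have w_dom: "nat (int i0 + i) \<le> h \<and> real (nat (int i0 + i)) = real i0 + real_of_int i" if "\<bar>i\<bar> \<le> int m" for i
      using that room i0(1) by auto
    show ?thesis
      unfolding axis_window_def
    proof (intro exI[of _ w] conjI allI impI)
      fix i :: int assume i: "\<bar>i\<bar> \<le> int m"
      show "w i \<in> V" unfolding w_def using w_dom[OF i] v(3) by blast
      have "wd (ax k (u (nat (int i0 + i)))) (\<psi> (w i)) \<le> N" unfolding w_def using w_dom[OF i] u N_def by (meson le_add1 order_trans le_trans)
      then show "\<exists>u. wd (ax k u) (\<psi> (w i)) \<le> N" ..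
      fix j :: int assume j: "\<bar>j\<bar> \<le> int m"
      show "d (w i) (w j) = \<bar>real_of_int (i - j)\<bar>"
        unfolding w_def using v(4) w_dom[OF i] w_dom[OF j] by simp
    next
      show "wd (ax k 0) (\<psi> (w 0)) \<le> N" using i0 by (simp add: w_def)
    next
      fix l :: int assume l: "P * nat \<bar>l\<bar> + P \<le> m"
      have "1 \<le> P" using K by (simp add: P_def)
      have "nat \<bar>l\<bar> \<le> P * nat \<bar>l\<bar>" using \<open>1 \<le> P\<close> by simp
      also have "\<dots> \<le> m" using l by simp
      also have "m \<le> K * m" using K by simp
      finally have "nat \<bar>l\<bar> \<le> n" by (simp add: n_def)
      then have "\<bar>l\<bar> \<le> int n" by linarith
      then obtain i where i: "i \<le> h" "wd (ax k l) (\<psi> (v i)) \<le> N" using cover by blast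
      have "wd (\<psi> (v i)) (\<psi> (v i0)) \<le> 2 * N + nat \<bar>l\<bar>"
        using wd_triangle[of "\<psi> (v i)" "\<psi> (v i0)" "ax k l"] wd_triangle[of "ax k l" "\<psi> (v i0)" "ax k 0"] i(2) i0(2)
          ax_wd[of k l 0] wd_sym[of "\<psi> (v i)" "ax k l"] by simp
      then have "real K * real (wd (\<psi> (v i)) (\<psi> (v i0))) \<le> real K * real (2 * N + nat \<bar>l\<bar>)"
        by (intro mult_left_mono) (simp_all only: of_nat_le_iff of_nat_0_le_iff)
      then have "\<bar>real i - real i0\<bar> \<le> real (K * (2 * N + nat \<bar>l\<bar>) + K)"
        using v_lower[OF i(1) i0(1)] by simp
      moreover have "K * (2 * N + nat \<bar>l\<bar>) + K \<le> P * nat \<bar>l\<bar> + P"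
      proof -
        have "K * nat \<bar>l\<bar> \<le> P * nat \<bar>l\<bar>" by (intro mult_le_mono) (simp_all add: P_def)
        then show ?thesis by (simp add: P_def algebra_simps)
      qed
      ultimately have "\<bar>int i - int i0\<bar> \<le> int (P * nat \<bar>l\<bar> + P)" by linarith
      moreover have "w (int i - int i0) = v i" by (simp add: w_def)
      ultimately show "\<exists>i. \<bar>i\<bar> \<le> int (P * nat \<bar>l\<bar> + P) \<and> wd (ax k l) (\<psi> (w i)) \<le> N"
        using i(2) by (intro exI[of _ "int i - int i0"]) simp
    qed
  qed
  then show ?thesis by blast
qed

theorem axis_exists:
  assumes k2: "2 \<le> k"
  obtains \<alpha> where "geodesic UNIV \<alpha>" "Morse UNIV \<alpha>"
    "fun_preceq (power_fun k) (lower_divergence \<alpha>)" "fun_preceq (lower_divergence \<alpha>) (power_fun k)"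
proof -
  obtain N P where "\<forall>m. \<exists>w. axis_window N P m w" using axis_segment[OF k2] by blast
  then obtain w where "\<forall>m. axis_window N P m (w m)" by metis
  then have w: "\<And>m i. \<bar>i\<bar> \<le> int m \<Longrightarrow> w m i \<in> V" "\<And>m i. \<bar>i\<bar> \<le> int m \<Longrightarrow> \<exists>u. wd (ax k u) (\<psi> (w m i)) \<le> N"
    "\<And>m i j. \<bar>i\<bar> \<le> int m \<Longrightarrow> \<bar>j\<bar> \<le> int m \<Longrightarrow> d (w m i) (w m j) = \<bar>real_of_int (i - j)\<bar>"
    "\<And>m. wd (ax k 0) (\<psi> (w m 0)) \<le> N"
    "\<And>m l. P * nat \<bar>l\<bar> + P \<le> m \<Longrightarrow> \<exists>i. \<bar>i\<bar> \<le> int (P * nat \<bar>l\<bar> + P) \<and> wd (ax k l) (\<psi> (w m i)) \<le> N"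
    unfolding axis_window_def by blast+
  have "d (w 0 0) (w m 0) \<le> real (K * (2 * N) + K)" for m
  proof -
    have "wd (\<psi> (w 0 0)) (\<psi> (w m 0)) \<le> 2 * N"
      using wd_triangle[of "\<psi> (w 0 0)" "\<psi> (w m 0)" "ax k 0"] w(4)[of 0] w(4)[of m] wd_sym[of "\<psi> (w 0 0)" "ax k 0"] by simp
    then have "real K * real (wd (\<psi> (w 0 0)) (\<psi> (w m 0))) \<le> real K * real (2 * N)"
      by (intro mult_left_mono) (simp_all only: of_nat_le_iff of_nat_0_le_iff)
    moreover have "w 0 0 \<in> M" "w m 0 \<in> M" using w(1)[of 0 0] w(1)[of 0 m] V_sub by auto
    ultimately show ?thesis using \<psi>_lower[of "w 0 0" "w m 0"] by simp
  qed
  with V_limit[of w] w(1,3) obtain \<alpha> where \<alpha>: "geodesic UNIV \<alpha>" "\<And>m. \<exists>m'\<ge>m. \<forall>i. \<bar>i\<bar> \<le> int m \<longrightarrow> \<alpha> (of_int i) = w m' i" by blast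
  note [simp] = geodesicD(1)[OF \<alpha>(1)]
  have "near_ax \<alpha> (N + 2 * K)"
    unfolding near_ax_def
  proof (intro conjI allI)
    fix t :: real
    obtain m' where m': "nat \<bar>\<lfloor>t\<rfloor>\<bar> \<le> m'" "\<alpha> (of_int \<lfloor>t\<rfloor>) = w m' \<lfloor>t\<rfloor>" using \<alpha>(2)[of "nat \<bar>\<lfloor>t\<rfloor>\<bar>"] by auto
    then have "\<bar>\<lfloor>t\<rfloor>\<bar> \<le> int m'" by linarith
    then obtain u where u: "wd (ax k u) (\<psi> (\<alpha> (of_int \<lfloor>t\<rfloor>))) \<le> N" using w(2)[of "\<lfloor>t\<rfloor>" m'] m'(2) by auto
    have "d (\<alpha> (of_int \<lfloor>t\<rfloor>)) (\<alpha> t) \<le> 1" unfolding geodesicD(2)[OF \<alpha>(1)] by linarith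
    then have "real K * d (\<alpha> (of_int \<lfloor>t\<rfloor>)) (\<alpha> t) \<le> real K * 1" by (intro mult_left_mono) auto
    then have "real (wd (\<psi> (\<alpha> (of_int \<lfloor>t\<rfloor>))) (\<psi> (\<alpha> t))) \<le> real (2 * K)" using \<psi>_upper[of "\<alpha> (of_int \<lfloor>t\<rfloor>)" "\<alpha> t"] by simp
    then have "wd (ax k u) (\<psi> (\<alpha> t)) \<le> N + 2 * K"
      using wd_triangle[of "ax k u" "\<psi> (\<alpha> t)" "\<psi> (\<alpha> (of_int \<lfloor>t\<rfloor>))"] u unfolding of_nat_le_iff by linarith
    then show "\<exists>u. wd (ax k u) (\<psi> (\<alpha> t)) \<le> N + 2 * K" ..
  next
    fix l :: int
    obtain m' where m': "P * nat \<bar>l\<bar> + P \<le> m'" "\<And>i. \<bar>i\<bar> \<le> int (P * nat \<bar>l\<bar> + P) \<Longrightarrow> \<alpha> (of_int i) = w m' i"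
      using \<alpha>(2)[of "P * nat \<bar>l\<bar> + P"] by auto
    obtain i where i: "\<bar>i\<bar> \<le> int (P * nat \<bar>l\<bar> + P)" "wd (ax k l) (\<psi> (w m' i)) \<le> N" using w(5)[OF m'(1)] by blast
    then have "wd (ax k l) (\<psi> (\<alpha> (of_int i))) \<le> N + 2 * K" using m'(2)[OF i(1)] by simp
    then show "\<exists>t. wd (ax k l) (\<psi> (\<alpha> t)) \<le> N + 2 * K" ..
  qed
  then show thesis
    using that[OF \<alpha>(1)] near_ax_Morse[OF k2 \<alpha>(1)] near_ax_lower[OF k2 \<alpha>(1)] runs_along_upper[OF \<alpha>(1)] near_ax_runs by blast
qed

end

section \<open>Graphs as geodesic spaces\<close>

text \<open>Diagonal argument with nested infinite index sets A n on which the windows agree over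
  [-n, n]; each is found by the pigeonhole principle, as every position has finitely many
  values.\<close>

lemma window_limit:
  fixes f :: "nat \<Rightarrow> int \<Rightarrow> 'b"
  assumes fin: "\<And>i. finite {f m i |m. \<bar>i\<bar> \<le> int m}"
  shows "\<exists>g. \<forall>m. \<exists>m'\<ge>m. \<forall>i. \<bar>i\<bar> \<le> int m \<longrightarrow> g i = f m' i"
proof -
  define good where "good n A \<longleftrightarrow> infinite A \<and> (\<forall>m\<in>A. n \<le> m) \<and> (\<forall>m\<in>A. \<forall>m'\<in>A. \<forall>i. \<bar>i\<bar> \<le> int n \<longrightarrow> f m i = f m' i)"
    for n and A :: "nat set"
  have step: "\<exists>B. good n B \<and> B \<subseteq> A" if A: "infinite A" for A n
  proof -
    let ?I = "{i. \<bar>i\<bar> \<le> int n}" and ?A = "{m \<in> A. n \<le> m}"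
    have "finite ?I" by (rule finite_subset[of _ "{- int n..int n}"]) auto
    define F where "F m = restrict (f m) ?I" for m
    have "F ` ?A \<subseteq> PiE ?I (\<lambda>i. {f m i |m. \<bar>i\<bar> \<le> int m})"
    proof
      fix y assume "y \<in> F ` ?A"
      then obtain m where m: "n \<le> m" "y = restrict (f m) ?I" by (auto simp: F_def)
      have "f m i \<in> {f m i |m. \<bar>i\<bar> \<le> int m}" if "i \<in> ?I" for i
      proof -
        have "\<bar>i\<bar> \<le> int m" using that m(1) by simp
        then show ?thesis by blast
      qed
      then show "y \<in> PiE ?I (\<lambda>i. {f m i |m. \<bar>i\<bar> \<le> int m})" unfolding m(2) by simp
    qed
    moreover have "finite (PiE ?I (\<lambda>i. {f m i |m. \<bar>i\<bar> \<le> int m}))" using \<open>finite ?I\<close> fin by (intro finite_PiE)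
    ultimately have "finite (F ` ?A)" by (rule finite_subset)
    moreover have "infinite ?A"
    proof
      assume "finite ?A"
      then have "finite (?A \<union> {..n})" by simp
      then have "finite A" by (rule rev_finite_subset) auto
      then show False using A by simp
    qed
    ultimately obtain m0 where m0: "m0 \<in> ?A" "infinite {m \<in> ?A. F m = F m0}" using pigeonhole_infinite[of ?A F] by blast
    have eq: "f m i = f m0 i" if "F m = F m0" "\<bar>i\<bar> \<le> int n" for m i
      using fun_cong[OF that(1), of i] that(2) by (simp add: F_def)
    have "good n {m \<in> ?A. F m = F m0}"
      unfolding good_def
    proof (intro conjI ballI allI impI)
      show "infinite {m \<in> ?A. F m = F m0}" by (rule m0(2))
      fix m assume m: "m \<in> {m \<in> ?A. F m = F m0}"
      then show "n \<le> m" by simp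
      fix m' i assume "m' \<in> {m \<in> ?A. F m = F m0}" "\<bar>i\<bar> \<le> int n"
      then show "f m i = f m' i" using m eq[of m i] eq[of m' i] by simp
    qed
    then show ?thesis by (intro exI[of _ "{m \<in> ?A. F m = F m0}"]) auto
  qed
  have "\<exists>A. \<forall>n. good n (A n) \<and> A (Suc n) \<subseteq> A n"
  proof (rule dependent_nat_choice)
    show "\<exists>B. good 0 B" using step[of UNIV 0] by auto
    show "\<exists>B. good (Suc n) B \<and> B \<subseteq> A" if "good n A" for A n using step[of A "Suc n"] that by (simp add: good_def)
  qed
  then obtain A where A: "\<And>n. good n (A n)" "\<And>n. A (Suc n) \<subseteq> A n" by blast
  have anti: "A n' \<subseteq> A n" if "n \<le> n'" for n n' using lift_Suc_antimono_le[of A, OF A(2) that] .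
  define g where "g i = f (SOME m. m \<in> A (nat \<bar>i\<bar>)) i" for i
  have g: "g i = f m i" if "m \<in> A n" "\<bar>i\<bar> \<le> int n" for m n i
  proof -
    have "A (nat \<bar>i\<bar>) \<noteq> {}" using A(1)[of "nat \<bar>i\<bar>"] by (auto simp: good_def)
    then have "(SOME m. m \<in> A (nat \<bar>i\<bar>)) \<in> A (nat \<bar>i\<bar>)" by (simp add: some_in_eq)
    moreover have "nat \<bar>i\<bar> \<le> n" using that(2) by linarith
    then have "m \<in> A (nat \<bar>i\<bar>)" using anti that(1) by blast
    moreover have "f m i = f m' i" if "m \<in> A (nat \<bar>i\<bar>)" "m' \<in> A (nat \<bar>i\<bar>)" for m m'
    proof -
      have "\<bar>i\<bar> \<le> int (nat \<bar>i\<bar>)" by simp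
      then show ?thesis using A(1)[of "nat \<bar>i\<bar>"] that unfolding good_def by blast
    qed
    ultimately show ?thesis unfolding g_def by blast
  qed
  have "\<exists>m'\<ge>m. \<forall>i. \<bar>i\<bar> \<le> int m \<longrightarrow> g i = f m' i" for m
  proof -
    obtain m' where "m' \<in> A m" using A(1)[of m] unfolding good_def by (metis finite.emptyI ex_in_conv)
    then show ?thesis using A(1)[of m] g unfolding good_def by blast
  qed
  then show ?thesis by blast
qed

abbreviation vert :: "'v \<Rightarrow> 'v \<Rightarrow> real" where "vert v \<equiv> edge_point v v 0"

locale metric_graph =
  fixes V :: "'v set" and E :: "'v set set"
  assumes simplicial: "simplicial_graph V E"
    and metric: "Metric_space (graph_points V E) (graph_dist V E)"
    and locally_finite: "v \<in> V \<Longrightarrow> finite {u. {v, u} \<in> E}"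
begin

sublocale Metric_space "graph_points V E" "graph_dist V E" by (rule metric)

lemma edgeD: "{u, v} \<in> E \<Longrightarrow> u \<in> V \<and> v \<in> V \<and> u \<noteq> v"
  using simplicial unfolding simplicial_graph_def by (fastforce simp: card_insert_if split: if_splits)

lemma vert_points: "v \<in> V \<Longrightarrow> vert v \<in> graph_points V E"
  by (auto simp: graph_points_def)

lemma edge_point_points: "{u, v} \<in> E \<Longrightarrow> t \<in> {0..1} \<Longrightarrow> edge_point u v t \<in> graph_points V E"
  by (auto simp: graph_points_def)

lemma chain_exists:
  assumes "x \<in> graph_points V E" "y \<in> graph_points V E" shows "\<exists>l. graph_chain V E x y l"
proof (cases "x = y")
  case True
  then show ?thesis using graph_chain.nil assms by blast
next
  case False
  then have "graph_dist V E x y \<noteq> 0" using assms by simp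
  then show ?thesis by (auto simp: graph_dist_def split: if_splits)
qed

lemma graph_dist_le: assumes "graph_chain V E x y l" shows "graph_dist V E x y \<le> l"
proof -
  have "bdd_below {l. graph_chain V E x y l}" using graph_chain_points(3) by (intro bdd_belowI[of _ 0]) auto
  then show ?thesis using assms cInf_lower[of l "{l. graph_chain V E x y l}"] by (auto simp: graph_dist_def)
qed

lemma graph_dist_ge:
  assumes "x \<in> graph_points V E" "y \<in> graph_points V E" "\<And>l. graph_chain V E x y l \<Longrightarrow> a \<le> l"
  shows "a \<le> graph_dist V E x y"
  using chain_exists[OF assms(1,2)] assms(3) by (auto simp: graph_dist_def intro!: cInf_greatest)

lemma graph_dist_edge:
  assumes "{u, v} \<in> E" "s \<in> {0..1}" "t \<in> {0..1}"
  shows "graph_dist V E (edge_point u v s) (edge_point u v t) \<le> \<bar>s - t\<bar>"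
  using graph_dist_le[OF graph_chain.step[OF assms graph_chain.nil[OF edge_point_points[OF assms(1,3)]]]] by simp

lemma chain_joined: "graph_chain V E x y l \<Longrightarrow> joined (graph_points V E) l x y"
proof (induction rule: graph_chain.induct)
  case (nil x)
  then show ?case by (intro joined_refl) auto
next
  case (step u v s t y l)
  define c where "c \<tau> = edge_point u v (s + sgn (t - s) * \<tau>)" for \<tau>
  have in01: "s + sgn (t - s) * \<tau> \<in> {0..1}" if "\<tau> \<in> {0..\<bar>s - t\<bar>}" for \<tau>
    using that step.hyps by (auto simp: sgn_if)
  have "c \<tau> \<in> graph_points V E" if "\<tau> \<in> {0..\<bar>s - t\<bar>}" for \<tau>
    unfolding c_def using edge_point_points[OF step.hyps(1) in01[OF that]] .
  moreover have "graph_dist V E (c \<tau>) (c \<tau>') \<le> \<bar>\<tau> - \<tau>'\<bar>" if "\<tau> \<in> {0..\<bar>s - t\<bar>}" "\<tau>' \<in> {0..\<bar>s - t\<bar>}" for \<tau> \<tau>'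
  proof -
    have "graph_dist V E (c \<tau>) (c \<tau>') \<le> \<bar>(s + sgn (t - s) * \<tau>) - (s + sgn (t - s) * \<tau>')\<bar>"
      unfolding c_def by (rule graph_dist_edge[OF step.hyps(1) in01[OF that(1)] in01[OF that(2)]])
    also have "\<dots> \<le> \<bar>\<tau> - \<tau>'\<bar>" by (simp add: sgn_if abs_minus_commute)
    finally show ?thesis .
  qed
  moreover have "c 0 = edge_point u v s" by (simp add: c_def)
  moreover have "c \<bar>s - t\<bar> = edge_point u v t" by (auto simp: c_def sgn_if abs_if)
  ultimately have "joined (graph_points V E) \<bar>s - t\<bar> (edge_point u v s) (edge_point u v t)"
    unfolding joined_def by (intro conjI exI[of _ c]) auto
  then show ?case using step.IH by (rule joined_trans)
qed

lemma graph_length_space: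
  assumes "x \<in> graph_points V E" "y \<in> graph_points V E"
  shows "\<exists>l\<le>graph_dist V E x y + 1. joined (graph_points V E) l x y"
proof -
  have "Inf {l. graph_chain V E x y l} < graph_dist V E x y + 1" using chain_exists[OF assms] by (simp add: graph_dist_def)
  then obtain l where "graph_chain V E x y l" "l < graph_dist V E x y + 1"
    using chain_exists[OF assms] cInf_lessD[of "{l. graph_chain V E x y l}"] by auto
  then show ?thesis using chain_joined by (intro exI[of _ l]) auto
qed

section \<open>Distances between vertices\<close>

definition adj_rel :: "('v \<times> 'v) set" where "adj_rel = {(u, v). {u, v} \<in> E}"

definition walk_dist :: "'v \<Rightarrow> 'v \<Rightarrow> nat" where "walk_dist u v = (LEAST n. (u, v) \<in> adj_rel ^^ n)"

text \<open>The nonzero coordinates of a point are ends of the edge that carries it; following them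
  along the chain gives a walk.\<close>

lemma chain_connected:
  "graph_chain V E x y l \<Longrightarrow> x p \<noteq> 0 \<Longrightarrow> y q \<noteq> 0 \<Longrightarrow> (p, q) \<in> adj_rel\<^sup>*"
proof (induction arbitrary: p rule: graph_chain.induct)
  case (nil x)
  then consider u where "x = vert u" | u v t where "{u, v} \<in> E" "x = edge_point u v t" by (auto simp: graph_points_def)
  then show ?case
  proof cases
    case 1
    then show ?thesis using nil by (auto simp: edge_point_def indicator_def split: if_splits)
  next
    case 2
    then have "p \<in> {u, v}" "q \<in> {u, v}" using nil by (auto simp: edge_point_def indicator_def split: if_splits)
    moreover have "(u, v) \<in> adj_rel" "(v, u) \<in> adj_rel" using 2 by (auto simp: adj_rel_def insert_commute)
    ultimately show ?thesis by auto
  qed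
next
  case (step u v s t y l)
  have p: "p \<in> {u, v}" using step.prems by (auto simp: edge_point_def indicator_def split: if_splits)
  have "u \<noteq> v" using edgeD step.hyps by blast
  then have "edge_point u v t u \<noteq> 0 \<or> edge_point u v t v \<noteq> 0" by (auto simp: edge_point_def)
  then obtain p' where "p' \<in> {u, v}" "edge_point u v t p' \<noteq> 0" by blast
  then have "(p', q) \<in> adj_rel\<^sup>*" using step by blast
  moreover have "(p, p') \<in> adj_rel\<^sup>*" using p \<open>p' \<in> _\<close> step.hyps(1) by (auto simp: adj_rel_def insert_commute)
  ultimately show ?case by (rule rtrancl_trans[rotated])
qed

lemma walk_dist_relpow: assumes "u \<in> V" "v \<in> V" shows "(u, v) \<in> adj_rel ^^ walk_dist u v"
proof -
  obtain l where "graph_chain V E (vert u) (vert v) l" using chain_exists vert_points assms by blast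
  from chain_connected[OF this, of u v] have "(u, v) \<in> adj_rel\<^sup>*" by (simp add: edge_point_def)
  then show ?thesis unfolding walk_dist_def by (metis LeastI rtrancl_imp_relpow)
qed

lemma walk_dist_le: "(u, v) \<in> adj_rel ^^ n \<Longrightarrow> walk_dist u v \<le> n"
  unfolding walk_dist_def by (rule Least_le)

lemma walk_dist_self [simp]: "walk_dist u u = 0"
  using walk_dist_le[of u u 0] by simp

lemma walk_dist_edge:
  assumes "g \<in> V" "{u, v} \<in> E" shows "walk_dist g v \<le> walk_dist g u + 1"
proof -
  have "(g, u) \<in> adj_rel ^^ walk_dist g u" using walk_dist_relpow assms edgeD by blast
  then have "(g, v) \<in> adj_rel ^^ Suc (walk_dist g u)" using assms(2) by (auto simp: adj_rel_def)
  then show ?thesis using walk_dist_le by fastforce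
qed

text \<open>The distance from the vertex \<open>g\<close>, extended to the edges by a formula that
  does not depend on how a point is presented. It is 1-Lipschitz, and so bounds from below a metric
  that is an infimum over chains.\<close>

definition potential :: "'v \<Rightarrow> ('v \<Rightarrow> real) \<Rightarrow> real" where
  "potential g x = Min ((\<lambda>v. real (walk_dist g v) + 1 - x v) ` {v. x v \<noteq> 0})"

lemma potential_edge:
  fixes t :: real
  assumes "g \<in> V" "{u, v} \<in> E" "t \<in> {0..1}"
  shows "potential g (edge_point u v t) = min (walk_dist g u + t) (walk_dist g v + 1 - t)"
proof -
  have uv: "u \<noteq> v" using edgeD assms(2) by blast
  have le: "walk_dist g v \<le> walk_dist g u + 1" "walk_dist g u \<le> walk_dist g v + 1"
    using walk_dist_edge[OF assms(1), of u v] walk_dist_edge[OF assms(1), of v u] assms(2) by (simp_all add: insert_commute)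
  consider "t = 0" | "t = 1" | "0 < t" "t < 1" using assms(3) by fastforce
  then show ?thesis
  proof cases
    case 1
    then have "{w. edge_point u v t w \<noteq> 0} = {u}" by (auto simp: edge_point_def indicator_def)
    then show ?thesis using 1 uv le by (simp add: potential_def edge_point_def)
  next
    case 2
    then have "{w. edge_point u v t w \<noteq> 0} = {v}" by (auto simp: edge_point_def indicator_def)
    then show ?thesis using 2 uv le by (simp add: potential_def edge_point_def)
  next
    case 3
    then have "{w. edge_point u v t w \<noteq> 0} = {u, v}" using uv by (auto simp: edge_point_def indicator_def)
    then show ?thesis using 3 uv by (simp add: potential_def edge_point_def)
  qed
qed

lemma potential_vert: "potential g (vert v) = walk_dist g v"
proof -
  have "{w. vert v w \<noteq> 0} = {v}" by (auto simp: edge_point_def indicator_def)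
  then show ?thesis by (simp add: potential_def edge_point_def)
qed

lemma potential_chain: assumes "g \<in> V" "graph_chain V E x y l" shows "\<bar>potential g x - potential g y\<bar> \<le> l"
  using assms(2)
proof (induction rule: graph_chain.induct)
  case (step u v s t y l)
  have "\<bar>potential g (edge_point u v s) - potential g (edge_point u v t)\<bar> \<le> \<bar>s - t\<bar>"
    unfolding potential_edge[OF assms(1) step.hyps(1,2)] potential_edge[OF assms(1) step.hyps(1,3)] by (auto simp: min_def)
  with step.IH show ?case by linarith
qed simp

lemma potential_lipschitz:
  assumes "g \<in> V" "x \<in> graph_points V E" "y \<in> graph_points V E"
  shows "\<bar>potential g x - potential g y\<bar> \<le> graph_dist V E x y"
  using assms(2,3) potential_chain[OF assms(1)] by (rule graph_dist_ge)

lemma dist_adjacent: "{u, v} \<in> E \<Longrightarrow> graph_dist V E (vert u) (vert v) \<le> 1"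
  using graph_dist_edge[of u v 0 1] by (simp add: edge_point_0[of u v] edge_point_1[of u v])

lemma dist_relpow: "(u, v) \<in> adj_rel ^^ n \<Longrightarrow> u \<in> V \<Longrightarrow> v \<in> V \<and> graph_dist V E (vert u) (vert v) \<le> n"
proof (induction n arbitrary: v)
  case 0
  then show ?case using vert_points by simp
next
  case (Suc n)
  then obtain w where w: "(u, w) \<in> adj_rel ^^ n" "{w, v} \<in> E" by (auto simp: adj_rel_def)
  then have "w \<in> V" "graph_dist V E (vert u) (vert w) \<le> n" "v \<in> V" using Suc edgeD by blast+
  then show ?case using triangle[of "vert u" "vert w" "vert v"] dist_adjacent[OF w(2)] Suc.prems vert_points by auto
qed

lemma dist_vert: assumes "u \<in> V" "v \<in> V" shows "graph_dist V E (vert u) (vert v) = walk_dist u v"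
proof (rule antisym)
  show "graph_dist V E (vert u) (vert v) \<le> walk_dist u v" using dist_relpow[OF walk_dist_relpow[OF assms]] assms by blast
  show "walk_dist u v \<le> graph_dist V E (vert u) (vert v)"
    using potential_lipschitz[OF assms(1) vert_points[OF assms(1)] vert_points[OF assms(2)]] by (simp add: potential_vert)
qed

lemma near_vert:
  assumes "x \<in> graph_points V E" shows "\<exists>v\<in>V. graph_dist V E x (vert v) \<le> 1"
proof -
  from assms consider u where "u \<in> V" "x = vert u" | u v t where "{u, v} \<in> E" "t \<in> {0..1}" "x = edge_point u v t"
    by (auto simp: graph_points_def)
  then show ?thesis
  proof cases
    case 1
    then show ?thesis using vert_points by (intro bexI[of _ u]) auto
  next
    case 2
    then show ?thesis using graph_dist_edge[OF 2(1,2), of 0] edgeD[OF 2(1)]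
      by (intro bexI[of _ u]) (auto simp: edge_point_0[of u v])
  qed
qed

lemma vert_geodesic:
  assumes "x \<in> vert ` V" "y \<in> vert ` V"
  shows "\<exists>n v. v 0 = x \<and> v n = y \<and> (\<forall>i\<le>n. v i \<in> vert ` V) \<and>
      (\<forall>i\<le>n. \<forall>j\<le>n. graph_dist V E (v i) (v j) = \<bar>real i - real j\<bar>)"
proof -
  obtain p q where pq: "p \<in> V" "q \<in> V" "x = vert p" "y = vert q" using assms by blast
  define n where "n = walk_dist p q"
  obtain f where f: "f 0 = p" "f n = q" "\<And>i. i < n \<Longrightarrow> (f i, f (Suc i)) \<in> adj_rel"
    using walk_dist_relpow[OF pq(1,2)] unfolding relpow_fun_conv n_def by blast
  have fV: "f i \<in> V" if "i \<le> n" for i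
  proof (cases "i = n")
    case False
    then show ?thesis using f(3)[of i] edgeD[of "f i" "f (Suc i)"] that by (simp add: adj_rel_def)
  qed (use f pq in simp)
  have le: "graph_dist V E (vert (f i)) (vert (f j)) \<le> real j - real i" if "i \<le> j" "j \<le> n" for i j
    using that
  proof (induction rule: dec_induct)
    case base
    then show ?case using fV vert_points by simp
  next
    case (step j)
    have "graph_dist V E (vert (f j)) (vert (f (Suc j))) \<le> 1"
      using f(3)[of j] step dist_adjacent by (simp add: adj_rel_def)
    then show ?case using step triangle[of "vert (f i)" "vert (f j)" "vert (f (Suc j))"] fV vert_points by simp
  qed
  have eq: "graph_dist V E (vert (f i)) (vert (f j)) = real j - real i" if "i \<le> j" "j \<le> n" for i j
  proof (rule antisym[OF le[OF that]])
    have "real n = graph_dist V E (vert (f 0)) (vert (f n))" using dist_vert[OF pq(1,2)] f by (simp add: n_def)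
    also have "\<dots> \<le> graph_dist V E (vert (f 0)) (vert (f i)) + (graph_dist V E (vert (f i)) (vert (f j)) + graph_dist V E (vert (f j)) (vert (f n)))"
      using triangle[of "vert (f 0)" "vert (f i)" "vert (f n)"] triangle[of "vert (f i)" "vert (f j)" "vert (f n)"]
        fV[of 0] fV[of i] fV[of j] fV[of n] vert_points that by auto
    finally show "real j - real i \<le> graph_dist V E (vert (f i)) (vert (f j))"
      using le[of 0 i] le[of j n] that by simp
  qed
  have "graph_dist V E (vert (f i)) (vert (f j)) = \<bar>real i - real j\<bar>" if "i \<le> n" "j \<le> n" for i j
    using eq[of i j] eq[of j i] that commute[of "vert (f i)" "vert (f j)"] by (cases "i \<le> j") auto
  then show ?thesis using f pq fV by (intro exI[of _ n] exI[of _ "\<lambda>i. vert (f i)"]) auto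
qed

lemma finite_ball: assumes "g \<in> V" shows "finite {v \<in> V. walk_dist g v \<le> n}"
proof (induction n)
  case 0
  have "{v \<in> V. walk_dist g v \<le> 0} \<subseteq> {g}" using walk_dist_relpow[OF assms] by fastforce
  then show ?case by (rule finite_subset) simp
next
  case (Suc n)
  have "{v \<in> V. walk_dist g v \<le> Suc n} \<subseteq> {v \<in> V. walk_dist g v \<le> n} \<union> (\<Union>u\<in>{v \<in> V. walk_dist g v \<le> n}. {v. {u, v} \<in> E})"
  proof
    fix v assume v: "v \<in> {v \<in> V. walk_dist g v \<le> Suc n}"
    show "v \<in> {v \<in> V. walk_dist g v \<le> n} \<union> (\<Union>u\<in>{v \<in> V. walk_dist g v \<le> n}. {v. {u, v} \<in> E})"
    proof (cases "walk_dist g v \<le> n")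
      case False
      then have "(g, v) \<in> adj_rel ^^ Suc n" using walk_dist_relpow[OF assms, of v] v by (simp add: le_Suc_eq)
      then obtain u where u: "(g, u) \<in> adj_rel ^^ n" "{u, v} \<in> E" by (auto simp: adj_rel_def)
      then show ?thesis using walk_dist_le[OF u(1)] edgeD[OF u(2)] by auto
    qed (use v in simp)
  qed
  moreover have "finite ({v \<in> V. walk_dist g v \<le> n} \<union> (\<Union>u\<in>{v \<in> V. walk_dist g v \<le> n}. {v. {u, v} \<in> E}))"
    using Suc locally_finite by simp
  ultimately show ?case by (rule finite_subset)
qed

text \<open>Upper bounds come from concatenating edges, lower bounds from the potential of a vertex
  of the line to the left of both points, which grows with slope 1 along the line.\<close>

lemma geodesic_extension:
  assumes h: "\<And>i. h i \<in> V" "\<And>i j. walk_dist (h i) (h j) = nat \<bar>i - j\<bar>"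
  shows "geodesic UNIV (\<lambda>t. edge_point (h \<lfloor>t\<rfloor>) (h (\<lfloor>t\<rfloor> + 1)) (t - of_int \<lfloor>t\<rfloor>))"
proof -
  define \<alpha> where "\<alpha> t = edge_point (h \<lfloor>t\<rfloor>) (h (\<lfloor>t\<rfloor> + 1)) (t - of_int \<lfloor>t\<rfloor>)" for t :: real
  have edge: "{h i, h (i + 1)} \<in> E" for i
    using walk_dist_relpow[OF h(1) h(1), of i "i + 1"] h(2)[of i "i + 1"] by (simp add: adj_rel_def)
  have frac: "t - of_int \<lfloor>t\<rfloor> \<in> {0..1}" for t :: real by (auto, linarith)
  have \<alpha>_on: "\<alpha> t = edge_point (h i) (h (i + 1)) (t - of_int i)" if "of_int i \<le> t" "t \<le> of_int i + 1" for t i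
  proof (cases "t = of_int i + 1")
    case True
    then have "\<lfloor>t\<rfloor> = i + 1" by simp
    then have "\<alpha> t = vert (h (i + 1))" using True edge_point_0[of "h (i + 1)" "h (i + 1 + 1)"] by (simp add: \<alpha>_def)
    then show ?thesis using True edge_point_1[of "h i" "h (i + 1)"] by simp
  next
    case False
    then have "\<lfloor>t\<rfloor> = i" using that by (simp add: floor_eq_iff)
    then show ?thesis by (simp add: \<alpha>_def)
  qed
  have \<alpha>_int: "\<alpha> (of_int i) = vert (h i)" for i using edge_point_0[of "h i" "h (i + 1)"] by (simp add: \<alpha>_def)
  have \<alpha>M: "\<alpha> t \<in> graph_points V E" for t unfolding \<alpha>_def by (rule edge_point_points[OF edge frac])
  have upper: "graph_dist V E (\<alpha> s) (\<alpha> t) \<le> t - s" if "s \<le> t" for s t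
  proof (cases "t \<le> of_int \<lfloor>s\<rfloor> + 1")
    case True
    then have "\<alpha> t = edge_point (h \<lfloor>s\<rfloor>) (h (\<lfloor>s\<rfloor> + 1)) (t - of_int \<lfloor>s\<rfloor>)" using that by (intro \<alpha>_on) linarith+
    moreover have "t - of_int \<lfloor>s\<rfloor> \<in> {0..1}" using True that by auto linarith
    ultimately show ?thesis using graph_dist_edge[OF edge frac, of "t - of_int \<lfloor>s\<rfloor>" "\<lfloor>s\<rfloor>" s] that by (simp add: \<alpha>_def)
  next
    case False
    define i where "i = \<lfloor>s\<rfloor> + 1"
    define j where "j = \<lfloor>t\<rfloor>"
    have ij: "s \<le> of_int i" "of_int i \<le> t" "of_int i - 1 \<le> s" "of_int j \<le> t" "t \<le> of_int j + 1" "i \<le> j"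
      using False unfolding i_def j_def by linarith+
    have "graph_dist V E (\<alpha> s) (\<alpha> (of_int i)) \<le> of_int i - s"
      using \<alpha>_on[of "i - 1" s] \<alpha>_on[of "i - 1" "of_int i"] ij graph_dist_edge[OF edge[of "i - 1"], of "s - of_int (i - 1)" "of_int i - of_int (i - 1)"] by simp
    moreover have "graph_dist V E (\<alpha> (of_int i)) (\<alpha> (of_int j)) = of_int j - of_int i"
      unfolding \<alpha>_int dist_vert[OF h(1) h(1)] h(2) using ij(6) by simp
    moreover have "graph_dist V E (\<alpha> (of_int j)) (\<alpha> t) \<le> t - of_int j"
      using \<alpha>_on[of j "of_int j"] \<alpha>_on[of j t] ij graph_dist_edge[OF edge[of j], of 0 "t - of_int j"] by simp
    ultimately show ?thesis
      using triangle[of "\<alpha> s" "\<alpha> (of_int i)" "\<alpha> t"] triangle[of "\<alpha> (of_int i)" "\<alpha> (of_int j)" "\<alpha> t"] \<alpha>M by simp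
  qed
  have lower: "t - s \<le> graph_dist V E (\<alpha> s) (\<alpha> t)" if "s \<le> t" for s t
  proof -
    define n where "n = \<bar>\<lfloor>s\<rfloor>\<bar>"
    have pot: "potential (h (- n)) (\<alpha> t) = of_int n + t" if "of_int (- n) \<le> t" for t
    proof -
      have "- n \<le> \<lfloor>t\<rfloor>" using that by (simp add: le_floor_iff)
      then show ?thesis
        unfolding \<alpha>_def potential_edge[OF h(1) edge frac] h(2) by (simp add: min_def) linarith
    qed
    have "of_int (- n) \<le> s" unfolding n_def by linarith
    then have "\<bar>potential (h (- n)) (\<alpha> s) - potential (h (- n)) (\<alpha> t)\<bar> = t - s" using pot[of s] pot[of t] that by simp
    then show ?thesis using potential_lipschitz[OF h(1) \<alpha>M \<alpha>M, of "- n" s t] by simp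
  qed
  have "graph_dist V E (\<alpha> s) (\<alpha> t) = \<bar>s - t\<bar>" for s t
    using upper[of s t] lower[of s t] upper[of t s] lower[of t s] commute[of "\<alpha> s" "\<alpha> t"] by (cases "s \<le> t") auto
  then have "geodesic UNIV \<alpha>" unfolding geodesic_def quasi_geodesic_def using \<alpha>M by auto
  then show ?thesis unfolding \<alpha>_def .
qed

lemma vert_limit:
  assumes w: "\<And>m i. \<bar>i\<bar> \<le> int m \<Longrightarrow> w m i \<in> vert ` V"
      "\<And>m i j. \<bar>i\<bar> \<le> int m \<Longrightarrow> \<bar>j\<bar> \<le> int m \<Longrightarrow> graph_dist V E (w m i) (w m j) = \<bar>real_of_int (i - j)\<bar>"
      "\<And>m. graph_dist V E (w 0 0) (w m 0) \<le> C"
  shows "\<exists>\<alpha>. geodesic UNIV \<alpha> \<and> (\<forall>m. \<exists>m'\<ge>m. \<forall>i. \<bar>i\<bar> \<le> int m \<longrightarrow> \<alpha> (of_int i) = w m' i)"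
proof -
  obtain g0 where g0: "g0 \<in> V" "w 0 0 = vert g0" using w(1)[of 0 0] by auto
  have fin: "finite {w m i |m. \<bar>i\<bar> \<le> int m}" for i
  proof -
    have "{w m i |m. \<bar>i\<bar> \<le> int m} \<subseteq> vert ` {v \<in> V. walk_dist g0 v \<le> nat \<lceil>C + \<bar>real_of_int i\<bar>\<rceil>}"
    proof safe
      fix m assume m: "\<bar>i\<bar> \<le> int m"
      obtain v where v: "v \<in> V" "w m i = vert v" using w(1)[OF m] by auto
      have M: "w m 0 \<in> graph_points V E" "w m i \<in> graph_points V E" "w 0 0 \<in> graph_points V E"
        using w(1)[of 0 m] w(1)[OF m] w(1)[of 0 0] vert_points by auto
      have "real (walk_dist g0 v) = graph_dist V E (w 0 0) (w m i)" using dist_vert g0 v by simp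
      also have "\<dots> \<le> C + \<bar>real_of_int i\<bar>"
        using triangle[OF M(3,1,2)] w(2)[of 0 m i] w(3)[of m] m by simp
      finally have "walk_dist g0 v \<le> nat \<lceil>C + \<bar>real_of_int i\<bar>\<rceil>" by linarith
      then show "w m i \<in> vert ` {v \<in> V. walk_dist g0 v \<le> nat \<lceil>C + \<bar>real_of_int i\<bar>\<rceil>}" using v by auto
    qed
    then show ?thesis using finite_ball[OF g0(1)] by (rule finite_subset[OF _ finite_imageI])
  qed
  obtain g where g: "\<forall>m. \<exists>m'\<ge>m. \<forall>i. \<bar>i\<bar> \<le> int m \<longrightarrow> g i = w m' i" using window_limit[of w, OF fin] ..
  have gV: "g i \<in> vert ` V \<and> graph_dist V E (g i) (g j) = \<bar>real_of_int (i - j)\<bar>" for i j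
  proof -
    obtain m' where m': "nat (max \<bar>i\<bar> \<bar>j\<bar>) \<le> m'" "\<And>l. \<bar>l\<bar> \<le> int (nat (max \<bar>i\<bar> \<bar>j\<bar>)) \<Longrightarrow> g l = w m' l"
      using spec[OF g, of "nat (max \<bar>i\<bar> \<bar>j\<bar>)"] by auto
    have "\<bar>i\<bar> \<le> int m'" "\<bar>j\<bar> \<le> int m'" using m'(1) by linarith+
    moreover have "g i = w m' i" "g j = w m' j" by (rule m'(2), linarith)+
    ultimately show ?thesis using w(1,2) by simp
  qed
  have "\<exists>v. v \<in> V \<and> g i = vert v" for i
    by (rule imageE[OF conjunct1[OF gV[of i i]]], rule exI, rule conjI)
  then obtain h where "\<forall>i. h i \<in> V \<and> g i = vert (h i)"
    using choice[of "\<lambda>i v. v \<in> V \<and> g i = vert v"] by auto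
  then have h: "\<And>i. h i \<in> V" "\<And>i. g i = vert (h i)" by simp_all
  have "walk_dist (h i) (h j) = nat \<bar>i - j\<bar>" for i j
  proof -
    have "real (walk_dist (h i) (h j)) = \<bar>real_of_int (i - j)\<bar>"
      using gV[of i j] dist_vert[OF h(1) h(1), of i j] by (simp add: h(2))
    then show ?thesis by linarith
  qed
  from geodesic_extension[of h, OF h(1) this]
  have "geodesic UNIV (\<lambda>t. edge_point (h \<lfloor>t\<rfloor>) (h (\<lfloor>t\<rfloor> + 1)) (t - of_int \<lfloor>t\<rfloor>))" .
  moreover have "edge_point (h \<lfloor>real_of_int i\<rfloor>) (h (\<lfloor>real_of_int i\<rfloor> + 1)) (real_of_int i - of_int \<lfloor>real_of_int i\<rfloor>) = g i" for i
    using edge_point_0[of "h i" "h (i + 1)"] by (simp add: h(2))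
  then have "\<forall>m. \<exists>m'\<ge>m. \<forall>i. \<bar>i\<bar> \<le> int m \<longrightarrow> edge_point (h \<lfloor>real_of_int i\<rfloor>) (h (\<lfloor>real_of_int i\<rfloor> + 1)) (real_of_int i - of_int \<lfloor>real_of_int i\<rfloor>) = w m' i"
    using g by (simp only: simp_thms)
  ultimately show ?thesis by (rule_tac exI) (rule conjI)
qed

end

section \<open>Cayley graphs\<close>

lemma cayley_metric_graph:
  fixes G (structure)
  assumes "group G" and T: "finite_generating_set G T"
  shows "metric_graph (carrier G) (cayley_edges G T)"
proof (rule metric_graph.intro)
  interpret group G by fact
  have TG: "T \<subseteq> carrier G" "finite T" using T by (auto simp: finite_generating_set_def)
  show "simplicial_graph (carrier G) (cayley_edges G T)"
    unfolding simplicial_graph_def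
  proof
    fix e assume "e \<in> cayley_edges G T"
    then obtain g s where e: "e = {g, g \<otimes> s}" "g \<in> carrier G" "s \<in> T" "s \<noteq> \<one>" by (auto simp: cayley_edges_def)
    then have "s \<in> carrier G" "g \<otimes> s \<noteq> g" using TG by (auto simp: subset_iff)
    then show "e \<subseteq> carrier G \<and> card e = 2" using e by (auto simp: card_insert_if)
  qed
  show "Metric_space (graph_points (carrier G) (cayley_edges G T)) (graph_dist (carrier G) (cayley_edges G T))"
    using metric_space_cayley[OF assms] by (simp add: cayley_points_def cayley_dist_def)
  fix v assume v: "v \<in> carrier G"
  have "{u. {v, u} \<in> cayley_edges G T} \<subseteq> (\<lambda>s. v \<otimes> s) ` T \<union> (\<lambda>s. v \<otimes> inv s) ` T"
  proof
    fix u assume "u \<in> {u. {v, u} \<in> cayley_edges G T}"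
    then obtain g s where "{v, u} = {g, g \<otimes> s}" "g \<in> carrier G" "s \<in> T" by (auto simp: cayley_edges_def)
    then consider "u = v \<otimes> s" "s \<in> T" | "v = u \<otimes> s" "u \<in> carrier G" "s \<in> T" by (auto simp: doubleton_eq_iff)
    then show "u \<in> (\<lambda>s. v \<otimes> s) ` T \<union> (\<lambda>s. v \<otimes> inv s) ` T"
    proof cases
      case 2
      then have "u = v \<otimes> inv s" using TG by (auto simp: m_assoc subset_iff)
      then show ?thesis using 2 by auto
    qed auto
  qed
  then show "finite {u. {v, u} \<in> cayley_edges G T}" 
    by (rule finite_subset) (simp add: TG(2))
qed

text \<open>The bound is uniform in \<open>g\<close>; applied to the standard generators it compares
  them with an arbitrary generating set.\<close>

lemma cayley_dist_translate:
  fixes G (structure)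
  assumes G: "group G" and T: "finite_generating_set G T" and h: "h \<in> carrier G"
  shows "\<exists>n::nat. \<forall>g\<in>carrier G. cayley_dist G T (vert g) (vert (g \<otimes> h)) \<le> n"
proof -
  interpret group G by fact
  interpret metric_graph "carrier G" "cayley_edges G T" by (rule cayley_metric_graph[OF G T])
  have TG: "T \<subseteq> carrier G" using T by (auto simp: finite_generating_set_def)
  let ?d = "graph_dist (carrier G) (cayley_edges G T)"
  have T_step: "?d (vert g) (vert (g \<otimes> s)) \<le> 1" if "g \<in> carrier G" "s \<in> T" for g s
  proof (cases "s = \<one>")
    case True
    then show ?thesis using that vert_points by simp
  next
    case False
    then show ?thesis using that by (intro dist_adjacent) (auto simp: cayley_edges_def)
  qed
  have "h \<in> generate G T" using h T by (simp add: finite_generating_set_def)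
  then have "\<exists>n::nat. \<forall>g\<in>carrier G. ?d (vert g) (vert (g \<otimes> h)) \<le> n"
  proof (induction rule: generate.induct)
    case one
    then show ?case using vert_points by (intro exI[of _ 0]) simp
  next
    case (incl s)
    then show ?case using T_step by (intro exI[of _ 1]) simp
  next
    case (inv s)
    have "?d (vert g) (vert (g \<otimes> inv s)) \<le> 1" if g: "g \<in> carrier G" for g
    proof -
      have s: "s \<in> carrier G" using inv TG by auto
      then have "?d (vert (g \<otimes> inv s)) (vert (g \<otimes> inv s \<otimes> s)) \<le> 1" using T_step[of "g \<otimes> inv s" s] inv g by simp
      then show ?thesis using g s by (simp add: m_assoc commute)
    qed
    then show ?case by (intro exI[of _ 1]) simp
  next
    case (eng h1 h2)
    obtain n1 n2 :: nat where n: "\<forall>g\<in>carrier G. ?d (vert g) (vert (g \<otimes> h1)) \<le> n1" "\<forall>g\<in>carrier G. ?d (vert g) (vert (g \<otimes> h2)) \<le> n2"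
      using eng.IH by blast
    have h: "h1 \<in> carrier G" "h2 \<in> carrier G" using eng generate_in_carrier[OF TG] by auto
    have "?d (vert g) (vert (g \<otimes> (h1 \<otimes> h2))) \<le> n1 + n2" if g: "g \<in> carrier G" for g
    proof -
      have "?d (vert g) (vert (g \<otimes> h1 \<otimes> h2)) \<le> ?d (vert g) (vert (g \<otimes> h1)) + ?d (vert (g \<otimes> h1)) (vert (g \<otimes> h1 \<otimes> h2))"
        using g h vert_points by (intro triangle) auto
      also have "\<dots> \<le> real n1 + real n2" using n g h by (intro add_mono) auto
      finally show ?thesis using g h by (simp add: m_assoc)
    qed
    then show ?case by (intro exI[of _ "n1 + n2"]) simp
  qed
  then show ?thesis by (simp add: cayley_dist_def)
qed

section \<open>The groups \<open>G_omega k\<close> as special subgroups of a single group\<close>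

abbreviation omega_rel :: "nat \<Rightarrow> (omega_vertex list \<times> omega_vertex list) set" where
  "omega_rel k \<equiv> racg_rel (omega_vertices k) (omega_edges k)"

lemma racg_eq_word:
  "racg_eq (omega_vertices k) (omega_edges k) x y \<Longrightarrow> word (map (Ix k) x) = word (map (Ix k) y)"
proof (induction rule: racg_eq.induct)
  case (square x y s)
  then show ?case using rac_eq.square[of "map (Ix k) x" "Ix k s" "map (Ix k) y"] by (simp add: word_eq_iff)
next
  case (commute x y s t)
  then show ?case using rac_eq.commute[of "Ix k s" "Ix k t" "map (Ix k) x" "map (Ix k) y"] by (simp add: word_eq_iff)
qed auto

text \<open>A left inverse of \<open>map (Ix k)\<close> that respects the relations
  (\<open>rac_eq_unindex\<close>); this makes \<open>embed\<close> injective.\<close>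

definition unindex :: "nat \<Rightarrow> indexed_vertex list \<Rightarrow> omega_vertex list" where
  "unindex k x = map (case_indexed_vertex (\<lambda>_ v. v)) (filter (\<lambda>s. s \<in> letters k) x)"

lemma unindex_lists: "unindex k x \<in> lists (omega_vertices k)"
  by (auto simp: unindex_def in_lists_conv_set)

lemma unindex_map: "x \<in> lists (omega_vertices k) \<Longrightarrow> unindex k (map (Ix k) x) = x"
  by (induction x) (auto simp: unindex_def)

lemma rac_eq_unindex:
  assumes "1 \<le> k" "rac_eq x y"
  shows "racg_eq (omega_vertices k) (omega_edges k) (unindex k x) (unindex k y)"
  using assms(2)
proof (induction rule: rac_eq.induct)
  case (square x s y)
  show ?case
  proof (cases "s \<in> letters k")
    case True
    then obtain u where u: "s = Ix k u" "u \<in> omega_vertices k" by auto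
    then show ?thesis
      using racg_eq.square[of "unindex k x" "omega_vertices k" "unindex k y" u "omega_edges k"] unindex_lists
      by (simp add: unindex_def image_iff)
  next
    case False
    then have "unindex k (x @ [s, s] @ y) = unindex k (x @ y)" by (simp add: unindex_def)
    then show ?thesis using racg_eq.refl[OF unindex_lists[of k "x @ y"]] by simp
  qed
next
  case (commute s t x y)
  show ?case
  proof (cases "s \<in> letters k \<and> t \<in> letters k")
    case True
    then obtain u v where uv: "s = Ix k u" "u \<in> omega_vertices k" "t = Ix k v" "v \<in> omega_vertices k" by auto
    then show ?thesis
      using racg_eq.commute[of "unindex k x" "omega_vertices k" "unindex k y" u v "omega_edges k"] unindex_lists commute
      by (simp add: unindex_def image_iff)
  next
    case False
    then have "unindex k (x @ [s, t] @ y) = unindex k (x @ [t, s] @ y)" by (auto simp: unindex_def)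
    then show ?thesis using racg_eq.refl[OF unindex_lists[of k "x @ [t, s] @ y"]] by simp
  qed
next
  case (refl x)
  show ?case by (rule racg_eq.refl[OF unindex_lists])
qed (blast intro: racg_eq.sym racg_eq.trans)+

text \<open>By \<open>racg_eq_word\<close> any representative serves. The map is an isomorphism from
  \<open>G_omega k\<close> onto \<open>sp (letters k)\<close> when k \<ge> 1.\<close>

definition embed :: "nat \<Rightarrow> omega_vertex list set \<Rightarrow> indexed_vertex rac" where
  "embed k X = word (map (Ix k) (SOME x. x \<in> X))"

lemma embed_class:
  assumes "x \<in> lists (omega_vertices k)" shows "embed k (omega_rel k `` {x}) = word (map (Ix k) x)"
proof -
  have "x \<in> omega_rel k `` {x}" using assms by (simp add: racg_rel_def racg_eq.refl)
  then have "(SOME y. y \<in> omega_rel k `` {x}) \<in> omega_rel k `` {x}" by (rule someI)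
  then show ?thesis unfolding embed_def using racg_eq_word by (auto simp: racg_rel_def)
qed

lemma embed_mult:
  assumes "X \<in> carrier (G_omega k)" "Y \<in> carrier (G_omega k)"
  shows "embed k (X \<otimes>\<^bsub>G_omega k\<^esub> Y) = embed k X + embed k Y"
proof -
  obtain x y where "x \<in> lists (omega_vertices k)" "X = omega_rel k `` {x}" "y \<in> lists (omega_vertices k)" "Y = omega_rel k `` {y}"
    using assms unfolding G_omega_def by (elim racg_carrierE)
  then show ?thesis unfolding G_omega_def by (simp add: racg_mult_class embed_class word_append)
qed

lemma embed_sp: assumes "X \<in> carrier (G_omega k)" shows "embed k X \<in> sp (letters k)"
proof -
  obtain x where "x \<in> lists (omega_vertices k)" "X = omega_rel k `` {x}" using assms unfolding G_omega_def by (rule racg_carrierE)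
  then show ?thesis by (auto simp: embed_class in_lists_conv_set intro!: sp_word)
qed

lemma letters_word: assumes "set x \<subseteq> letters k" obtains y where "y \<in> lists (omega_vertices k)" "x = map (Ix k) y"
proof -
  have "\<exists>y. y \<in> lists (omega_vertices k) \<and> x = map (Ix k) y" using assms
  proof (induction x)
    case (Cons s x)
    then obtain y u where "y \<in> lists (omega_vertices k)" "x = map (Ix k) y" "s = Ix k u" "u \<in> omega_vertices k" by auto
    then show ?case by (intro exI[of _ "u # y"]) simp
  qed simp
  with that show thesis by blast
qed

lemma embed_onto:
  assumes "w \<in> sp (letters k)" obtains X where "X \<in> carrier (G_omega k)" "embed k X = w"
proof -
  obtain x where "set x \<subseteq> letters k" "w = word x" using assms by (rule spE)
  then obtain y where y: "y \<in> lists (omega_vertices k)" "w = word (map (Ix k) y)" by (metis letters_word)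
  then show thesis using that[of "omega_rel k `` {y}"] racg_carrierI[OF y(1)] by (simp add: embed_class G_omega_def)
qed

lemma embed_inj:
  assumes "1 \<le> k" "X \<in> carrier (G_omega k)" "Y \<in> carrier (G_omega k)" "embed k X = embed k Y" shows "X = Y"
proof -
  obtain x y where xy: "x \<in> lists (omega_vertices k)" "X = omega_rel k `` {x}" "y \<in> lists (omega_vertices k)" "Y = omega_rel k `` {y}"
    using assms(2,3) unfolding G_omega_def by (elim racg_carrierE)
  then have "rac_eq (map (Ix k) x) (map (Ix k) y)" using assms(4) by (simp add: embed_class word_eq_iff)
  then have "racg_eq (omega_vertices k) (omega_edges k) x y" using rac_eq_unindex[OF assms(1)] xy unindex_map by metis
  then show ?thesis using xy racg_class_eq by metis
qed

lemma G_omega_model: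
  assumes k: "1 \<le> k" and T: "finite_generating_set (G_omega k) T"
  obtains \<psi> K where "coarse_model (cayley_points (G_omega k) T) (cayley_dist (G_omega k) T) \<psi> (letters k) K"
proof -
  let ?G = "G_omega k"
  have G: "group ?G" by (simp add: G_omega_def group_racg)
  interpret group ?G by (rule G)
  interpret metric_graph "carrier ?G" "cayley_edges ?G T" by (rule cayley_metric_graph[OF G T])
  let ?M = "graph_points (carrier ?G) (cayley_edges ?G T)" and ?d = "graph_dist (carrier ?G) (cayley_edges ?G T)"
  have TG: "T \<subseteq> carrier ?G" "finite T" using T by (auto simp: finite_generating_set_def)
  text \<open>\<open>C1\<close> bounds the lengths of the elements of \<open>T\<close>, and \<open>C2\<close> those of the standard generators with respect to \<open>T\<close>.\<close>
  define C1 where "C1 = (\<Sum>t\<in>T. len (embed k t))"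
  have C1: "len (embed k t) \<le> C1" if "t \<in> T" for t unfolding C1_def using TG(2) that by (intro member_le_sum) auto
  have embed_edge: "wd (embed k u) (embed k v) \<le> C1" if "(u, v) \<in> adj_rel" for u v
  proof -
    have e: "{u, v} \<in> cayley_edges ?G T" using that by (simp add: adj_rel_def)
    have *: "wd (embed k g) (embed k (g \<otimes>\<^bsub>?G\<^esub> s)) \<le> C1" if "g \<in> carrier ?G" "s \<in> T" for g s
    proof -
      have "s \<in> carrier ?G" using that TG by auto
      then show ?thesis using C1[OF that(2)] by (simp add: embed_mult[OF that(1)] wd_def flip: add.assoc)
    qed
    from e obtain g s where "{u, v} = {g, g \<otimes>\<^bsub>?G\<^esub> s}" "g \<in> carrier ?G" "s \<in> T" by (auto simp: cayley_edges_def)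
    then show ?thesis using *[of g s] wd_sym[of "embed k u" "embed k v"] by (auto simp: doubleton_eq_iff)
  qed
  have embed_relpow: "wd (embed k u) (embed k v) \<le> C1 * n" if "(u, v) \<in> adj_rel ^^ n" for u v n
    using that
  proof (induction n arbitrary: v)
    case (Suc n)
    then obtain w where "(u, w) \<in> adj_rel ^^ n" "(w, v) \<in> adj_rel" by auto
    then show ?case using Suc.IH[of w] embed_edge[of w v] wd_triangle[of "embed k u" "embed k v" "embed k w"] by simp
  qed simp
  have upper: "real (wd (embed k u) (embed k v)) \<le> C1 * ?d (vert u) (vert v)" if "u \<in> carrier ?G" "v \<in> carrier ?G" for u v
    using embed_relpow[OF walk_dist_relpow[OF that]] unfolding dist_vert[OF that] by (simp flip: of_nat_mult)
  have "\<forall>s\<in>omega_vertices k. \<exists>n::nat. \<forall>g\<in>carrier ?G. ?d (vert g) (vert (g \<otimes>\<^bsub>?G\<^esub> (omega_rel k `` {[s]}))) \<le> n"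
  proof
    fix s assume "s \<in> omega_vertices k"
    then have "omega_rel k `` {[s]} \<in> carrier ?G" using racg_carrierI[of "[s]"] by (simp add: G_omega_def)
    from cayley_dist_translate[OF G T this]
    show "\<exists>n::nat. \<forall>g\<in>carrier ?G. ?d (vert g) (vert (g \<otimes>\<^bsub>?G\<^esub> (omega_rel k `` {[s]}))) \<le> n"
      by (simp add: cayley_dist_def)
  qed
  then obtain c where c: "\<And>s g. s \<in> omega_vertices k \<Longrightarrow> g \<in> carrier ?G \<Longrightarrow> ?d (vert g) (vert (g \<otimes>\<^bsub>?G\<^esub> (omega_rel k `` {[s]}))) \<le> real (c s)"
    by metis
  define C2 where "C2 = (\<Sum>s\<in>omega_vertices k. c s)"
  have C2: "?d (vert g) (vert (g \<otimes>\<^bsub>?G\<^esub> (omega_rel k `` {[s]}))) \<le> real C2" if "s \<in> omega_vertices k" "g \<in> carrier ?G" for s g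
  proof -
    have "c s \<le> C2" unfolding C2_def using finite_omega_vertices that(1) by (intro member_le_sum) auto
    then show ?thesis using c[OF that] by simp
  qed
  have word_dist: "?d (vert g) (vert (g \<otimes>\<^bsub>?G\<^esub> (omega_rel k `` {x}))) \<le> real (C2 * length x)"
    if "x \<in> lists (omega_vertices k)" "g \<in> carrier ?G" for x g
    using that
  proof (induction x arbitrary: g)
    case Nil
    have "omega_rel k `` {[]} = \<one>\<^bsub>?G\<^esub>" by (simp add: G_omega_def racg_one)
    then show ?case using Nil vert_points by simp
  next
    case (Cons s x)
    let ?s = "omega_rel k `` {[s]}" and ?x = "omega_rel k `` {x}"
    have s: "s \<in> omega_vertices k" "x \<in> lists (omega_vertices k)" using Cons.hyps by simp_all
    have sx: "?s \<in> carrier ?G" "?x \<in> carrier ?G"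
      using racg_carrierI[of "[s]"] racg_carrierI[of x] s by (simp_all add: G_omega_def)
    have "omega_rel k `` {s # x} = ?s \<otimes>\<^bsub>?G\<^esub> ?x"
      using s racg_mult_class[of "[s]" "omega_vertices k" x "omega_edges k"] by (simp add: G_omega_def)
    then have eq: "g \<otimes>\<^bsub>?G\<^esub> (omega_rel k `` {s # x}) = g \<otimes>\<^bsub>?G\<^esub> ?s \<otimes>\<^bsub>?G\<^esub> ?x" using sx Cons.prems by (simp add: m_assoc)
    have "?d (vert g) (vert (g \<otimes>\<^bsub>?G\<^esub> ?s \<otimes>\<^bsub>?G\<^esub> ?x)) \<le> ?d (vert g) (vert (g \<otimes>\<^bsub>?G\<^esub> ?s)) + ?d (vert (g \<otimes>\<^bsub>?G\<^esub> ?s)) (vert (g \<otimes>\<^bsub>?G\<^esub> ?s \<otimes>\<^bsub>?G\<^esub> ?x))"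
      using sx Cons.prems vert_points by (intro triangle) auto
    also have "\<dots> \<le> real C2 + real (C2 * length x)"
      using sx Cons.prems s by (intro add_mono C2 Cons.IH) auto
    finally show ?case unfolding eq by (simp add: algebra_simps)
  qed
  have lower: "?d (vert u) (vert v) \<le> C2 * real (wd (embed k u) (embed k v))" if uv: "u \<in> carrier ?G" "v \<in> carrier ?G" for u v
  proof -
    have "- embed k u + embed k v \<in> sp (letters k)" using embed_sp uv by (simp add: sp_add sp_uminus)
    then obtain xs where xs: "- embed k u + embed k v = word xs" "set xs \<subseteq> letters k" "length xs = wd (embed k u) (embed k v)"
      unfolding wd_def by (rule sp_geodesic_word)
    obtain x where x: "x \<in> lists (omega_vertices k)" "xs = map (Ix k) x" by (rule letters_word[OF xs(2)])
    have cx: "omega_rel k `` {x} \<in> carrier ?G" using racg_carrierI[OF x(1)] by (simp add: G_omega_def)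
    have "embed k (u \<otimes>\<^bsub>?G\<^esub> (omega_rel k `` {x})) = embed k u + (- embed k u + embed k v)"
      using uv cx x xs(1) by (simp add: embed_mult embed_class)
    also have "\<dots> = embed k v" by (simp flip: add.assoc)
    finally have "u \<otimes>\<^bsub>?G\<^esub> (omega_rel k `` {x}) = v" using uv cx by (intro embed_inj[OF k]) auto
    then show ?thesis using word_dist[OF x(1) uv(1)] xs(3) x(2) by simp
  qed
  \<comment> \<open>Points inside edges are moved to a vertex at distance at most 1, which costs 2
    in each distance estimate.\<close>
  define nv where "nv x = (SOME v. v \<in> carrier ?G \<and> ?d x (vert v) \<le> 1)" for x
  have nv: "nv x \<in> carrier ?G" "?d x (vert (nv x)) \<le> 1" if "x \<in> ?M" for x
    using someI_ex[of "\<lambda>v. v \<in> carrier ?G \<and> ?d x (vert v) \<le> 1"] near_vert[OF that] unfolding nv_def by auto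
  have nv_dist: "?d (vert (nv x)) (vert (nv y)) \<le> ?d x y + 2" "?d x y \<le> ?d (vert (nv x)) (vert (nv y)) + 2" if "x \<in> ?M" "y \<in> ?M" for x y
    using nv[OF that(1)] nv[OF that(2)] that vert_points commute[of x "vert (nv x)"] commute[of y "vert (nv y)"]
      triangle[of "vert (nv x)" x "vert (nv y)"] triangle[of x y "vert (nv y)"]
      triangle[of x "vert (nv x)" y] triangle[of "vert (nv x)" "vert (nv y)" y] by auto
  define K where "K = 2 * C1 + C2 + 2"
  have "coarse_model ?M ?d (\<lambda>x. embed k (nv x)) (letters k) K"
  proof
    show "1 \<le> K" by (simp add: K_def)
    fix x assume x: "x \<in> ?M"
    show "embed k (nv x) \<in> sp (letters k)" using nv(1)[OF x] by (rule embed_sp)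
    fix y assume y: "y \<in> ?M"
    have "real (wd (embed k (nv x)) (embed k (nv y))) \<le> C1 * ?d (vert (nv x)) (vert (nv y))" using upper nv x y by blast
    also have "\<dots> \<le> C1 * (?d x y + 2)" using nv_dist(1)[OF x y] by (intro mult_left_mono) auto
    also have "\<dots> = C1 * ?d x y + 2 * C1" by (simp add: algebra_simps)
    also have "\<dots> \<le> K * ?d x y + K" by (intro add_mono mult_right_mono) (simp_all add: K_def)
    finally show "real (wd (embed k (nv x)) (embed k (nv y))) \<le> K * ?d x y + K" .
    have "?d x y \<le> C2 * real (wd (embed k (nv x)) (embed k (nv y))) + 2" using nv_dist(2)[OF x y] lower[OF nv(1)[OF x] nv(1)[OF y]] by linarith
    also have "\<dots> \<le> K * real (wd (embed k (nv x)) (embed k (nv y))) + K" by (intro add_mono mult_right_mono) (simp_all add: K_def)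
    finally show "?d x y \<le> K * real (wd (embed k (nv x)) (embed k (nv y))) + K" .
    show "\<exists>l\<le>?d x y + 1. joined ?M l x y" using graph_length_space[OF x y] .
  next
    fix w assume "w \<in> sp (letters k)"
    then obtain X where X: "X \<in> carrier ?G" "embed k X = w" by (rule embed_onto)
    have M: "vert X \<in> ?M" using vert_points X by blast
    have "real C1 * ?d (vert X) (vert (nv (vert X))) \<le> real C1 * 1" using nv(2)[OF M] by (intro mult_left_mono) auto
    then have "real (wd (embed k X) (embed k (nv (vert X)))) \<le> C1" using upper[OF X(1) nv(1)[OF M]] by simp
    then have "wd (embed k (nv (vert X))) w \<le> K" using X(2) wd_sym[of w] by (simp add: K_def)
    then show "\<exists>x\<in>?M. wd (embed k (nv x)) w \<le> K" using M by blast
  qed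
  then show thesis using that unfolding cayley_points_def cayley_dist_def by blast
qed

text \<open>Transfers the model of a group to a Cayley graph of another group that is
  quasi-isometric to it; the length space property comes from \<open>X\<close> itself.\<close>

lemma coarse_model_compose:
  assumes Y: "coarse_model Y dY \<psi> A K" and X: "Metric_space X dX"
    and len: "\<And>x y. x \<in> X \<Longrightarrow> y \<in> X \<Longrightarrow> \<exists>l\<le>dX x y + 1. Metric_space.joined X dX X l x y"
    and qi: "quasi_isometric X dX Y dY"
  obtains \<psi>' K' where "coarse_model X dX \<psi>' A K'"
proof -
  interpret Y: coarse_model Y dY \<psi> A K by fact
  interpret X: Metric_space X dX by fact
  obtain f P L where f: "f \<in> X \<rightarrow> Y" "P \<ge> 1" "L \<ge> 0"
    "\<And>x y. x \<in> X \<Longrightarrow> y \<in> X \<Longrightarrow> 1 / P * dX x y - L \<le> dY (f x) (f y)"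
    "\<And>x y. x \<in> X \<Longrightarrow> y \<in> X \<Longrightarrow> dY (f x) (f y) \<le> P * dX x y + L"
    "\<And>y. y \<in> Y \<Longrightarrow> \<exists>x\<in>X. dY (f x) y \<le> L"
    using qi unfolding quasi_isometric_def by blast
  define K' where "K' = nat \<lceil>K * P + (K + P) * (K + L + 1)\<rceil> + 2 * K"
  have KP: "0 \<le> K * P" "0 \<le> K * L" "0 \<le> P * L" using f by auto
  have bound: "K * P + (K + P) * (K + L + 1) + K \<le> real K'"
    using real_nat_ceiling_ge[of "K * P + (K + P) * (K + L + 1)"] unfolding K'_def by simp
  have eq: "K * P + (K + P) * (K + L + 1) = 2 * (K * P) + (real K * real K + K * L + P * L + K + P)"
    "P * (K + L) = K * P + P * L" by (simp_all add: algebra_simps)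
  have K0: "0 \<le> real K * real K" "0 \<le> real K" by simp_all
  have K': "K * P \<le> real K'" "K * L + K \<le> real K'" "P * (K + L) \<le> real K'"
    using bound KP f(2) K0 unfolding eq by linarith+
  have fY: "f x \<in> Y" if "x \<in> X" for x using f(1) that by auto
  have "coarse_model X dX (\<lambda>x. \<psi> (f x)) A K'"
  proof
    show "1 \<le> K'" using Y.K by (simp add: K'_def)
    fix x assume x: "x \<in> X"
    show "\<psi> (f x) \<in> sp A" using fY[OF x] by (rule Y.\<psi>_sp)
    fix y assume y: "y \<in> X"
    have "real (wd (\<psi> (f x)) (\<psi> (f y))) \<le> K * dY (f x) (f y) + K" using Y.\<psi>_upper fY x y by blast
    also have "\<dots> \<le> K * (P * dX x y + L) + K" using f(5)[OF x y] by (intro add_right_mono mult_left_mono) auto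
    also have "\<dots> = (K * P) * dX x y + (K * L + K)" by (simp add: algebra_simps)
    also have "\<dots> \<le> K' * dX x y + K'" using K' by (intro add_mono mult_right_mono) auto
    finally show "real (wd (\<psi> (f x)) (\<psi> (f y))) \<le> K' * dX x y + K'" .
    have "dX x y \<le> P * (dY (f x) (f y) + L)" using f(2) f(4)[OF x y] by (simp add: field_simps)
    also have "\<dots> \<le> P * (K * real (wd (\<psi> (f x)) (\<psi> (f y))) + K + L)"
      using Y.\<psi>_lower[OF fY[OF x] fY[OF y]] f(2) by (intro mult_left_mono add_right_mono) auto
    also have "\<dots> = (K * P) * real (wd (\<psi> (f x)) (\<psi> (f y))) + P * (K + L)" by (simp add: algebra_simps)
    also have "\<dots> \<le> K' * real (wd (\<psi> (f x)) (\<psi> (f y))) + K'" using K' by (intro add_mono mult_right_mono) auto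
    finally show "dX x y \<le> K' * real (wd (\<psi> (f x)) (\<psi> (f y))) + K'" .
    show "\<exists>l\<le>dX x y + 1. X.joined X l x y" using len[OF x y] .
  next
    fix w assume "w \<in> sp A"
    then obtain y where y: "y \<in> Y" "wd (\<psi> y) w \<le> K" using Y.\<psi>_onto by blast
    obtain x where x: "x \<in> X" "dY (f x) y \<le> L" using f(6)[OF y(1)] by blast
    have "K * dY (f x) y + K \<le> K * L + K" using x(2) by (intro add_right_mono mult_left_mono) auto
    then have "real (wd (\<psi> (f x)) (\<psi> y)) \<le> K * L + K" using Y.\<psi>_upper[OF fY[OF x(1)] y(1)] by linarith
    then have "real (wd (\<psi> (f x)) (\<psi> y)) + K \<le> real K'"
      using bound KP f(2) K0 unfolding eq by linarith
    then have "wd (\<psi> (f x)) w \<le> K'" using wd_triangle[of "\<psi> (f x)" w "\<psi> y"] y(2) by linarith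
    then show "\<exists>x\<in>X. wd (\<psi> (f x)) w \<le> K'" using x(1) by blast
  qed
  then show thesis by (rule that)
qed

section \<open>Degrees in the divergence spectrum\<close>

text \<open>Members of the spectrum are extensional on [0, \<infinity>), hence the restriction,
  which \<open>fun_equiv\<close> does not notice.\<close>

lemma spectrum_of_geodesic:
  assumes "Metric_space.geodesic M d UNIV \<gamma>" "Metric_space.Morse M d UNIV \<gamma>" "Metric_space M d"
  shows "restrict (Metric_space.lower_divergence M d \<gamma>) {0..} \<in> Metric_space.divergence_spectrum M d"
    and "fun_equiv (restrict (Metric_space.lower_divergence M d \<gamma>) {0..}) (Metric_space.lower_divergence M d \<gamma>)"
proof -
  interpret Metric_space M d by fact
  have *: "f x \<le> ennreal 1 * f (1 * x) + ennreal (1 * x)" for f :: "real \<Rightarrow> ennreal" and x by (simp add: add_increasing2)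
  show eq: "fun_equiv (restrict (lower_divergence \<gamma>) {0..}) (lower_divergence \<gamma>)"
    unfolding fun_equiv_def using *[of "lower_divergence \<gamma>"]
    by (auto intro!: fun_preceqI[of 1 1 1 1])
  show "restrict (lower_divergence \<gamma>) {0..} \<in> divergence_spectrum"
    unfolding divergence_spectrum_def using assms eq by auto
qed

lemma cayley_spectrum_degree:
  assumes G: "group G" "finite_generating_set G T" and k: "2 \<le> k"
    and model: "coarse_model (cayley_points G T) (cayley_dist G T) \<psi> (letters k) K"
  shows "\<exists>f\<in>cayley_divergence_spectrum G T. fun_preceq (power_fun k) f \<and> fun_preceq f (power_fun k)"
proof -
  interpret metric_graph "carrier G" "cayley_edges G T" by (rule cayley_metric_graph[OF G])
  let ?M = "graph_points (carrier G) (cayley_edges G T)" and ?d = "graph_dist (carrier G) (cayley_edges G T)"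
  interpret X: coarse_model ?M ?d \<psi> "letters k" K using model unfolding cayley_points_def cayley_dist_def .
  interpret X: omega_graph ?M ?d \<psi> K k "vert ` carrier G"
  proof
    show "1 \<le> k" using k by simp
    show "vert ` carrier G \<subseteq> ?M" using vert_points by auto
    show "\<exists>v\<in>vert ` carrier G. ?d x v \<le> 1" if "x \<in> ?M" for x using near_vert[OF that] by blast
  qed (rule vert_geodesic, assumption+, rule vert_limit, assumption+)
  obtain \<alpha> where \<alpha>: "geodesic UNIV \<alpha>" "Morse UNIV \<alpha>"
    "fun_preceq (power_fun k) (lower_divergence \<alpha>)" "fun_preceq (lower_divergence \<alpha>) (power_fun k)"
    by (rule X.axis_exists[OF k])
  note sp = spectrum_of_geodesic[OF \<alpha>(1,2) metric]
  show ?thesis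
    using sp \<alpha>(3,4) unfolding cayley_divergence_spectrum_def cayley_points_def cayley_dist_def fun_equiv_def
    by (meson fun_preceq_trans)
qed

text \<open>Since \<open>e\<close> is arbitrary, no member of the spectrum has a polynomial degree
  above k.\<close>

lemma cayley_spectrum_gap:
  assumes k: "1 \<le> k" and model: "coarse_model (cayley_points G T) (cayley_dist G T) \<psi> (letters k) K"
    and f: "f \<in> cayley_divergence_spectrum G T"
  shows "fun_preceq f (power_fun k) \<or> fun_preceq (power_fun e) f"
proof -
  interpret X: coarse_model "cayley_points G T" "cayley_dist G T" \<psi> "letters k" K by fact
  interpret X: omega_model "cayley_points G T" "cayley_dist G T" \<psi> K k by standard (rule k)
  obtain \<gamma> where \<gamma>: "X.geodesic UNIV \<gamma>" "X.Morse UNIV \<gamma>" "fun_equiv f (X.lower_divergence \<gamma>)"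
    using f unfolding cayley_divergence_spectrum_def X.divergence_spectrum_def by auto
  obtain N where N: "X.tracked \<gamma> N" by (rule X.Morse_tracked[OF \<gamma>(1,2)])
  show ?thesis
  proof (cases "X.runs_along (Gam k) \<gamma> N")
    case True
    then show ?thesis using X.runs_along_upper[OF \<gamma>(1)] \<gamma>(3) fun_preceq_trans unfolding fun_equiv_def by blast
  next
    case False
    then show ?thesis using X.tracked_dichotomy[OF \<gamma>(1) N] \<gamma>(3) fun_preceq_trans unfolding fun_equiv_def by blast
  qed
qed

text \<open>The degree k' occurs for \<open>H\<close>, but in the spectrum of \<open>G\<close> it
  would have to be at most k or at least k' + 1. The two Cayley graphs may coincide, with models of
  different groups.\<close>

lemma spectra_differ:
  assumes k: "1 \<le> k" "k < k'"
    and G: "coarse_model (cayley_points G T) (cayley_dist G T) \<psi> (letters k) K"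
    and H: "group H" "finite_generating_set H U" "coarse_model (cayley_points H U) (cayley_dist H U) \<psi>' (letters k') K'"
  shows "cayley_divergence_spectrum G T \<noteq> cayley_divergence_spectrum H U"
proof
  assume eq: "cayley_divergence_spectrum G T = cayley_divergence_spectrum H U"
  have "2 \<le> k'" using k by simp
  then obtain f where f: "f \<in> cayley_divergence_spectrum H U" "fun_preceq (power_fun k') f" "fun_preceq f (power_fun k')"
    using cayley_spectrum_degree[OF H(1,2) _ H(3)] by blast
  from cayley_spectrum_gap[OF k(1) G, of f "Suc k'"] f(1) eq
  consider "fun_preceq f (power_fun k)" | "fun_preceq (power_fun (Suc k')) f" by auto
  then show False
  proof cases
    case 1
    then have "fun_preceq (power_fun k') (power_fun k)" using f(2) fun_preceq_trans by blast
    then show False using power_fun_strict[of k k'] k by simp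
  next
    case 2
    then have "fun_preceq (power_fun (Suc k')) (power_fun k')" using f(3) fun_preceq_trans by blast
    then show False using power_fun_strict[of k' "Suc k'"] k by simp
  qed
qed

theorem theorem1p3:
  fixes d1 d2 :: nat
  assumes "1 \<le> d1" and "1 \<le> d2" and "d1 \<noteq> d2"
  shows "(\<forall>T1 T2. finite_generating_set (G_omega d1) T1 \<longrightarrow> finite_generating_set (G_omega d2) T2 \<longrightarrow>
            cayley_divergence_spectrum (G_omega d1) T1 \<noteq> cayley_divergence_spectrum (G_omega d2) T2)
       \<and> \<not> groups_quasi_isometric (G_omega d1) (G_omega d2)"
proof (intro conjI allI impI notI)
  have grp: "group (G_omega d)" for d by (simp add: G_omega_def group_racg)
  fix T1 T2
  assume T: "finite_generating_set (G_omega d1) T1" "finite_generating_set (G_omega d2) T2"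
    and eq: "cayley_divergence_spectrum (G_omega d1) T1 = cayley_divergence_spectrum (G_omega d2) T2"
  obtain \<psi>1 K1 where 1: "coarse_model (cayley_points (G_omega d1) T1) (cayley_dist (G_omega d1) T1) \<psi>1 (letters d1) K1"
    by (rule G_omega_model[OF assms(1) T(1)])
  obtain \<psi>2 K2 where 2: "coarse_model (cayley_points (G_omega d2) T2) (cayley_dist (G_omega d2) T2) \<psi>2 (letters d2) K2"
    by (rule G_omega_model[OF assms(2) T(2)])
  show False
    using spectra_differ[OF assms(1) _ 1 grp T(2) 2] spectra_differ[OF assms(2) _ 2 grp T(1) 1] eq assms(3)
    by (metis linorder_neq_iff)
next
  have grp: "group (G_omega d)" for d by (simp add: G_omega_def group_racg)
  assume "groups_quasi_isometric (G_omega d1) (G_omega d2)"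
  then obtain T U where T: "finite_generating_set (G_omega d1) T" "finite_generating_set (G_omega d2) U"
    and qi: "quasi_isometric (cayley_points (G_omega d1) T) (cayley_dist (G_omega d1) T) (cayley_points (G_omega d2) U) (cayley_dist (G_omega d2) U)"
    unfolding groups_quasi_isometric_def by blast
  obtain \<psi>1 K1 where 1: "coarse_model (cayley_points (G_omega d1) T) (cayley_dist (G_omega d1) T) \<psi>1 (letters d1) K1"
    by (rule G_omega_model[OF assms(1) T(1)])
  obtain \<psi>2 K2 where 2: "coarse_model (cayley_points (G_omega d2) U) (cayley_dist (G_omega d2) U) \<psi>2 (letters d2) K2"
    by (rule G_omega_model[OF assms(2) T(2)])
  \<comment> \<open>Now one Cayley graph models both groups, and \<open>spectra_differ\<close> says
    that its spectrum differs from itself.\<close>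
  obtain \<psi>3 K3 where 3: "coarse_model (cayley_points (G_omega d1) T) (cayley_dist (G_omega d1) T) \<psi>3 (letters d2) K3"
    by (rule coarse_model_compose[OF 2 metric_space_cayley[OF grp T(1)] coarse_model.length_space[OF 1] qi])
  show False
    using spectra_differ[OF assms(1) _ 1 grp T(1) 3] spectra_differ[OF assms(2) _ 3 grp T(1) 1] assms(3)
    by (metis linorder_neq_iff)
qed

end
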